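(* Fix $\alpha\in(0,1)$ and let $\{\eta^n_t\}_{t\ge 0}$ be the symmetric simple exclusion process on $\mathcal{X}_n=\{0,1\}^{\mathbb{T}_n}$, accelerated by $n^2$ (generator $\mathcal{L}_n$ defined in the context), with empirical measures $\pi^n_t=\frac1n\sum_{i\in\mathbb{T}_n}\eta^n_t(i)\,\delta_{i/n}$ on $\mathbb{T}$. Fix a density profile $m_0:\mathbb{T}\to[0,1]$ and let $(\mu^n)$ be a sequence of probability measures on $\mathcal{X}_n$ such that, for any $\delta>0$ and any smooth function $G:\mathbb{T}\to\mathbb{R}$, $$\limsup_{n\to\infty}\mu^n\bigg[\Big|\frac1n\sum_{i\in\mathbb{T}_n}G(i/n)\,\eta(i)-\int_{\mathbb{T}}G(\theta)m_0(\theta)\,d\theta\Big|>\delta\bigg]=0.$$ Assume moreover that $$\lim_{n\to\infty}\frac1n\operatorname{Ent}_{\nu^n_\alpha}(\mu^n)=\int_{\mathbb{T}}h(m_0(\theta))\,d\theta-h\Big(\int_{\mathbb{T}}m_0(\theta)\,d\theta\Big).$$ Let the process $\{\eta^n_t\}_{t\ge0}$ start from the initial law $\mu^n$, and denote by $\mu^n_t$ the law of $\eta^n_t$. Let $m$ be the solution to the heat equation $\frac{\partial m}{\partial t}=\frac{\partial^2 m}{\partial\theta^2}$ on $\mathbb{R}_+\times\mathbb{T}$ with initial condition $m(0,\cdot)=m_0$. Then, for any $t>0$, the sequence $(\pi^n_t)_{n}$ converges in probability to the deterministic measure $m(t,\theta)\,d\theta$, that is, for every smooth $G:\mathbb{T}\to\mathbb{R}$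 and every $\delta>0$, $$\mathbb{P}_{\mu^n}\bigg[\Big|\frac1n\sum_{i\in\mathbb{T}_n}G(i/n)\,\eta^n_t(i)-\int_{\mathbb{T}}G(\theta)m(t,\theta)\,d\theta\Big|>\delta\bigg]\xrightarrow[n\to\infty]{}0,$$ and the entropy also converges: $$\lim_{n\to\infty}\frac1n\operatorname{Ent}_{\nu^n_\alpha}(\mu^n_t)=\int_{\mathbb{T}}h(m(t,\theta))\,d\theta-h\Big(\int_{\mathbb{T}}m(t,\theta)\,d\theta\Big).$$
   Context: $\mathbb{T}_n=\{0,\dots,n-1\}$ is the discrete one-dimensional torus (indices modulo $n$) and $\mathbb{T}=[0,1)$ is the continuous one-dimensional torus. For $\eta\in\mathcal{X}_n=\{0,1\}^{\mathbb{T}_n}$, $\eta(i)=1$ means that site $i$ is occupied by a particle and $\eta(i)=0$ that it is empty; $\eta^{i,j}$ is the configuration obtained from $\eta$ by exchanging the occupation variables $\eta(i)$ and $\eta(j)$. The symmetric simple exclusion process in the diffusive time scale is the continuous-time Markov process on $\mathcal{X}_n$ with generator, for $f:\mathcal{X}_n\to\mathbb{R}$, $$\mathcal{L}_n f(\eta)=n^2\sum_{i\in\mathbb{T}_n}\big[\eta(i)(1-\eta(i+1))+\eta(i+1)(1-\eta(i))\big]\big(f(\eta^{i,i+1})-f(\eta)\big).$$ $\mathbb{P}_{\mu^n}$ denotes the probability law of the process started from the initial law $\mu^n$. $\nu^n_\alpha$ is the Bernoulli product measure on $\mathcal{X}_n$ with parameter $\alpha$: under it the variables $\eta(i)$ are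 independent with $\nu^n_\alpha\{\eta(i)=1\}=\alpha=1-\nu^n_\alpha\{\eta(i)=0\}$. It is invariant for the dynamics. For a probability measure $\mu$ on $\mathcal{X}_n$ with density $\rho$ with respect to $\nu^n_\alpha$, the relative entropy is $\operatorname{Ent}_{\nu^n_\alpha}(\mu)=\sum_{\eta\in\mathcal{X}_n}\nu^n_\alpha(\eta)\rho(\eta)\log\rho(\eta)$, with the convention $0\log0=0$. The function $h:[0,1]\to\mathbb{R}$ is $h(x)=x\log x+(1-x)\log(1-x)$, with $0\log 0=0$. *)

theory Defs
  imports "HOL-Probability.Probability"
begin

section \<open>Functions on the continuous torus\<close>

text \<open>A function on the torus \<open>[0,1)\<close> is represented by its 1-periodic extension to \<open>\<real>\<close>;
  integrals over the torus are integrals over \<open>{0..<1}\<close>.\<close>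

definition torus_periodic :: "(real \<Rightarrow> real) \<Rightarrow> bool" where
  "torus_periodic g \<longleftrightarrow> (\<forall>\<theta>. g (\<theta> + 1) = g \<theta>)"

definition torus_integral :: "(real \<Rightarrow> real) \<Rightarrow> real" where
  "torus_integral g = (LINT \<theta>:{0..<1}|lborel. g \<theta>)"

definition torus_smooth :: "(real \<Rightarrow> real) \<Rightarrow> bool" where
  "torus_smooth g \<longleftrightarrow> torus_periodic g \<and> (\<forall>k \<theta>. ((deriv ^^ k) g) differentiable (at \<theta>))"

definition density_profile :: "(real \<Rightarrow> real) \<Rightarrow> bool" where
  "density_profile g \<longleftrightarrow>
     torus_periodic g \<and> g \<in> borel_measurable borel \<and> (\<forall>\<theta>. 0 \<le> g \<theta> \<and> g \<theta> \<le> 1)"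

text \<open>\<open>m\<close> solves \<open>\<partial>\<^sub>t m = \<partial>\<^sub>\<theta>\<^sub>\<theta> m\<close> with initial condition \<open>m\<^sub>0\<close>: it is a classical
  solution at positive times (once continuously differentiable in \<open>t\<close>, twice in \<open>\<theta>\<close>). As \<open>m\<^sub>0\<close> is merely
  bounded and measurable, continuity of \<open>m\<close> at time 0 is required in \<open>L\<^sup>1\<close> of the torus;
  the values \<open>m t \<theta>\<close> with \<open>t < 0\<close> play no role.\<close>

definition heat_solution :: "(real \<Rightarrow> real) \<Rightarrow> (real \<Rightarrow> real \<Rightarrow> real) \<Rightarrow> bool" where
  "heat_solution m0 m \<longleftrightarrow>
     (\<forall>t\<ge>0. torus_periodic (m t)) \<and>
     (\<exists>m_t m_x m_xx.
        (\<forall>t>0. \<forall>\<theta>.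
           ((\<lambda>s. m s \<theta>) has_real_derivative m_t t \<theta>) (at t) \<and>
           ((\<lambda>x. m t x) has_real_derivative m_x t \<theta>) (at \<theta>) \<and>
           ((\<lambda>x. m_x t x) has_real_derivative m_xx t \<theta>) (at \<theta>) \<and>
           m_t t \<theta> = m_xx t \<theta>) \<and>
        continuous_on ({0<..} \<times> UNIV) (\<lambda>(t, \<theta>). m t \<theta>) \<and>
        continuous_on ({0<..} \<times> UNIV) (\<lambda>(t, \<theta>). m_t t \<theta>) \<and>
        continuous_on ({0<..} \<times> UNIV) (\<lambda>(t, \<theta>). m_x t \<theta>) \<and>
        continuous_on ({0<..} \<times> UNIV) (\<lambda>(t, \<theta>). m_xx t \<theta>)) \<and>
     (\<forall>\<theta>. m 0 \<theta> = m0 \<theta>) \<and>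
     ((\<lambda>t. torus_integral (\<lambda>\<theta>. \<bar>m t \<theta> - m0 \<theta>\<bar>)) \<longlongrightarrow> 0) (at_right 0)"

text \<open>Since \<open>ln 0 = 0\<close> in HOL, the convention \<open>0 log 0 = 0\<close> is automatic here and in the
  relative entropy below.\<close>

definition h :: "real \<Rightarrow> real" where
  "h x = x * ln x + (1 - x) * ln (1 - x)"


section \<open>Configurations and the exclusion generator\<close>

type_synonym config = "nat \<Rightarrow> nat"

definition configs :: "nat \<Rightarrow> config set" where
  "configs n = {..<n} \<rightarrow>\<^sub>E {0, 1}"

definition exchange :: "nat \<Rightarrow> nat \<Rightarrow> config \<Rightarrow> config" where
  "exchange i j \<eta> = \<eta>(i := \<eta> j, j := \<eta> i)"

definition ssep_generator :: "nat \<Rightarrow> (config \<Rightarrow> real) \<Rightarrow> config \<Rightarrow> real" where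
  "ssep_generator n f \<eta> =
     (real n)\<^sup>2 * (\<Sum>i<n. let j = (i + 1) mod n in
        (real (\<eta> i) * (1 - real (\<eta> j)) + real (\<eta> j) * (1 - real (\<eta> i))) *
        (f (exchange i j \<eta>) - f \<eta>))"

definition bernoulli_product :: "nat \<Rightarrow> real \<Rightarrow> config pmf" where
  "bernoulli_product n \<alpha> = Pi_pmf {..<n} undefined (\<lambda>_. map_pmf of_bool (bernoulli_pmf \<alpha>))"

text \<open>On the finite set \<open>S\<close>, the density of \<open>\<mu>\<close> with respect to \<open>\<nu>\<close> (which is to charge every
  point of \<open>S\<close>) is the quotient of the point masses.\<close>

definition relative_entropy :: "'s set \<Rightarrow> 's measure \<Rightarrow> 's measure \<Rightarrow> real" where
  "relative_entropy S \<nu> \<mu> =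
     (\<Sum>\<eta>\<in>S. let \<rho> = measure \<mu> {\<eta>} / measure \<nu> {\<eta>} in measure \<nu> {\<eta>} * (\<rho> * ln \<rho>))"


section \<open>Markov processes on a finite state space\<close>

text \<open>The semigroup \<open>exp (t L)\<close> as an exponential series; it converges at the points of a finite
  set \<open>S\<close> if the jumps described by \<open>L\<close> do not leave \<open>S\<close>.\<close>

definition markov_semigroup ::
  "(('s \<Rightarrow> real) \<Rightarrow> 's \<Rightarrow> real) \<Rightarrow> real \<Rightarrow> ('s \<Rightarrow> real) \<Rightarrow> 's \<Rightarrow> real" where
  "markov_semigroup L t f x = (\<Sum>k. t ^ k / fact k * (L ^^ k) f x)"

definition past :: "'s set \<Rightarrow> 'w measure \<Rightarrow> (real \<Rightarrow> 'w \<Rightarrow> 's) \<Rightarrow> real \<Rightarrow> 'w measure" where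
  "past S M X s = sigma (space M) {X u -` A \<inter> space M | u A. 0 \<le> u \<and> u \<le> s \<and> A \<subseteq> S}"

text \<open>\<open>X\<close>, defined on the probability space \<open>M\<close>, is a Markov process (for its natural
  filtration) on the finite set \<open>S\<close> with generator \<open>L\<close> and initial law \<open>\<mu>\<close>. Regularity of the
  paths is not demanded, so that every version of the process qualifies.\<close>

definition markov_process ::
  "'s set \<Rightarrow> (('s \<Rightarrow> real) \<Rightarrow> 's \<Rightarrow> real) \<Rightarrow> 's measure \<Rightarrow> 'w measure \<Rightarrow> (real \<Rightarrow> 'w \<Rightarrow> 's) \<Rightarrow> bool"
where
  "markov_process S L \<mu> M X \<longleftrightarrow>
     prob_space M \<and>
     (\<forall>t\<ge>0. X t \<in> M \<rightarrow>\<^sub>M count_space S) \<and>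
     distr M (count_space S) (X 0) = \<mu> \<and>
     (\<forall>s\<ge>0. \<forall>t\<ge>s. \<forall>f. AE \<omega> in M.
        real_cond_exp M (past S M X s) (\<lambda>\<omega>. f (X t \<omega>)) \<omega> = markov_semigroup L (t - s) f (X s \<omega>))"

text \<open>The pairing of the empirical measure, the sum of the masses \<open>\<eta> i / n\<close> at the points
  \<open>i / n\<close>, with the test function \<open>G\<close>.\<close>

definition empirical_mean :: "nat \<Rightarrow> config \<Rightarrow> (real \<Rightarrow> real) \<Rightarrow> real" where
  "empirical_mean n \<eta> G = (1 / real n) * (\<Sum>i<n. G (real i / real n) * real (\<eta> i))"

end

theory Submission
  imports Defs
begin

text \<open>
  Particle numbers at distinct sites are negatively correlated if the process starts from a fixed
  configuration, because the truncated correlations solve a linear equation with a nonpositive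
  source. Since the particle number is conserved, these correlations are summable. This yields the
  law of large numbers at time \<open>t\<close>, first for trigonometric test functions, which are eigenfunctions
  of both the discrete and the continuous Laplacian. Testing the equation of the correlations
  against \<open>d * (n - d)\<close>, where \<open>d\<close> is the distance of the two sites, shows moreover that the time
  integral of the sum of the nearest neighbour correlations is bounded uniformly in \<open>n\<close>.

  For the entropy, compare the law with the product measure of profile \<open>m\<close>, pushed away
  from \<open>0\<close> and \<open>1\<close> by a factor \<open>\<epsilon>\<close>. By Yau's inequality the growth of the relative entropy is at most the
  expectation of a sum over nearest neighbours of products of centred occupation variables, so the
  preceding bound makes it \<open>o(n)\<close>. Between a small time \<open>s\<close> and \<open>t\<close> the entropy relative to the Bernoulli
  measure therefore changes by at most the difference of the macroscopic entropies; the entropy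
  decreases on \<open>[0, s]\<close>, and \<open>s\<close> tends to \<open>0\<close>. The lower bound is the nonnegativity of the relative
  entropy, combined with Gibbs' inequality for the mean density.
\<close>

section \<open>The generator as a sum of site exchanges\<close>

text \<open>The initial profile is only measurable and may take the values 0 and 1, so neither its
  gradient nor \<open>1 / (\<rho> * (1 - \<rho>))\<close> is bounded. This is why the comparison
  starts at a positive time and uses the mixed profile: for fixed \<open>s\<close> and
  \<open>\<epsilon>\<close> the gradient bound \<open>K\<close> and the lower bound \<open>c\<close>
  of \<open>\<rho> * (1 - \<rho>)\<close> do not depend on \<open>n\<close>, and only then does
  \<open>n\<close> tend to infinity. The delicate term is the expectation of the products of centred
  variables at neighbouring sites. It splits into a correlation and the product of the deviations of
  the mean occupations from the profile. That product enters with a minus sign and is bounded from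
  above by squared gradients (\<open>neg_mult_le_of_diff\<close>), so the deviations themselves need
  not be small. The squared gradient of the mean occupations is, up to sign, the source of the
  correlation equation, and the derivative of \<open>corr_energy\<close> contains it together with
  the nearest neighbour correlations in exactly the combination that arises here. The price is
  bounded in \<open>n\<close>, hence negligible after division by \<open>n\<close>.\<close>

definition nxt :: "nat \<Rightarrow> nat \<Rightarrow> nat" where
  "nxt n i = (i + 1) mod n"

definition bond_swap :: "nat \<Rightarrow> nat \<Rightarrow> nat \<Rightarrow> nat" where
  "bond_swap n e = Transposition.transpose e (nxt n e)"

text \<open>Exchanging equal occupation variables has no effect, so the exclusion rule can be dropped
  and every bond exchanges its two variables at rate \<open>n\<^sup>2\<close>.\<close>

definition stirring :: "nat \<Rightarrow> (config \<Rightarrow> real) \<Rightarrow> config \<Rightarrow> real" where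
  "stirring n f \<eta> = (real n)\<^sup>2 * (\<Sum>e<n. f (\<eta> \<circ> bond_swap n e) - f \<eta>)"

abbreviation ssep_at :: "nat \<Rightarrow> real \<Rightarrow> (config \<Rightarrow> real) \<Rightarrow> config \<Rightarrow> real" where
  "ssep_at n t f x \<equiv> markov_semigroup (ssep_generator n) t f x"

lemma nxt_less: "n > 0 \<Longrightarrow> nxt n i < n"
  by (simp add: nxt_def)

lemma nxt_eq: "i < n \<Longrightarrow> nxt n i = (if i = n - 1 then 0 else i + 1)"
  by (auto simp: nxt_def)

lemma nxt_neq: "2 \<le> n \<Longrightarrow> i < n \<Longrightarrow> nxt n i \<noteq> i"
  by (auto simp: nxt_eq)

lemma inj_on_nxt: "inj_on (nxt n) {..<n}"
  by (auto simp: inj_on_def nxt_eq split: if_splits)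

lemma nxt_image: "nxt n ` {..<n} = {..<n}"
  by (rule endo_inj_surj[OF _ _ inj_on_nxt]) (auto simp: nxt_less)

lemma bij_betw_nxt: "bij_betw (nxt n) {..<n} {..<n}"
  by (simp add: bij_betw_def inj_on_nxt nxt_image)

lemma sum_nxt: "(\<Sum>i<n. f (nxt n i)) = (\<Sum>i<n. f i)"
  by (rule sum.reindex_bij_betw[OF bij_betw_nxt])

lemma bond_swap_less [simp]: "e < n \<Longrightarrow> i < n \<Longrightarrow> bond_swap n e i < n"
  by (auto simp: bond_swap_def Transposition.transpose_def nxt_less)

lemma bond_swap_invol [simp]: "bond_swap n e (bond_swap n e i) = i"
  by (simp add: bond_swap_def)

lemma bond_swap_eq_iff [simp]: "bond_swap n e i = bond_swap n e j \<longleftrightarrow> i = j"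
  by (metis bond_swap_invol)

lemma bij_betw_bond_swap: "e < n \<Longrightarrow> bij_betw (bond_swap n e) {..<n} {..<n}"
  by (rule bij_betwI[where g = "bond_swap n e"]) (auto simp: bond_swap_less)

lemma finite_configs [simp]: "finite (configs n)"
  by (simp add: configs_def finite_PiE)

lemma configs_bond_swap:
  assumes "\<eta> \<in> configs n" "e < n"
  shows "\<eta> \<circ> bond_swap n e \<in> configs n"
proof -
  \<comment> \<open>Outside the sites a configuration must keep the value \<open>undefined\<close>,
    so the swap has to fix these indices; this uses \<open>nxt n e < n\<close>.\<close>
  have "bond_swap n e i = i" if "\<not> i < n" for i
    using that assms(2) nxt_less[of n e] by (auto simp: bond_swap_def Transposition.transpose_def)
  then show ?thesis
    using assms by (auto simp: configs_def PiE_iff extensional_def bond_swap_less)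
qed

lemma comp_bond_swap_invol [simp]: "\<eta> \<circ> bond_swap n e \<circ> bond_swap n e = \<eta>"
  by (simp add: fun_eq_iff)

lemma sum_configs_bond_swap:
  assumes "e < n"
  shows "(\<Sum>\<eta>\<in>configs n. F (\<eta> \<circ> bond_swap n e)) = (\<Sum>\<eta>\<in>configs n. F \<eta>)"
  by (rule sum.reindex_bij_betw, rule bij_betwI[where g = "\<lambda>\<eta>. \<eta> \<circ> bond_swap n e"])
     (use assms configs_bond_swap in \<open>auto simp: comp_def\<close>)

lemma config_values: "\<eta> \<in> configs n \<Longrightarrow> i < n \<Longrightarrow> \<eta> i = 0 \<or> \<eta> i = 1"
  by (auto simp: configs_def PiE_iff)

text \<open>The rate is 1 if the two occupation variables differ and 0 if they agree, and in the
  latter case the exchange changes nothing. The two functions may differ off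
  \<open>configs n\<close>, because identities such as \<open>\<eta> i * \<eta> i = \<eta> i\<close>
  hold only there.\<close>

lemma ssep_generator_cong:
  assumes "\<eta> \<in> configs n" "\<And>x. x \<in> configs n \<Longrightarrow> f x = g x"
  shows "ssep_generator n f \<eta> = stirring n g \<eta>"
proof -
  have ex: "exchange e (nxt n e) \<eta> = \<eta> \<circ> bond_swap n e" for e
    by (auto simp: exchange_def bond_swap_def Transposition.transpose_def fun_eq_iff)
  have "(real (\<eta> e) * (1 - real (\<eta> (nxt n e))) + real (\<eta> (nxt n e)) * (1 - real (\<eta> e))) *
        (f (exchange e (nxt n e) \<eta>) - f \<eta>) = g (\<eta> \<circ> bond_swap n e) - g \<eta>" if "e < n" for e
  proof (cases "\<eta> e = \<eta> (nxt n e)")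
    case True
    then have "\<eta> \<circ> bond_swap n e = \<eta>"
      by (auto simp: bond_swap_def Transposition.transpose_def fun_eq_iff)
    with True show ?thesis
      using config_values[OF assms(1) that] by auto
  next
    case False
    have "nxt n e < n" using that by (simp add: nxt_less)
    then show ?thesis
      using False config_values[OF assms(1) that] config_values[OF assms(1) \<open>nxt n e < n\<close>]
        assms(2)[OF assms(1)] assms(2)[OF configs_bond_swap[OF assms(1) that]]
      by (auto simp: ex)
  qed
  then show ?thesis
    by (simp add: ssep_generator_def stirring_def Let_def nxt_def del: of_nat_Suc)
qed

section \<open>The semigroup as a convergent exponential series\<close>

lemma generator_pow_eq:
  assumes "x \<in> configs n" "\<And>x. x \<in> configs n \<Longrightarrow> f x = g x"
  shows "(ssep_generator n ^^ k) f x = (stirring n ^^ k) g x"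
  using assms(1)
proof (induction k arbitrary: x)
  case (Suc k)
  show ?case
    using ssep_generator_cong[OF Suc.prems Suc.IH] by simp
qed (use assms in auto)

text \<open>There are \<open>n\<close> bonds, each giving a difference of two values with weight
  \<open>n\<^sup>2\<close>, whence the crude operator norm \<open>2 * n\<^sup>3\<close>; it makes
  the exponential series converge.\<close>

lemma stirring_pow_bound:
  assumes "x \<in> configs n" "\<And>x. x \<in> configs n \<Longrightarrow> \<bar>f x\<bar> \<le> b"
  shows "\<bar>(stirring n ^^ k) f x\<bar> \<le> (2 * real n ^ 3) ^ k * b"
  using assms(1)
proof (induction k arbitrary: x)
  case (Suc k)
  let ?g = "(stirring n ^^ k) f" and ?c = "(2 * real n ^ 3) ^ k * b"
  have "\<bar>\<Sum>e<n. ?g (x \<circ> bond_swap n e) - ?g x\<bar> \<le> (\<Sum>e<n. 2 * ?c)"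
  proof (rule order_trans[OF sum_abs sum_mono])
    fix e assume "e \<in> {..<n}"
    then have "\<bar>?g (x \<circ> bond_swap n e)\<bar> \<le> ?c"
      by (intro Suc.IH configs_bond_swap Suc.prems) auto
    then show "\<bar>?g (x \<circ> bond_swap n e) - ?g x\<bar> \<le> 2 * ?c"
      using Suc.IH[OF Suc.prems] by linarith
  qed
  then have "(real n)\<^sup>2 * \<bar>\<Sum>e<n. ?g (x \<circ> bond_swap n e) - ?g x\<bar> \<le> (real n)\<^sup>2 * (real n * (2 * ?c))"
    by (intro mult_left_mono) auto
  then show ?case
    by (simp add: stirring_def[of n ?g] abs_mult power2_eq_square power3_eq_cube mult_ac)
qed (use assms in auto)

lemma semigroup_summable:
  assumes "x \<in> configs n"
  shows "summable (\<lambda>k. t ^ k / fact k * (ssep_generator n ^^ k) f x)"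
proof -
  define b where "b = (\<Sum>x\<in>configs n. \<bar>f x\<bar>)"
  have b: "\<bar>f x\<bar> \<le> b" if "x \<in> configs n" for x
    unfolding b_def using that by (intro member_le_sum) auto
  have "summable (\<lambda>k. (1 / fact k) * (\<bar>t\<bar> * (2 * real n ^ 3)) ^ k)"
    using summable_exp[of "\<bar>t\<bar> * (2 * real n ^ 3)"] by (simp add: field_simps)
  then have "summable (\<lambda>k. (1 / fact k) * (\<bar>t\<bar> * (2 * real n ^ 3)) ^ k * b)"
    by (rule summable_mult2)
  then show ?thesis
  proof (rule summable_comparison_test'[where N = 0])
    fix k
    have "\<bar>t\<bar> ^ k / fact k * \<bar>(stirring n ^^ k) f x\<bar> \<le> \<bar>t\<bar> ^ k / fact k * ((2 * real n ^ 3) ^ k * b)"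
      by (intro mult_left_mono stirring_pow_bound assms b) auto
    then show "norm (t ^ k / fact k * (ssep_generator n ^^ k) f x) \<le> 1 / fact k * (\<bar>t\<bar> * (2 * real n ^ 3)) ^ k * b"
      by (simp add: generator_pow_eq[OF assms, of f f] abs_mult power_abs power_mult_distrib mult_ac)
  qed
qed

lemma semigroup_cong:
  assumes "x \<in> configs n" "\<And>x. x \<in> configs n \<Longrightarrow> f x = g x"
  shows "ssep_at n t f x = ssep_at n t g x"
  using assms by (simp add: markov_semigroup_def generator_pow_eq[where f = f and g = g] generator_pow_eq[where f = g and g = g])

lemma semigroup_zero [simp]: "ssep_at n 0 f x = f x"
proof -
  have "(\<lambda>k. 0 ^ k / fact k * (ssep_generator n ^^ k) f x) = (\<lambda>k. if k = 0 then f x else 0)"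
    by (auto simp: fun_eq_iff)
  then show ?thesis
    using sums_unique[OF sums_single[of 0 "\<lambda>_. f x"]] by (simp add: markov_semigroup_def)
qed

text \<open>Termwise differentiation of a power series in \<open>t\<close>: \<open>diffs\<close>
  raises the power of the generator by one, and the additional factor is moved to the innermost
  place. With the generator acting on \<open>f\<close>, families of functions closed under site
  exchanges satisfy closed linear equations.\<close>

lemma semigroup_deriv:
  assumes "x \<in> configs n"
  shows "((\<lambda>t. ssep_at n t f x) has_real_derivative ssep_at n t (stirring n f) x) (at t)"
proof -
  define c where "c k = (ssep_generator n ^^ k) f x / fact k" for k
  have "((\<lambda>t. \<Sum>k. c k * t ^ k) has_real_derivative (\<Sum>k. diffs c k * t ^ k)) (at t)"
    by (rule termdiffs_strong_converges_everywhere)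
       (use semigroup_summable[OF assms, of _ f] in \<open>simp add: c_def mult_ac\<close>)
  moreover have "diffs c k * t ^ k = t ^ k / fact k * (ssep_generator n ^^ k) (stirring n f) x" for k
  proof -
    have "(ssep_generator n ^^ Suc k) f x = (ssep_generator n ^^ k) (stirring n f) x"
      using generator_pow_eq[OF assms, of f f "Suc k"] generator_pow_eq[OF assms, of "stirring n f" "stirring n f" k]
      by (simp add: funpow_swap1)
    moreover have "diffs c k = (ssep_generator n ^^ Suc k) f x / fact k"
      by (simp add: diffs_def c_def del: funpow.simps)
    ultimately show ?thesis
      by (simp del: funpow.simps)
  qed
  ultimately show ?thesis
    by (simp add: markov_semigroup_def c_def mult_ac)
qed

lemma stirring_linear:
  "stirring n (\<lambda>x. a * f x + b * g x) = (\<lambda>x. a * stirring n f x + b * stirring n g x)"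
  by (simp add: stirring_def sum.distrib sum_subtractf fun_eq_iff flip: sum_distrib_left)
     (simp add: algebra_simps)

lemma stirring_pow_linear:
  "(stirring n ^^ k) (\<lambda>x. a * f x + b * g x) x = a * (stirring n ^^ k) f x + b * (stirring n ^^ k) g x"
proof (induction k arbitrary: x)
  case (Suc k)
  then have "(stirring n ^^ k) (\<lambda>x. a * f x + b * g x) =
      (\<lambda>x. a * (stirring n ^^ k) f x + b * (stirring n ^^ k) g x)"
    by blast
  then show ?case
    by (simp add: stirring_linear)
qed simp

lemma semigroup_linear:
  assumes "x \<in> configs n"
  shows "ssep_at n t (\<lambda>x. a * f x + b * g x) x = a * ssep_at n t f x + b * ssep_at n t g x"
proof -
  have "t ^ k / fact k * (ssep_generator n ^^ k) (\<lambda>x. a * f x + b * g x) x =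
     a * (t ^ k / fact k * (ssep_generator n ^^ k) f x) + b * (t ^ k / fact k * (ssep_generator n ^^ k) g x)" for k
    using generator_pow_eq[OF assms, of "\<lambda>x. a * f x + b * g x"] generator_pow_eq[OF assms, of f f]
      generator_pow_eq[OF assms, of g g] by (simp add: stirring_pow_linear algebra_simps)
  then show ?thesis
    unfolding markov_semigroup_def
    using sums_unique[OF sums_add[OF sums_mult[OF summable_sums] sums_mult[OF summable_sums],
          OF semigroup_summable semigroup_summable, OF assms assms, of a t f b t g]]
    by simp
qed

lemma semigroup_const:
  assumes "x \<in> configs n"
  shows "ssep_at n t (\<lambda>_. c) x = c"
proof -
  have st: "stirring n (\<lambda>_. 0) = (\<lambda>_. 0)" "stirring n (\<lambda>_. c) = (\<lambda>_. 0)"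
    by (auto simp: stirring_def fun_eq_iff)
  have "(stirring n ^^ k) (\<lambda>_. c) = (if k = 0 then (\<lambda>_. c) else (\<lambda>_. 0))" for k
    by (induction k) (auto simp: st)
  then have "(\<lambda>k. t ^ k / fact k * (ssep_generator n ^^ k) (\<lambda>_. c) x) = (\<lambda>k. if k = 0 then c else 0)"
    using generator_pow_eq[OF assms, of "\<lambda>_. c" "\<lambda>_. c"] by (auto simp: fun_eq_iff)
  then show ?thesis
    using sums_unique[OF sums_single[of 0 "\<lambda>_. c"]] by (simp add: markov_semigroup_def)
qed

lemma semigroup_add:
  "x \<in> configs n \<Longrightarrow> ssep_at n t (\<lambda>x. f x + g x) x = ssep_at n t f x + ssep_at n t g x"
  using semigroup_linear[of x n t 1 f 1 g] by simp

lemma semigroup_cmult: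
  "x \<in> configs n \<Longrightarrow> ssep_at n t (\<lambda>x. a * f x) x = a * ssep_at n t f x"
  using semigroup_linear[of x n t a f 0 f] by simp

lemma semigroup_diff:
  "x \<in> configs n \<Longrightarrow> ssep_at n t (\<lambda>x. f x - g x) x = ssep_at n t f x - ssep_at n t g x"
  using semigroup_linear[of x n t 1 f "-1" g] by simp

lemma semigroup_sum:
  assumes "x \<in> configs n"
  shows "ssep_at n t (\<lambda>x. \<Sum>i\<in>I. f i x) x = (\<Sum>i\<in>I. ssep_at n t (f i) x)"
proof (cases "finite I")
  case True
  then show ?thesis
    by (induction I) (auto simp: semigroup_const[OF assms] semigroup_add[OF assms])
qed (simp add: semigroup_const[OF assms])

section \<open>Negative correlations\<close>

text \<open>Adding \<open>\<delta> * u\<close> makes the derivative strictly positive where the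
  perturbed minimum over the indices and \<open>[0, t]\<close> is attained, so slightly earlier the
  value would be smaller still, unless that time is 0. The sign condition is imposed at minimal
  indices only, which admits sources of the right sign.\<close>

lemma linear_min_principle:
  fixes y y' :: "'i \<Rightarrow> real \<Rightarrow> real"
  assumes fin: "finite S" and i: "i \<in> S" and t: "0 \<le> t"
    and deriv: "\<And>i u. i \<in> S \<Longrightarrow> 0 \<le> u \<Longrightarrow> (y i has_real_derivative y' i u) (at u)"
    and at_min: "\<And>i u. i \<in> S \<Longrightarrow> 0 \<le> u \<Longrightarrow> (\<And>j. j \<in> S \<Longrightarrow> y i u \<le> y j u) \<Longrightarrow> 0 \<le> y' i u"
    and init: "\<And>i. i \<in> S \<Longrightarrow> 0 \<le> y i 0"
  shows "0 \<le> y i t"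
proof (rule ccontr)
  assume "\<not> 0 \<le> y i t"
  then have neg: "y i t < 0" by simp
  \<comment> \<open>Small enough for \<open>y i t + \<delta> * t\<close> to remain negative; the
    \<open>+ 1\<close> avoids division by zero at \<open>t = 0\<close>.\<close>
  define \<delta> where "\<delta> = - y i t / (2 * (t + 1))"
  have \<delta>: "\<delta> > 0" unfolding \<delta>_def by (intro divide_pos_pos) (use neg t in auto)
  have neg': "y i t + \<delta> * t < 0"
  proof -
    have "\<delta> * t \<le> \<delta> * (t + 1)" using \<delta> by simp
    also have "\<dots> = - y i t / 2" using t by (simp add: \<delta>_def field_simps)
    finally show ?thesis using neg by linarith
  qed
  define z where "z j u = y j u + \<delta> * u" for j u
  have dz: "(z j has_real_derivative y' j u + \<delta>) (at u)" if "j \<in> S" "0 \<le> u" for j u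
    unfolding z_def by (auto intro!: derivative_eq_intros deriv that)
  have "\<exists>u. u \<in> {0..t} \<and> (\<forall>v\<in>{0..t}. z j u \<le> z j v)" if "j \<in> S" for j
  proof -
    have "continuous_on {0..t} (z j)"
      by (intro continuous_at_imp_continuous_on ballI DERIV_isCont[OF dz] that) auto
    then show ?thesis
      using continuous_attains_inf[of "{0..t}" "z j"] t by auto
  qed
  then obtain u where u: "\<And>j. j \<in> S \<Longrightarrow> u j \<in> {0..t}"
      "\<And>j v. j \<in> S \<Longrightarrow> v \<in> {0..t} \<Longrightarrow> z j (u j) \<le> z j v"
    by metis
  obtain j where j: "j \<in> S" "\<And>k. k \<in> S \<Longrightarrow> z j (u j) \<le> z k (u k)"
    using ex_min_if_finite[of "(\<lambda>j. z j (u j)) ` S"] fin i by fastforce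
  have min: "z j (u j) \<le> z k v" if "k \<in> S" "v \<in> {0..t}" for k v
    using j(2)[OF that(1)] u(2)[OF that] by linarith
  have "z j (u j) < 0"
    using min[OF i, of t] neg' t by (simp add: z_def)
  moreover have "z j 0 \<ge> 0"
    using init[OF j(1)] by (simp add: z_def)
  ultimately have "u j \<noteq> 0" by force
  with u(1)[OF j(1)] have uj: "0 < u j" "u j \<le> t" by auto
  have "0 \<le> y' j (u j)"
    using uj j(1) min[of _ "u j"] by (intro at_min) (auto simp: z_def)
  then have "y' j (u j) + \<delta> > 0" using \<delta> by linarith
  then obtain d where d: "d > 0" "\<And>r. 0 < r \<Longrightarrow> r < d \<Longrightarrow> z j (u j - r) < z j (u j)"
    using DERIV_pos_inc_left[OF dz[OF j(1) less_imp_le[OF uj(1)]]] by blast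
  define r where "r = min (d / 2) (u j)"
  have "z j (u j - r) < z j (u j)" "u j - r \<in> {0..t}"
    using d uj by (auto simp: r_def)
  then show False
    using min[OF j(1), of "u j - r"] by linarith
qed

section \<open>One- and two-site expectations from a fixed configuration\<close>

definition prv :: "nat \<Rightarrow> nat \<Rightarrow> nat" where
  "prv n i = (if i = 0 then n - 1 else i - 1)"

lemma prv_less: "i < n \<Longrightarrow> prv n i < n"
  by (auto simp: prv_def)

lemma nxt_eq_iff_prv: "2 \<le> n \<Longrightarrow> e < n \<Longrightarrow> i < n \<Longrightarrow> nxt n e = i \<longleftrightarrow> e = prv n i"
  by (auto simp: nxt_eq prv_def)

text \<open>Only the bonds \<open>i\<close> and \<open>prv n i\<close> move the site
  \<open>i\<close>, and for \<open>2 \<le> n\<close> they are distinct; the generator acts on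
  one-site functions as the discrete Laplacian. For \<open>n = 2\<close> the single neighbour is
  counted twice.\<close>

lemma sum_bond_swap_diff:
  fixes F :: "nat \<Rightarrow> real"
  assumes "2 \<le> n" "i < n"
  shows "(\<Sum>e<n. F (bond_swap n e i) - F i) = F (nxt n i) + F (prv n i) - 2 * F i"
proof -
  have "F (bond_swap n e i) - F i =
      (if e = i then F (nxt n i) - F i else 0) + (if e = prv n i then F (prv n i) - F i else 0)"
    if "e < n" for e
    using that assms nxt_eq_iff_prv[OF assms(1) that assms(2)] nxt_neq[OF assms(1) that]
    by (auto simp: bond_swap_def Transposition.transpose_def)
  then have "(\<Sum>e<n. F (bond_swap n e i) - F i) =
      (\<Sum>e<n. (if e = i then F (nxt n i) - F i else 0) + (if e = prv n i then F (prv n i) - F i else 0))"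
    by (intro sum.cong) auto
  then show ?thesis
    using assms prv_less[OF assms(2)] by (simp add: sum.distrib)
qed

definition occ :: "nat \<Rightarrow> config \<Rightarrow> nat \<Rightarrow> real \<Rightarrow> real" where
  "occ n x i t = ssep_at n t (\<lambda>\<eta>. real (\<eta> i)) x"

text \<open>A truncated correlation of the process started at the point \<open>x\<close>, hence zero
  at time 0 even for \<open>i = j\<close>, where it is the variance of an occupation
  variable.\<close>

definition corr :: "nat \<Rightarrow> config \<Rightarrow> nat \<Rightarrow> nat \<Rightarrow> real \<Rightarrow> real" where
  "corr n x i j t = ssep_at n t (\<lambda>\<eta>. real (\<eta> i) * real (\<eta> j)) x - occ n x i t * occ n x j t"

lemma corr_sym: "corr n x i j t = corr n x j i t"
  by (simp add: corr_def mult.commute)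

lemma occ_0: "occ n x i 0 = real (x i)"
  by (simp add: occ_def)

lemma corr_0: "corr n x i j 0 = 0"
  by (simp add: corr_def occ_0)

lemma occ_deriv:
  assumes "x \<in> configs n"
  shows "(occ n x i has_real_derivative (real n)\<^sup>2 * (\<Sum>e<n. occ n x (bond_swap n e i) t - occ n x i t)) (at t)"
proof -
  have "stirring n (\<lambda>\<eta>. real (\<eta> i)) = (\<lambda>\<eta>. (real n)\<^sup>2 * (\<Sum>e<n. real (\<eta> (bond_swap n e i)) - real (\<eta> i)))"
    by (simp add: stirring_def fun_eq_iff)
  then show ?thesis
    using semigroup_deriv[OF assms, of "\<lambda>\<eta>. real (\<eta> i)" t]
    by (simp add: occ_def[abs_def] semigroup_cmult[OF assms] semigroup_sum[OF assms] semigroup_diff[OF assms])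
qed

text \<open>The product rule for \<open>occ * occ\<close> changes one factor at a time, whereas a
  bond may change both; the source is the product of the two increments that this leaves
  over.\<close>

lemma corr_deriv:
  assumes "x \<in> configs n"
  shows "(corr n x i j has_real_derivative (real n)\<^sup>2 * (\<Sum>e<n.
     corr n x (bond_swap n e i) (bond_swap n e j) t - corr n x i j t +
     (occ n x (bond_swap n e i) t - occ n x i t) * (occ n x (bond_swap n e j) t - occ n x j t))) (at t)"
proof -
  define B where "B i j t = ssep_at n t (\<lambda>\<eta>. real (\<eta> i) * real (\<eta> j)) x" for i j t
  have "stirring n (\<lambda>\<eta>. real (\<eta> i) * real (\<eta> j)) = (\<lambda>\<eta>. (real n)\<^sup>2 *
      (\<Sum>e<n. real (\<eta> (bond_swap n e i)) * real (\<eta> (bond_swap n e j)) - real (\<eta> i) * real (\<eta> j)))"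
    by (simp add: stirring_def fun_eq_iff)
  then have "(B i j has_real_derivative
      (real n)\<^sup>2 * (\<Sum>e<n. B (bond_swap n e i) (bond_swap n e j) t - B i j t)) (at t)"
    using semigroup_deriv[OF assms, of "\<lambda>\<eta>. real (\<eta> i) * real (\<eta> j)" t]
    by (simp add: B_def[abs_def] semigroup_cmult[OF assms] semigroup_sum[OF assms] semigroup_diff[OF assms])
  then have "((\<lambda>t. B i j t - occ n x i t * occ n x j t) has_real_derivative
      (real n)\<^sup>2 * (\<Sum>e<n. B (bond_swap n e i) (bond_swap n e j) t - B i j t)
      - ((real n)\<^sup>2 * (\<Sum>e<n. occ n x (bond_swap n e i) t - occ n x i t) * occ n x j t
         + (real n)\<^sup>2 * (\<Sum>e<n. occ n x (bond_swap n e j) t - occ n x j t) * occ n x i t)) (at t)"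
    by (rule DERIV_cong[OF DERIV_diff[OF _ DERIV_mult'[OF occ_deriv[OF assms] occ_deriv[OF assms]]]])
       (simp add: mult_ac)
  moreover have "corr n x i j = (\<lambda>t. B i j t - occ n x i t * occ n x j t)"
    by (simp add: corr_def B_def fun_eq_iff)
  moreover have "(real n)\<^sup>2 * (\<Sum>e<n. B (bond_swap n e i) (bond_swap n e j) t - B i j t)
      - ((real n)\<^sup>2 * (\<Sum>e<n. occ n x (bond_swap n e i) t - occ n x i t) * occ n x j t
         + (real n)\<^sup>2 * (\<Sum>e<n. occ n x (bond_swap n e j) t - occ n x j t) * occ n x i t) =
     (real n)\<^sup>2 * (\<Sum>e<n. (B (bond_swap n e i) (bond_swap n e j) t - B i j t) -
       (occ n x (bond_swap n e i) t - occ n x i t) * occ n x j t -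
       (occ n x (bond_swap n e j) t - occ n x j t) * occ n x i t)"
    unfolding sum_subtractf[of "\<lambda>e. _ e - _ e"] by (simp add: sum_subtractf sum_distrib_left algebra_simps)
  ultimately show ?thesis
    by (simp add: corr_def B_def algebra_simps)
qed

lemma corr_diag:
  assumes "x \<in> configs n" "i < n"
  shows "corr n x i i t = occ n x i t * (1 - occ n x i t)"
proof -
  have "real (\<eta> i) * real (\<eta> i) = real (\<eta> i)" if "\<eta> \<in> configs n" for \<eta>
    using config_values[OF that assms(2)] by auto
  then show ?thesis
    using semigroup_cong[OF assms(1), of "\<lambda>\<eta>. real (\<eta> i) * real (\<eta> i)" "\<lambda>\<eta>. real (\<eta> i)" t]
    by (simp add: corr_def occ_def algebra_simps)
qed

lemma occ_nonneg:
  assumes "x \<in> configs n" "i < n" "0 \<le> t"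
  shows "0 \<le> occ n x i t"
proof (rule linear_min_principle[where S = "{..<n}" and y = "occ n x"])
  show "(occ n x i has_real_derivative (real n)\<^sup>2 * (\<Sum>e<n. occ n x (bond_swap n e i) u - occ n x i u)) (at u)" for i u
    by (rule occ_deriv[OF assms(1)])
  fix i u assume "i \<in> {..<n}" "\<And>j. j \<in> {..<n} \<Longrightarrow> occ n x i u \<le> occ n x j u"
  then show "0 \<le> (real n)\<^sup>2 * (\<Sum>e<n. occ n x (bond_swap n e i) u - occ n x i u)"
    by (intro mult_nonneg_nonneg sum_nonneg) simp_all
qed (use assms in \<open>auto simp: occ_0\<close>)

lemma occ_le_1:
  assumes "x \<in> configs n" "i < n" "0 \<le> t"
  shows "occ n x i t \<le> 1"
proof -
  have "0 \<le> 1 - occ n x i t"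
  proof (rule linear_min_principle[where S = "{..<n}" and y = "\<lambda>i t. 1 - occ n x i t"])
    show "((\<lambda>u. 1 - occ n x i u) has_real_derivative
        - ((real n)\<^sup>2 * (\<Sum>e<n. occ n x (bond_swap n e i) u - occ n x i u))) (at u)" for i u
      by (auto intro!: derivative_eq_intros occ_deriv[OF assms(1)])
    show "0 \<le> 1 - occ n x i 0" if "i \<in> {..<n}" for i
      using that config_values[OF assms(1), of i] by (auto simp: occ_0)
    show "0 \<le> - ((real n)\<^sup>2 * (\<Sum>e<n. occ n x (bond_swap n e i) u - occ n x i u))"
      if "i \<in> {..<n}" "\<And>j. j \<in> {..<n} \<Longrightarrow> 1 - occ n x i u \<le> 1 - occ n x j u" for i u
    proof -
      have "(real n)\<^sup>2 * (\<Sum>e<n. occ n x (bond_swap n e i) u - occ n x i u) \<le> 0"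
        using that by (intro mult_nonneg_nonpos sum_nonpos) simp_all
      then show ?thesis by simp
    qed
  qed (use assms in auto)
  then show ?thesis by simp
qed

text \<open>For distinct sites a bond changes both only by exchanging them, and then the two
  increments of \<open>occ\<close> are opposite; otherwise one increment vanishes. So the source is
  at most 0. Exchanges map pairs of distinct sites to such pairs, so the minimum principle can be
  applied to \<open>- corr\<close> on them alone, away from the positive diagonal.\<close>

lemma corr_nonpos:
  assumes "x \<in> configs n" "i < n" "j < n" "i \<noteq> j" "0 \<le> t"
  shows "corr n x i j t \<le> 0"
proof -
  let ?S = "{(i, j). i < n \<and> j < n \<and> i \<noteq> j}"
  define D where "D i j u = (real n)\<^sup>2 * (\<Sum>e<n.
     corr n x (bond_swap n e i) (bond_swap n e j) u - corr n x i j u +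
     (occ n x (bond_swap n e i) u - occ n x i u) * (occ n x (bond_swap n e j) u - occ n x j u))" for i j u
  have "0 \<le> - corr n x (fst (i, j)) (snd (i, j)) t"
  proof (rule linear_min_principle[where S = ?S and i = "(i, j)" and y = "\<lambda>p u. - corr n x (fst p) (snd p) u"
        and y' = "\<lambda>p u. - D (fst p) (snd p) u"])
    show "finite ?S"
      by (rule finite_subset[of _ "{..<n} \<times> {..<n}"]) auto
    fix p u assume p: "p \<in> ?S" and min: "\<And>q. q \<in> ?S \<Longrightarrow>
       - corr n x (fst p) (snd p) u \<le> - corr n x (fst q) (snd q) u"
    obtain i j where ij: "p = (i, j)" "i < n" "j < n" "i \<noteq> j" using p by auto
    have "(\<Sum>e<n. corr n x (bond_swap n e i) (bond_swap n e j) u - corr n x i j u +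
       (occ n x (bond_swap n e i) u - occ n x i u) * (occ n x (bond_swap n e j) u - occ n x j u)) \<le> 0"
    proof (rule sum_nonpos)
      fix e assume "e \<in> {..<n}"
      then have "corr n x (bond_swap n e i) (bond_swap n e j) u \<le> corr n x i j u"
        using min[of "(bond_swap n e i, bond_swap n e j)"] ij by (auto simp: bond_swap_less)
      moreover have "(occ n x (bond_swap n e i) u - occ n x i u) * (occ n x (bond_swap n e j) u - occ n x j u) \<le> 0"
        using ij(4) by (auto simp: bond_swap_def Transposition.transpose_def mult_le_0_iff)
      ultimately show "corr n x (bond_swap n e i) (bond_swap n e j) u - corr n x i j u +
       (occ n x (bond_swap n e i) u - occ n x i u) * (occ n x (bond_swap n e j) u - occ n x j u) \<le> 0"
        by linarith
    qed
    then show "0 \<le> - D (fst p) (snd p) u"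
      by (simp add: ij D_def mult_nonneg_nonpos)
  next
    show "((\<lambda>u. - corr n x (fst p) (snd p) u) has_real_derivative - D (fst p) (snd p) u) (at u)" for p u
      unfolding D_def by (intro DERIV_minus corr_deriv assms)
  qed (use assms in \<open>auto simp: corr_0\<close>)
  then show ?thesis by simp
qed

lemma sum_bond_swap:
  "e < n \<Longrightarrow> (\<Sum>i<n. f (bond_swap n e i)) = (\<Sum>i<n. f i)"
  by (rule sum.reindex_bij_betw[OF bij_betw_bond_swap])

text \<open>The number of particles is deterministic, so it is uncorrelated with everything.\<close>

lemma sum_corr_eq_0:
  assumes "x \<in> configs n" "i < n" "0 \<le> t"
  shows "(\<Sum>j<n. corr n x i j t) = 0"
proof -
  define S where "S i u = (\<Sum>j<n. corr n x i j u)" for i u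
  have S': "(S i has_real_derivative (real n)\<^sup>2 * (\<Sum>e<n. S (bond_swap n e i) u - S i u)) (at u)" for i u
  proof -
    have "(S i has_real_derivative (\<Sum>j<n. (real n)\<^sup>2 * (\<Sum>e<n.
     corr n x (bond_swap n e i) (bond_swap n e j) u - corr n x i j u +
     (occ n x (bond_swap n e i) u - occ n x i u) * (occ n x (bond_swap n e j) u - occ n x j u)))) (at u)"
      unfolding S_def[abs_def] by (intro DERIV_sum corr_deriv[OF assms(1)])
    moreover have "(\<Sum>j<n. corr n x (bond_swap n e i) (bond_swap n e j) u - corr n x i j u +
     (occ n x (bond_swap n e i) u - occ n x i u) * (occ n x (bond_swap n e j) u - occ n x j u)) =
       S (bond_swap n e i) u - S i u" if "e < n" for e
      using sum_bond_swap[OF that, of "\<lambda>j. corr n x (bond_swap n e i) j u"] sum_bond_swap[OF that, of "\<lambda>j. occ n x j u"]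
      by (simp add: S_def sum.distrib sum_subtractf flip: sum_distrib_left)
    ultimately show ?thesis
      by (simp add: sum.swap[of _ "{..<n}" "{..<n}"] flip: sum_distrib_left)
  qed
  have S0: "S i 0 = 0" for i
    by (simp add: S_def corr_0)
  have "0 \<le> S i t"
  proof (rule linear_min_principle[where S = "{..<n}" and y = S, OF _ _ _ S'])
    fix i u assume "i \<in> {..<n}" "\<And>j. j \<in> {..<n} \<Longrightarrow> S i u \<le> S j u"
    then show "0 \<le> (real n)\<^sup>2 * (\<Sum>e<n. S (bond_swap n e i) u - S i u)"
      by (intro mult_nonneg_nonneg sum_nonneg) simp_all
  qed (use assms S0 in auto)
  moreover have "0 \<le> - S i t"
  proof (rule linear_min_principle[where S = "{..<n}" and y = "\<lambda>i u. - S i u", OF _ _ _ DERIV_minus[OF S']])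
    fix i u assume "i \<in> {..<n}" "\<And>j. j \<in> {..<n} \<Longrightarrow> - S i u \<le> - S j u"
    then have "(real n)\<^sup>2 * (\<Sum>e<n. S (bond_swap n e i) u - S i u) \<le> 0"
      by (intro mult_nonneg_nonpos sum_nonpos) simp_all
    then show "0 \<le> - ((real n)\<^sup>2 * (\<Sum>e<n. S (bond_swap n e i) u - S i u))"
      by simp
  qed (use assms S0 in auto)
  ultimately show ?thesis by (simp add: S_def)
qed

section \<open>A weighted sum of the correlations\<close>

text \<open>The one-site discrete Laplacian of this weight is constant off the diagonal. This is why the
  two-particle generator applied to it gives a constant plus a term of order \<open>n\<close> that charges only the
  pairs of neighbouring sites.\<close>

definition cyc_weight :: "nat \<Rightarrow> nat \<Rightarrow> nat \<Rightarrow> real" where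
  "cyc_weight n i j = \<bar>real i - real j\<bar> * (real n - \<bar>real i - real j\<bar>)"

lemma cyc_weight_diag [simp]: "cyc_weight n i i = 0"
  by (simp add: cyc_weight_def)

lemma cyc_weight_sym: "cyc_weight n i j = cyc_weight n j i"
  by (simp add: cyc_weight_def abs_minus_commute)

lemma cyc_weight_nonneg: "i < n \<Longrightarrow> j < n \<Longrightarrow> 0 \<le> cyc_weight n i j"
  unfolding cyc_weight_def by (intro mult_nonneg_nonneg) linarith+

lemma cyc_weight_le: "cyc_weight n i j \<le> (real n)\<^sup>2 / 4"
proof -
  define d where "d = \<bar>real i - real j\<bar>"
  have "0 \<le> (real n / 2 - d)\<^sup>2" by simp
  then show ?thesis
    by (simp add: cyc_weight_def power2_eq_square algebra_simps flip: d_def)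
qed

lemma cyc_weight_nxt: "2 \<le> n \<Longrightarrow> i < n \<Longrightarrow> cyc_weight n i (nxt n i) = real n - 1"
  by (auto simp: cyc_weight_def nxt_eq of_nat_diff)

text \<open>As a function of the signed distance the weight is a parabola with second difference -2
  on either side of a kink at 0, where the second difference is \<open>2 * (n - 1)\<close>. The
  symmetry of \<open>d * (n - d)\<close> under the reflection of \<open>d\<close> to
  \<open>n - d\<close> takes care of the wrap-around.\<close>

lemma cyc_weight_laplacian:
  assumes "2 \<le> n" "i < n" "j < n"
  shows "cyc_weight n (nxt n i) j + cyc_weight n (prv n i) j - 2 * cyc_weight n i j = (if i = j then 2 * real n else 0) - 2"
proof -
  define W where "W d = \<bar>d\<bar> * (real n - \<bar>d\<bar>)" for d :: real
  have up: "cyc_weight n (nxt n i) j = W (real i - real j + 1)"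
  proof (cases "i = n - 1")
    case True
    then have "real i = real n - 1" using assms by (simp add: of_nat_diff)
    then show ?thesis using True assms by (simp add: cyc_weight_def W_def nxt_eq)
  qed (use assms in \<open>simp add: cyc_weight_def W_def nxt_eq algebra_simps\<close>)
  have down: "cyc_weight n (prv n i) j = W (real i - real j - 1)"
    using assms by (auto simp: cyc_weight_def W_def prv_def of_nat_diff algebra_simps)
  have "W (d + 1) + W (d - 1) - 2 * W d = - 2" if "1 \<le> d \<or> d \<le> - 1" for d
  proof (cases "1 \<le> d")
    case True
    then show ?thesis by (simp add: W_def algebra_simps)
  next
    case False
    then have "\<bar>d\<bar> = - d" "\<bar>d + 1\<bar> = - (d + 1)" "\<bar>d - 1\<bar> = - (d - 1)" using that by auto
    then show ?thesis unfolding W_def by (simp add: algebra_simps)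
  qed
  moreover have "1 \<le> real i - real j \<or> real i - real j \<le> - 1" if "i \<noteq> j"
    using that by linarith
  ultimately show ?thesis
    unfolding up down by (auto simp: cyc_weight_def W_def)
qed

text \<open>Off the diagonal, a bond that does not join \<open>i\<close> and \<open>j\<close> moves
  at most one of them, so the sum is that of two one-site Laplacians, each equal to -2. A bond
  joining them leaves the symmetric weight unchanged, while the Laplacians have counted two moves
  onto the diagonal, each costing \<open>n - 1\<close>; the last term corrects this.\<close>

lemma sum_cyc_weight_diff:
  assumes n: "2 \<le> n" and i: "i < n" and j: "j < n"
  shows "(\<Sum>e<n. cyc_weight n (bond_swap n e i) (bond_swap n e j) - cyc_weight n i j) =
     of_bool (i = j) * 4 - 4 + 2 * (real n - 1) * (of_bool (nxt n i = j) + of_bool (nxt n j = i))"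
proof (cases "i = j")
  case True
  then show ?thesis using nxt_neq[OF n j] by simp
next
  case False
  let ?w = "cyc_weight n" and ?\<tau> = "bond_swap n"
  have mixed: "?w (?\<tau> e i) (?\<tau> e j) - ?w i j =
      (?w (?\<tau> e i) j - ?w i j) + (?w (?\<tau> e j) i - ?w j i) +
      ((if e = i then of_bool (nxt n i = j) * (2 * (real n - 1)) else 0) +
       (if e = j then of_bool (nxt n j = i) * (2 * (real n - 1)) else 0))" if "e < n" for e
  proof -
    have "?w (nxt n e) e = real n - 1" "?w e (nxt n e) = real n - 1"
      using cyc_weight_nxt[OF n that] by (auto simp: cyc_weight_sym)
    then show ?thesis
      using False by (auto simp: bond_swap_def Transposition.transpose_def cyc_weight_sym)
  qed
  have "(\<Sum>e<n. ?w (?\<tau> e i) (?\<tau> e j) - ?w i j) =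
      (\<Sum>e<n. ?w (?\<tau> e i) j - ?w i j) + (\<Sum>e<n. ?w (?\<tau> e j) i - ?w j i) +
      (of_bool (nxt n i = j) * (2 * (real n - 1)) + of_bool (nxt n j = i) * (2 * (real n - 1)))"
    using i j by (simp add: mixed sum.distrib)
  then show ?thesis
    using sum_bond_swap_diff[OF n i, of "\<lambda>k. ?w k j"] sum_bond_swap_diff[OF n j, of "\<lambda>k. ?w k i"]
      cyc_weight_laplacian[OF n i j] cyc_weight_laplacian[OF n j i] False
    by (simp add: algebra_simps)
qed

definition corr_energy :: "nat \<Rightarrow> config \<Rightarrow> real \<Rightarrow> real" where
  "corr_energy n x t = (\<Sum>i<n. \<Sum>j<n. cyc_weight n i j * corr n x i j t)"

text \<open>The increments live on the two ends of the bond, with opposite signs. The weight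
  vanishes on the diagonal, so just the two mixed pairs remain, each with weight
  \<open>n - 1\<close>.\<close>

lemma sum_cyc_weight_gradient:
  fixes A :: "nat \<Rightarrow> real"
  assumes n: "2 \<le> n" and e: "e < n"
  shows "(\<Sum>i<n. \<Sum>j<n. cyc_weight n i j * ((A (bond_swap n e i) - A i) * (A (bond_swap n e j) - A j))) =
     - 2 * (real n - 1) * (A (nxt n e) - A e)\<^sup>2"
proof -
  let ?f = "nxt n e" and ?w = "cyc_weight n"
  define d where "d = A ?f - A e"
  have f: "?f < n" "?f \<noteq> e" using n e by (auto simp: nxt_less nxt_neq)
  have A: "A (bond_swap n e i) - A i = (if i = e then d else 0) + (if i = ?f then - d else 0)" for i
    using f by (auto simp: bond_swap_def Transposition.transpose_def d_def)
  have inner: "(\<Sum>j<n. ?w i j * (c * (A (bond_swap n e j) - A j))) = c * d * (?w i e - ?w i ?f)" for i c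
    unfolding A using e f by (simp add: sum.distrib distrib_left if_distrib[of "(*) _"] cong: if_cong) (simp add: algebra_simps)
  have "(\<Sum>i<n. \<Sum>j<n. ?w i j * ((A (bond_swap n e i) - A i) * (A (bond_swap n e j) - A j))) =
     (\<Sum>i<n. (A (bond_swap n e i) - A i) * d * (?w i e - ?w i ?f))"
    by (simp add: inner)
  also have "\<dots> = d * d * (?w e e - ?w e ?f) - d * d * (?w ?f e - ?w ?f ?f)"
    unfolding A using e f by (simp add: sum.distrib distrib_right if_distrib[of "\<lambda>x. x * _"] cong: if_cong)
  also have "\<dots> = - 2 * (real n - 1) * d\<^sup>2"
    unfolding cyc_weight_sym[of n ?f e] cyc_weight_nxt[OF n e] by (simp add: power2_eq_square algebra_simps)
  finally show ?thesis by (simp add: d_def)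
qed

text \<open>The constant in \<open>sum_cyc_weight_diff\<close> meets the total sum of the
  correlations, which is 0. What remains is a positive diagonal term, at most
  \<open>n\<^sup>3\<close>, and \<open>4 * n\<^sup>2 * (n - 1)\<close> times a nonpositive sum,
  whose time integral the boundedness of the energy therefore controls.\<close>

lemma corr_energy_deriv:
  assumes x: "x \<in> configs n" and n: "2 \<le> n" and t: "0 \<le> t"
  shows "(corr_energy n x has_real_derivative
     4 * (real n)\<^sup>2 * (\<Sum>i<n. corr n x i i t) +
     4 * (real n)\<^sup>2 * (real n - 1) * (\<Sum>i<n. corr n x i (nxt n i) t - (occ n x (nxt n i) t - occ n x i t)\<^sup>2 / 2)) (at t)"
proof -
  let ?w = "cyc_weight n" and ?\<tau> = "bond_swap n" and ?C = "\<lambda>i j. corr n x i j t"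
  define g where "g e i j = (occ n x (?\<tau> e i) t - occ n x i t) * (occ n x (?\<tau> e j) t - occ n x j t)" for e i j
  have d0: "(corr_energy n x has_real_derivative
     (\<Sum>i<n. \<Sum>j<n. ?w i j * ((real n)\<^sup>2 * (\<Sum>e<n. ?C (?\<tau> e i) (?\<tau> e j) - ?C i j + g e i j)))) (at t)"
    unfolding corr_energy_def[abs_def] g_def by (intro DERIV_sum DERIV_cmult corr_deriv x)
  have d1: "(\<Sum>i<n. \<Sum>j<n. ?w i j * ((real n)\<^sup>2 * (\<Sum>e<n. ?C (?\<tau> e i) (?\<tau> e j) - ?C i j + g e i j))) =
     (real n)\<^sup>2 * ((\<Sum>e<n. \<Sum>i<n. \<Sum>j<n. ?w i j * (?C (?\<tau> e i) (?\<tau> e j) - ?C i j)) +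
       (\<Sum>e<n. \<Sum>i<n. \<Sum>j<n. ?w i j * g e i j))"
  proof -
    have "(\<Sum>i<n. \<Sum>j<n. ?w i j * ((real n)\<^sup>2 * (\<Sum>e<n. ?C (?\<tau> e i) (?\<tau> e j) - ?C i j + g e i j))) =
      (real n)\<^sup>2 * (\<Sum>i<n. \<Sum>j<n. \<Sum>e<n. ?w i j * (?C (?\<tau> e i) (?\<tau> e j) - ?C i j) + ?w i j * g e i j)"
      by (simp only: sum_distrib_left distrib_left mult.left_commute)
    also have "(\<Sum>i<n. \<Sum>j<n. \<Sum>e<n. ?w i j * (?C (?\<tau> e i) (?\<tau> e j) - ?C i j) + ?w i j * g e i j) =
       (\<Sum>i<n. \<Sum>e<n. \<Sum>j<n. ?w i j * (?C (?\<tau> e i) (?\<tau> e j) - ?C i j) + ?w i j * g e i j)"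
      by (intro sum.cong refl sum.swap)
    also have "\<dots> = (\<Sum>e<n. \<Sum>i<n. \<Sum>j<n. ?w i j * (?C (?\<tau> e i) (?\<tau> e j) - ?C i j) + ?w i j * g e i j)"
      by (rule sum.swap)
    finally show ?thesis by (simp add: sum.distrib)
  qed
  have d2: "(\<Sum>e<n. \<Sum>i<n. \<Sum>j<n. ?w i j * g e i j) =
     - 2 * (real n - 1) * (\<Sum>e<n. (occ n x (nxt n e) t - occ n x e t)\<^sup>2)"
    unfolding g_def sum_distrib_left
    by (intro sum.cong refl) (use sum_cyc_weight_gradient[OF n, of _ "\<lambda>i. occ n x i t"] in simp)
  have d3: "(\<Sum>e<n. \<Sum>i<n. \<Sum>j<n. ?w i j * (?C (?\<tau> e i) (?\<tau> e j) - ?C i j)) =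
     4 * (\<Sum>i<n. ?C i i) + 4 * (real n - 1) * (\<Sum>i<n. ?C i (nxt n i))"
  proof -
    \<comment> \<open>Replacing both indices by their images under the involution moves the exchange
      from the correlations to the weight.\<close>
    have shift: "(\<Sum>i<n. \<Sum>j<n. ?w i j * (?C (?\<tau> e i) (?\<tau> e j) - ?C i j)) =
        (\<Sum>i<n. \<Sum>j<n. (?w (?\<tau> e i) (?\<tau> e j) - ?w i j) * ?C i j)" if "e < n" for e
    proof -
      have "(\<Sum>i<n. \<Sum>j<n. ?w i j * ?C (?\<tau> e i) (?\<tau> e j)) =
          (\<Sum>i<n. \<Sum>j<n. ?w (?\<tau> e (?\<tau> e i)) (?\<tau> e (?\<tau> e j)) * ?C (?\<tau> e i) (?\<tau> e j))"
        by simp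
      also have "\<dots> = (\<Sum>i<n. \<Sum>j<n. ?w (?\<tau> e i) (?\<tau> e (?\<tau> e j)) * ?C i (?\<tau> e j))"
        by (rule sum_bond_swap[OF that, of "\<lambda>i. \<Sum>j<n. ?w (?\<tau> e i) (?\<tau> e (?\<tau> e j)) * ?C i (?\<tau> e j)"])
      also have "\<dots> = (\<Sum>i<n. \<Sum>j<n. ?w (?\<tau> e i) (?\<tau> e j) * ?C i j)"
        by (intro sum.cong refl sum_bond_swap[OF that, of "\<lambda>j. ?w (?\<tau> e _) (?\<tau> e j) * ?C _ j"])
      finally show ?thesis
        by (simp add: algebra_simps sum_subtractf)
    qed
    have "(\<Sum>e<n. \<Sum>i<n. \<Sum>j<n. ?w i j * (?C (?\<tau> e i) (?\<tau> e j) - ?C i j)) =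
        (\<Sum>e<n. \<Sum>i<n. \<Sum>j<n. (?w (?\<tau> e i) (?\<tau> e j) - ?w i j) * ?C i j)"
      by (intro sum.cong refl shift) auto
    also have "\<dots> = (\<Sum>i<n. \<Sum>e<n. \<Sum>j<n. (?w (?\<tau> e i) (?\<tau> e j) - ?w i j) * ?C i j)"
      by (rule sum.swap)
    also have "\<dots> = (\<Sum>i<n. \<Sum>j<n. \<Sum>e<n. (?w (?\<tau> e i) (?\<tau> e j) - ?w i j) * ?C i j)"
      by (intro sum.cong refl sum.swap)
    also have "\<dots> = (\<Sum>i<n. \<Sum>j<n. (\<Sum>e<n. ?w (?\<tau> e i) (?\<tau> e j) - ?w i j) * ?C i j)"
      by (simp only: sum_distrib_right)
    also have "\<dots> = (\<Sum>i<n. \<Sum>j<n. 4 * (of_bool (i = j) * ?C i j) - 4 * ?C i j +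
        2 * (real n - 1) * (of_bool (nxt n i = j) * ?C i j) + 2 * (real n - 1) * (of_bool (nxt n j = i) * ?C i j))"
      by (intro sum.cong refl) (simp add: sum_cyc_weight_diff[OF n] algebra_simps)
    also have "\<dots> = 4 * (\<Sum>i<n. \<Sum>j<n. of_bool (i = j) * ?C i j) - 4 * (\<Sum>i<n. \<Sum>j<n. ?C i j) +
        2 * (real n - 1) * (\<Sum>i<n. \<Sum>j<n. of_bool (nxt n i = j) * ?C i j) +
        2 * (real n - 1) * (\<Sum>i<n. \<Sum>j<n. of_bool (nxt n j = i) * ?C i j)"
      by (simp only: sum.distrib sum_subtractf sum_distrib_left)
    also have "(\<Sum>i<n. \<Sum>j<n. of_bool (i = j) * ?C i j) = (\<Sum>i<n. ?C i i)"
      by (intro sum.cong refl) (simp add: of_bool_def if_distrib[of "\<lambda>a. a * _"] cong: if_cong)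
    also have "(\<Sum>i<n. \<Sum>j<n. ?C i j) = 0"
      by (simp add: sum_corr_eq_0[OF x _ t])
    also have "(\<Sum>i<n. \<Sum>j<n. of_bool (nxt n i = j) * ?C i j) = (\<Sum>i<n. ?C i (nxt n i))"
      using n by (intro sum.cong refl) (simp add: of_bool_def if_distrib[of "\<lambda>a. a * _"] nxt_less cong: if_cong)
    also have "(\<Sum>i<n. \<Sum>j<n. of_bool (nxt n j = i) * ?C i j) = (\<Sum>j<n. \<Sum>i<n. of_bool (nxt n j = i) * ?C i j)"
      by (rule sum.swap)
    also have "\<dots> = (\<Sum>i<n. ?C i (nxt n i))"
      using n by (intro sum.cong refl)
        (simp add: of_bool_def if_distrib[of "\<lambda>a. a * _"] nxt_less corr_sym[of n x "nxt n _"] cong: if_cong)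
    finally show ?thesis by simp
  qed
  show ?thesis
    by (rule DERIV_cong[OF d0], unfold d1 d2 d3) (simp add: sum_subtractf sum_divide_distrib[symmetric] algebra_simps)
qed

text \<open>Off the diagonal the entries are at most 0 and the whole row sums to 0, so the absolute
  row sum is twice the diagonal entry \<open>a * (1 - a) \<le> 1 / 4\<close>.\<close>

lemma sum_abs_corr_le:
  assumes "x \<in> configs n" "i < n" "0 \<le> t"
  shows "(\<Sum>j<n. \<bar>corr n x i j t\<bar>) \<le> 1 / 2"
proof -
  define a where "a = occ n x i t"
  have "0 \<le> a" "a \<le> 1"
    using occ_nonneg[OF assms] occ_le_1[OF assms] by (auto simp: a_def)
  then have nn: "corr n x i i t \<ge> 0"
    by (simp add: corr_diag[OF assms(1,2)] a_def)
  have "0 \<le> (a - 1 / 2)\<^sup>2" by simp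
  then have le: "corr n x i i t \<le> 1 / 4"
    by (simp add: corr_diag[OF assms(1,2)] power2_eq_square algebra_simps flip: a_def)
  have "\<bar>corr n x i j t\<bar> = (if j = i then 2 * corr n x i i t else 0) - corr n x i j t" if "j < n" for j
    using corr_nonpos[OF assms(1,2) that _ assms(3)] nn by auto
  then have "(\<Sum>j<n. \<bar>corr n x i j t\<bar>) = (\<Sum>j<n. (if j = i then 2 * corr n x i i t else 0) - corr n x i j t)"
    by simp
  also have "\<dots> = 2 * corr n x i i t"
    using assms(2) by (simp add: sum_subtractf sum_corr_eq_0[OF assms])
  finally show ?thesis using le by linarith
qed

text \<open>There are \<open>n\<close> rows, each at least
  \<open>- (n\<^sup>2 / 4) * (1 / 2)\<close>. Compared with the factor
  \<open>4 * n\<^sup>2 * (n - 1)\<close> in \<open>corr_energy_deriv\<close> this is of order one,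
  which is the source of the bound uniform in \<open>n\<close>.\<close>

lemma corr_energy_bounds:
  assumes x: "x \<in> configs n" and t: "0 \<le> t"
  shows "corr_energy n x t \<le> 0" "- (real n ^ 3 / 8) \<le> corr_energy n x t"
proof -
  show "corr_energy n x t \<le> 0"
    unfolding corr_energy_def
  proof (intro sum_nonpos)
    fix i j assume "i \<in> {..<n}" "j \<in> {..<n}"
    then show "cyc_weight n i j * corr n x i j t \<le> 0"
      using corr_nonpos[OF x, of i j] t cyc_weight_nonneg[of i n j]
      by (cases "i = j") (auto intro: mult_nonneg_nonpos)
  qed
  have "- (real n ^ 3 / 8) = (\<Sum>i<n. - ((real n)\<^sup>2 / 4) * (1 / 2))"
    by (simp add: power2_eq_square power3_eq_cube)
  also have "\<dots> \<le> (\<Sum>i<n. - ((real n)\<^sup>2 / 4) * (\<Sum>j<n. \<bar>corr n x i j t\<bar>))"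
    by (intro sum_mono mult_left_mono_neg sum_abs_corr_le x t) auto
  also have "\<dots> = (\<Sum>i<n. \<Sum>j<n. - ((real n)\<^sup>2 / 4) * \<bar>corr n x i j t\<bar>)"
    by (simp only: sum_distrib_left)
  also have "\<dots> \<le> corr_energy n x t"
    unfolding corr_energy_def
  proof (intro sum_mono)
    fix i j assume "i \<in> {..<n}" "j \<in> {..<n}"
    then have "cyc_weight n i j * \<bar>corr n x i j t\<bar> \<le> (real n)\<^sup>2 / 4 * \<bar>corr n x i j t\<bar>"
      by (intro mult_right_mono cyc_weight_le) auto
    moreover have "- (cyc_weight n i j * \<bar>corr n x i j t\<bar>) \<le> cyc_weight n i j * corr n x i j t"
      using mult_left_mono[of "- \<bar>corr n x i j t\<bar>" "corr n x i j t" "cyc_weight n i j"]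
        cyc_weight_nonneg[of i n j] \<open>i \<in> {..<n}\<close> \<open>j \<in> {..<n}\<close> by simp
    ultimately show "- ((real n)\<^sup>2 / 4) * \<bar>corr n x i j t\<bar> \<le> cyc_weight n i j * corr n x i j t"
      by linarith
  qed
  finally show "- (real n ^ 3 / 8) \<le> corr_energy n x t" .
qed

lemma sum_corr_diag_le:
  assumes "x \<in> configs n" "0 \<le> t"
  shows "(\<Sum>i<n. corr n x i i t) \<le> real n / 4"
proof -
  have "corr n x i i t \<le> 1 / 4" if "i < n" for i
  proof -
    have "0 \<le> (occ n x i t - 1 / 2)\<^sup>2" by simp
    then show ?thesis
      by (simp add: corr_diag[OF assms(1) that] power2_eq_square algebra_simps)
  qed
  then have "(\<Sum>i<n. corr n x i i t) \<le> (\<Sum>i<n. 1 / 4)"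
    by (intro sum_mono) auto
  then show ?thesis by simp
qed

section \<open>Entropy relative to product measures\<close>

text \<open>From \<open>ln y \<le> y\<close> at \<open>y = 1 / sqrt x\<close>; the right-hand side
  exhibits the limit 0 at 0.\<close>

lemma abs_x_ln_x_le: 
  fixes x :: real
  assumes "0 \<le> x" "x \<le> 1"
  shows "\<bar>x * ln x\<bar> \<le> 2 * sqrt x"
proof (cases "x = 0")
  case False
  then have x: "0 < x" using assms by simp
  have "ln (1 / sqrt x) \<le> 1 / sqrt x"
    using ln_le_minus_one[of "1 / sqrt x"] x by simp
  then have "- ln x \<le> 2 / sqrt x"
    using x by (simp add: ln_div ln_sqrt)
  then have "x * (- ln x) \<le> x * (2 / sqrt x)"
    using x by (intro mult_left_mono) auto
  also have "\<dots> = 2 * sqrt x"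
    using real_div_sqrt[of x] x by (simp add: field_simps)
  finally show ?thesis
    using x assms by (simp add: abs_mult)
qed simp

text \<open>The only point in question is 0, where \<open>ln 0 = 0\<close> makes the value agree
  with the limit. Limits of entropies can therefore be taken although some masses vanish.\<close>

lemma continuous_on_x_ln_x: "continuous_on {0..} (\<lambda>x::real. x * ln x)"
  unfolding continuous_on_def
proof
  fix x :: real assume "x \<in> {0..}"
  show "((\<lambda>x. x * ln x) \<longlongrightarrow> x * ln x) (at x within {0..})"
  proof (cases "x = 0")
    case True
    have "((\<lambda>x::real. 2 * sqrt x) \<longlongrightarrow> 2 * sqrt 0) (at_right 0)"
      by (intro tendsto_intros)
    then have lim: "((\<lambda>x::real. 2 * sqrt x) \<longlongrightarrow> 0) (at_right 0)" by simp
    have "\<forall>\<^sub>F x::real in at_right 0. norm (x * ln x) \<le> 2 * sqrt x"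
      using eventually_at_right_real[of 0 1] abs_x_ln_x_le by (auto elim!: eventually_mono)
    from Lim_null_comparison[OF this lim]
    have "((\<lambda>x::real. x * ln x) \<longlongrightarrow> 0) (at_right 0)" .
    then show ?thesis
      by (simp add: True at_within_Ici_at_right)
  next
    case False
    with \<open>x \<in> {0..}\<close> show ?thesis by (intro tendsto_intros) auto
  qed
qed

text \<open>Built from initial masses and the semigroup, with no process involved; linearity in
  \<open>q\<close> is used when \<open>q\<close> is mixed with the uniform law.\<close>

definition law :: "nat \<Rightarrow> (config \<Rightarrow> real) \<Rightarrow> real \<Rightarrow> config \<Rightarrow> real" where
  "law n q t \<eta> = (\<Sum>x\<in>configs n. q x * ssep_at n t (\<lambda>\<xi>. of_bool (\<xi> = \<eta>)) x)"

lemma law_expectation: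
  "(\<Sum>\<eta>\<in>configs n. law n q t \<eta> * F \<eta>) = (\<Sum>x\<in>configs n. q x * ssep_at n t F x)"
proof -
  have "ssep_at n t F x = (\<Sum>\<eta>\<in>configs n. F \<eta> * ssep_at n t (\<lambda>\<xi>. of_bool (\<xi> = \<eta>)) x)" if x: "x \<in> configs n" for x
  proof -
    have "F \<xi> = (\<Sum>\<eta>\<in>configs n. F \<eta> * of_bool (\<xi> = \<eta>))" if "\<xi> \<in> configs n" for \<xi>
      using that by (simp add: of_bool_def if_distrib[of "(*) _"] cong: if_cong)
    from semigroup_cong[OF x, of F "\<lambda>\<xi>. \<Sum>\<eta>\<in>configs n. F \<eta> * of_bool (\<xi> = \<eta>)", OF this] show ?thesis
      by (simp only: semigroup_sum[OF x] semigroup_cmult[OF x])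
  qed
  then have "(\<Sum>x\<in>configs n. q x * ssep_at n t F x) =
      (\<Sum>x\<in>configs n. \<Sum>\<eta>\<in>configs n. q x * ssep_at n t (\<lambda>\<xi>. of_bool (\<xi> = \<eta>)) x * F \<eta>)"
    by (simp add: sum_distrib_left mult_ac)
  also have "\<dots> = (\<Sum>\<eta>\<in>configs n. law n q t \<eta> * F \<eta>)"
    by (subst sum.swap) (simp add: law_def sum_distrib_right)
  finally show ?thesis by simp
qed

lemma sum_law: "(\<Sum>\<eta>\<in>configs n. law n q t \<eta>) = (\<Sum>x\<in>configs n. q x)"
  using law_expectation[of n q t "\<lambda>_. 1"] by (simp add: semigroup_const)

lemma law_0: "\<eta> \<in> configs n \<Longrightarrow> law n q 0 \<eta> = q \<eta>"
  by (simp add: law_def of_bool_def if_distrib[of "(*) _"] cong: if_cong)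

text \<open>The forward equation. Each exchange is an involution, so applying it to the argument of
  a point indicator exchanges the point instead: the generator is its own transpose, and the law
  solves an equation of the same form as the expectations.\<close>

lemma law_deriv:
  "((\<lambda>t. law n q t \<eta>) has_real_derivative
     (real n)\<^sup>2 * (\<Sum>e<n. law n q t (\<eta> \<circ> bond_swap n e) - law n q t \<eta>)) (at t)"
proof -
  let ?\<delta> = "\<lambda>\<eta> \<xi>. of_bool (\<xi> = \<eta>) :: real"
  have eq: "\<xi> \<circ> bond_swap n e = \<eta> \<longleftrightarrow> \<xi> = \<eta> \<circ> bond_swap n e" for \<xi> \<eta> :: config and e
    by (metis comp_bond_swap_invol)
  have "stirring n (?\<delta> \<eta>) = (\<lambda>\<xi>. (real n)\<^sup>2 * (\<Sum>e<n. ?\<delta> (\<eta> \<circ> bond_swap n e) \<xi> - ?\<delta> \<eta> \<xi>))"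
    by (rule ext) (simp only: stirring_def eq)
  then have "((\<lambda>t. law n q t \<eta>) has_real_derivative
     (\<Sum>x\<in>configs n. q x * ((real n)\<^sup>2 * (\<Sum>e<n. ssep_at n t (?\<delta> (\<eta> \<circ> bond_swap n e)) x - ssep_at n t (?\<delta> \<eta>) x)))) (at t)"
    unfolding law_def
    by (intro DERIV_sum DERIV_cmult DERIV_cong[OF semigroup_deriv])
       (simp_all add: semigroup_cmult semigroup_sum semigroup_diff)
  moreover have "(\<Sum>x\<in>configs n. q x * ((real n)\<^sup>2 * (\<Sum>e<n. ssep_at n t (?\<delta> (\<eta> \<circ> bond_swap n e)) x - ssep_at n t (?\<delta> \<eta>) x))) =
     (real n)\<^sup>2 * (\<Sum>e<n. law n q t (\<eta> \<circ> bond_swap n e) - law n q t \<eta>)"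
    unfolding law_def sum_subtractf[symmetric] right_diff_distrib[symmetric]
    by (subst sum.swap) (simp add: sum_distrib_left mult_ac)
  ultimately show ?thesis by simp
qed

text \<open>With \<open>c = 0\<close> this is positivity; with \<open>c > 0\<close> it keeps a
  strictly positive initial law away from 0, as differentiating the entropy requires.\<close>

lemma law_ge:
  assumes "\<And>x. x \<in> configs n \<Longrightarrow> c \<le> q x" "\<eta> \<in> configs n" "0 \<le> t"
  shows "c \<le> law n q t \<eta>"
proof -
  have "0 \<le> law n q t \<eta> - c"
  proof (rule linear_min_principle[where S = "configs n" and y = "\<lambda>\<eta> t. law n q t \<eta> - c"])
    show "((\<lambda>t. law n q t \<eta> - c) has_real_derivative
       (real n)\<^sup>2 * (\<Sum>e<n. law n q t (\<eta> \<circ> bond_swap n e) - law n q t \<eta>)) (at t)" for \<eta> t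
      by (auto intro!: derivative_eq_intros law_deriv)
    fix \<eta> u assume "\<eta> \<in> configs n" "\<And>\<xi>. \<xi> \<in> configs n \<Longrightarrow> law n q u \<eta> - c \<le> law n q u \<xi> - c"
    then show "0 \<le> (real n)\<^sup>2 * (\<Sum>e<n. law n q u (\<eta> \<circ> bond_swap n e) - law n q u \<eta>)"
      by (intro mult_nonneg_nonneg sum_nonneg) (auto simp: configs_bond_swap)
  qed (use assms in \<open>auto simp: law_0\<close>)
  then show ?thesis by simp
qed

definition ent :: "nat \<Rightarrow> (config \<Rightarrow> real) \<Rightarrow> (config \<Rightarrow> real) \<Rightarrow> real" where
  "ent n q r = (\<Sum>\<eta>\<in>configs n. q \<eta> * ln (q \<eta> / r \<eta>))"

text \<open>Termwise \<open>q * ln (q / r) \<ge> q - r\<close>, and the right-hand sides sum to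
  0.\<close>

lemma ent_nonneg:
  assumes q: "\<And>\<eta>. \<eta> \<in> configs n \<Longrightarrow> 0 \<le> q \<eta>" and r: "\<And>\<eta>. \<eta> \<in> configs n \<Longrightarrow> 0 < r \<eta>"
    and eq: "(\<Sum>\<eta>\<in>configs n. q \<eta>) = (\<Sum>\<eta>\<in>configs n. r \<eta>)"
  shows "0 \<le> ent n q r"
proof -
  have "q \<eta> - r \<eta> \<le> q \<eta> * ln (q \<eta> / r \<eta>)" if "\<eta> \<in> configs n" for \<eta>
  proof (cases "q \<eta> = 0")
    case False
    then have qp: "q \<eta> > 0" using q[OF that] by simp
    have "ln (r \<eta> / q \<eta>) \<le> r \<eta> / q \<eta> - 1"
      using r[OF that] qp by (intro ln_le_minus_one) simp
    then have "q \<eta> * ln (r \<eta> / q \<eta>) \<le> q \<eta> * (r \<eta> / q \<eta> - 1)"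
      using qp by (intro mult_left_mono) auto
    moreover have "ln (q \<eta> / r \<eta>) = - ln (r \<eta> / q \<eta>)"
      using qp r[OF that] by (simp add: ln_div)
    ultimately show ?thesis using qp by (simp add: right_diff_distrib)
  qed (use r[OF that] in auto)
  then have "(\<Sum>\<eta>\<in>configs n. q \<eta> - r \<eta>) \<le> ent n q r"
    unfolding ent_def by (rule sum_mono)
  then show ?thesis by (simp add: sum_subtractf eq)
qed

text \<open>Yau's entropy inequality for the symmetric dynamics: only the elementary bound
  \<open>ln z \<le> z - 1\<close> is used, so no lower bound on the dissipation is kept.\<close>

lemma ent_law_deriv:
  assumes q: "\<And>\<eta>. \<eta> \<in> configs n \<Longrightarrow> 0 < law n q t \<eta>" and r: "\<And>\<eta>. \<eta> \<in> configs n \<Longrightarrow> 0 < r t \<eta>"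
    and r': "\<And>\<eta>. \<eta> \<in> configs n \<Longrightarrow> ((\<lambda>t. r t \<eta>) has_real_derivative r' \<eta>) (at t)"
  shows "\<exists>D. ((\<lambda>t. ent n (law n q t) (r t)) has_real_derivative D) (at t) \<and>
     D \<le> (\<Sum>\<eta>\<in>configs n. law n q t \<eta> *
       ((real n)\<^sup>2 * (\<Sum>e<n. r t (\<eta> \<circ> bond_swap n e) / r t \<eta> - 1) - r' \<eta> / r t \<eta>))"
proof -
  let ?q = "law n q t" and ?r = "r t" and ?\<tau> = "\<lambda>e \<eta>. \<eta> \<circ> bond_swap n e"
  define q' where "q' \<eta> = (real n)\<^sup>2 * (\<Sum>e<n. ?q (?\<tau> e \<eta>) - ?q \<eta>)" for \<eta>
  define g where "g \<eta> = ln (?q \<eta> / ?r \<eta>)" for \<eta>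
  define D where "D = (\<Sum>\<eta>\<in>configs n. q' \<eta> * g \<eta> + q' \<eta> - ?q \<eta> * (r' \<eta> / ?r \<eta>))"
  have "((\<lambda>t. ent n (law n q t) (r t)) has_real_derivative D) (at t)"
    unfolding ent_def D_def
  proof (rule DERIV_sum)
    fix \<eta> assume \<eta>: "\<eta> \<in> configs n"
    have "((\<lambda>t. law n q t \<eta> / r t \<eta>) has_real_derivative (q' \<eta> * ?r \<eta> - ?q \<eta> * r' \<eta>) / (?r \<eta> * ?r \<eta>)) (at t)"
      using r[OF \<eta>] by (intro DERIV_divide r'[OF \<eta>]) (auto simp: q'_def law_deriv)
    then have "((\<lambda>t. ln (law n q t \<eta> / r t \<eta>)) has_real_derivative
        1 / (?q \<eta> / ?r \<eta>) * ((q' \<eta> * ?r \<eta> - ?q \<eta> * r' \<eta>) / (?r \<eta> * ?r \<eta>))) (at t)"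
      using q[OF \<eta>] r[OF \<eta>] by (intro DERIV_chain2[OF DERIV_ln_divide]) auto
    from DERIV_mult[OF law_deriv[of n q \<eta> t, folded q'_def] this]
    show "((\<lambda>t. law n q t \<eta> * ln (law n q t \<eta> / r t \<eta>)) has_real_derivative
        q' \<eta> * g \<eta> + q' \<eta> - ?q \<eta> * (r' \<eta> / ?r \<eta>)) (at t)"
      by (rule DERIV_cong) (use q[OF \<eta>] r[OF \<eta>] in \<open>simp add: g_def field_simps\<close>)
  qed
  moreover have "D \<le> (\<Sum>\<eta>\<in>configs n. ?q \<eta> * ((real n)\<^sup>2 * (\<Sum>e<n. ?r (?\<tau> e \<eta>) / ?r \<eta> - 1) - r' \<eta> / ?r \<eta>))"
  proof -
    \<comment> \<open>Summation by parts: the symmetric dynamics moves from the law to the test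
      function.\<close>
    have swap: "(\<Sum>\<eta>\<in>configs n. q' \<eta> * F \<eta>) = (real n)\<^sup>2 * (\<Sum>e<n. \<Sum>\<eta>\<in>configs n. ?q \<eta> * (F (?\<tau> e \<eta>) - F \<eta>))" for F
    proof -
      have "(\<Sum>\<eta>\<in>configs n. ?q (?\<tau> e \<eta>) * F \<eta>) = (\<Sum>\<eta>\<in>configs n. ?q \<eta> * F (?\<tau> e \<eta>))" if "e < n" for e
        using sum_configs_bond_swap[OF that, of "\<lambda>\<eta>. ?q (?\<tau> e \<eta>) * F \<eta>"] by simp
      then have "(\<Sum>e<n. \<Sum>\<eta>\<in>configs n. ?q \<eta> * (F (?\<tau> e \<eta>) - F \<eta>)) =
          (\<Sum>e<n. \<Sum>\<eta>\<in>configs n. (?q (?\<tau> e \<eta>) - ?q \<eta>) * F \<eta>)"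
        by (simp add: right_diff_distrib left_diff_distrib sum_subtractf)
      also have "\<dots> = (\<Sum>\<eta>\<in>configs n. \<Sum>e<n. (?q (?\<tau> e \<eta>) - ?q \<eta>) * F \<eta>)"
        by (rule sum.swap)
      finally show ?thesis
        by (simp add: q'_def sum_distrib_left sum_distrib_right mult.assoc)
    qed
    have key: "(\<Sum>\<eta>\<in>configs n. ?q \<eta> * (g (?\<tau> e \<eta>) - g \<eta>)) \<le> (\<Sum>\<eta>\<in>configs n. ?q \<eta> * (?r (?\<tau> e \<eta>) / ?r \<eta> - 1))"
      if e: "e < n" for e
    proof -
      \<comment> \<open>\<open>ln z \<le> z - 1\<close> for \<open>z\<close> the quotient of the
        densities \<open>law / r\<close> at the two configurations; the factor
        \<open>?q \<eta>\<close> cancels against its denominator. Reindexing by the exchange then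
        turns the bound into a ratio of reference masses.\<close>
      have "?q \<eta> * (g (?\<tau> e \<eta>) - g \<eta>) \<le> ?q (?\<tau> e \<eta>) * (?r \<eta> / ?r (?\<tau> e \<eta>)) - ?q \<eta>"
        if \<eta>: "\<eta> \<in> configs n" for \<eta>
      proof -
        have pos: "0 < ?q \<eta>" "0 < ?q (?\<tau> e \<eta>)" "0 < ?r \<eta>" "0 < ?r (?\<tau> e \<eta>)"
          using q r \<eta> configs_bond_swap[OF \<eta> e] by auto
        have "g (?\<tau> e \<eta>) - g \<eta> = ln ((?q (?\<tau> e \<eta>) / ?r (?\<tau> e \<eta>)) / (?q \<eta> / ?r \<eta>))"
          using pos by (subst ln_div) (auto simp: g_def)
        also have "\<dots> \<le> (?q (?\<tau> e \<eta>) / ?r (?\<tau> e \<eta>)) / (?q \<eta> / ?r \<eta>) - 1"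
          using pos by (intro ln_le_minus_one) auto
        finally have "?q \<eta> * (g (?\<tau> e \<eta>) - g \<eta>) \<le> ?q \<eta> * ((?q (?\<tau> e \<eta>) / ?r (?\<tau> e \<eta>)) / (?q \<eta> / ?r \<eta>) - 1)"
          using pos by (intro mult_left_mono) auto
        also have "\<dots> = ?q (?\<tau> e \<eta>) * (?r \<eta> / ?r (?\<tau> e \<eta>)) - ?q \<eta>"
          using pos by (simp add: field_simps)
        finally show ?thesis .
      qed
      then have "(\<Sum>\<eta>\<in>configs n. ?q \<eta> * (g (?\<tau> e \<eta>) - g \<eta>)) \<le>
          (\<Sum>\<eta>\<in>configs n. ?q (?\<tau> e \<eta>) * (?r \<eta> / ?r (?\<tau> e \<eta>)) - ?q \<eta>)"
        by (intro sum_mono)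
      also have "\<dots> = (\<Sum>\<eta>\<in>configs n. ?q \<eta> * (?r (?\<tau> e \<eta>) / ?r \<eta>)) - (\<Sum>\<eta>\<in>configs n. ?q \<eta>)"
        using sum_configs_bond_swap[OF e, of "\<lambda>\<eta>. ?q (?\<tau> e \<eta>) * (?r \<eta> / ?r (?\<tau> e \<eta>))"]
        by (simp add: sum_subtractf)
      finally show ?thesis
        by (simp add: right_diff_distrib sum_subtractf)
    qed
    have "D = (real n)\<^sup>2 * (\<Sum>e<n. \<Sum>\<eta>\<in>configs n. ?q \<eta> * (g (?\<tau> e \<eta>) - g \<eta>)) - (\<Sum>\<eta>\<in>configs n. ?q \<eta> * (r' \<eta> / ?r \<eta>))"
      \<comment> \<open>The constant function in \<open>swap\<close> shows that the derivatives of
        the masses sum to 0.\<close>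
      using swap[of g] swap[of "\<lambda>_. 1"] by (simp add: D_def sum.distrib sum_subtractf)
    also have "\<dots> \<le> (real n)\<^sup>2 * (\<Sum>e<n. \<Sum>\<eta>\<in>configs n. ?q \<eta> * (?r (?\<tau> e \<eta>) / ?r \<eta> - 1)) - (\<Sum>\<eta>\<in>configs n. ?q \<eta> * (r' \<eta> / ?r \<eta>))"
      by (intro diff_right_mono mult_left_mono sum_mono key) auto
    also have "(\<Sum>e<n. \<Sum>\<eta>\<in>configs n. ?q \<eta> * (?r (?\<tau> e \<eta>) / ?r \<eta> - 1)) =
        (\<Sum>\<eta>\<in>configs n. \<Sum>e<n. ?q \<eta> * (?r (?\<tau> e \<eta>) / ?r \<eta> - 1))"
      by (rule sum.swap)
    also have "(real n)\<^sup>2 * \<dots> - (\<Sum>\<eta>\<in>configs n. ?q \<eta> * (r' \<eta> / ?r \<eta>)) =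
        (\<Sum>\<eta>\<in>configs n. ?q \<eta> * ((real n)\<^sup>2 * (\<Sum>e<n. ?r (?\<tau> e \<eta>) / ?r \<eta> - 1) - r' \<eta> / ?r \<eta>))"
      unfolding right_diff_distrib sum_subtractf[of "\<lambda>\<eta>. ?q \<eta> * ((real n)\<^sup>2 * _ \<eta>)"]
      by (simp add: sum_distrib_left mult_ac sum_subtractf right_diff_distrib)
    finally show ?thesis .
  qed
  ultimately show ?thesis by blast
qed

section \<open>Product measures with a profile\<close>

definition bern :: "nat \<Rightarrow> (nat \<Rightarrow> real) \<Rightarrow> config \<Rightarrow> real" where
  "bern n \<rho> \<eta> = (\<Prod>i<n. if \<eta> i = 1 then \<rho> i else 1 - \<rho> i)"

lemma bern_pos:
  assumes "\<And>i. i < n \<Longrightarrow> 0 < \<rho> i \<and> \<rho> i < 1"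
  shows "0 < bern n \<rho> \<eta>"
  unfolding bern_def using assms by (intro prod_pos) auto

lemma sum_bern: "(\<Sum>\<eta>\<in>configs n. bern n \<rho> \<eta>) = 1"
proof -
  have "(\<Prod>i<n. \<Sum>a\<in>{0, 1::nat}. if a = 1 then \<rho> i else 1 - \<rho> i) = (\<Sum>\<eta>\<in>configs n. bern n \<rho> \<eta>)"
    unfolding configs_def bern_def by (rule prod_sum_PiE) auto
  then show ?thesis by simp
qed

text \<open>On configurations this is the derivative of \<open>ln (bern n \<rho> \<eta>)\<close>
  with respect to \<open>\<rho> i\<close>: the centred occupation variable divided by its
  variance.\<close>

definition fluct :: "(nat \<Rightarrow> real) \<Rightarrow> nat \<Rightarrow> config \<Rightarrow> real" where
  "fluct \<rho> i \<eta> = (real (\<eta> i) - \<rho> i) / (\<rho> i * (1 - \<rho> i))"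

lemma bern_deriv:
  assumes \<rho>: "\<And>i. i < n \<Longrightarrow> 0 < \<rho> i t \<and> \<rho> i t < 1" and \<eta>: "\<eta> \<in> configs n"
    and d: "\<And>i. i < n \<Longrightarrow> (\<rho> i has_real_derivative \<rho>' i) (at t)"
  shows "((\<lambda>t. bern n (\<lambda>i. \<rho> i t) \<eta>) has_real_derivative
     bern n (\<lambda>i. \<rho> i t) \<eta> * (\<Sum>i<n. \<rho>' i * fluct (\<lambda>i. \<rho> i t) i \<eta>)) (at t)"
proof -
  have "((\<lambda>t. \<Prod>i<n. if \<eta> i = 1 then \<rho> i t else 1 - \<rho> i t) has_real_derivative
      (\<Prod>i<n. if \<eta> i = 1 then \<rho> i t else 1 - \<rho> i t) *
      (\<Sum>i<n. (if \<eta> i = 1 then \<rho>' i else - \<rho>' i) / (if \<eta> i = 1 then \<rho> i t else 1 - \<rho> i t))) (at t)"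
  proof (rule has_field_derivative_prod')
    fix i assume i: "i \<in> {..<n}"
    show "(if \<eta> i = 1 then \<rho> i t else 1 - \<rho> i t) \<noteq> 0"
      using \<rho>[of i] i by auto
    show "((\<lambda>t. if \<eta> i = 1 then \<rho> i t else 1 - \<rho> i t) has_real_derivative (if \<eta> i = 1 then \<rho>' i else - \<rho>' i)) (at t)"
      using i by (auto intro!: derivative_eq_intros d)
  qed
  moreover have "(if \<eta> i = 1 then \<rho>' i else - \<rho>' i) / (if \<eta> i = 1 then \<rho> i t else 1 - \<rho> i t) =
      \<rho>' i * fluct (\<lambda>i. \<rho> i t) i \<eta>" if "i < n" for i
    using config_values[OF \<eta> that] \<rho>[OF that] by (auto simp: fluct_def field_simps)
  ultimately show ?thesis
    by (simp add: bern_def)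
qed

text \<open>The ratio of the exchanged to the original product mass if the first end of the bond is
  empty and the second occupied, \<open>p\<close> and \<open>s\<close> being the densities there;
  interchanging \<open>p\<close> and \<open>s\<close> gives the opposite case.\<close>

lemma odds_ratio_identity:
  fixes p s :: real
  assumes "s \<noteq> 0" "1 - p \<noteq> 0"
  shows "p * (1 - s) / ((1 - p) * s) - 1 = (s - p) * (- (1 / (1 - p)) - 1 / s) + (s - p) * (s - p) / ((1 - p) * s)"
proof -
  define a where "a = 1 - p"
  have a: "a \<noteq> 0" using assms by (simp add: a_def)
  have "p * (1 - s) / (a * s) - 1 = (p * (1 - s) - a * s) / (a * s)"
    using a assms(1) by (simp add: diff_divide_distrib)
  also have "p * (1 - s) - a * s = (s - p) * (- s - a) + (s - p) * (s - p)"
    by (simp add: a_def algebra_simps)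
  also have "\<dots> / (a * s) = (s - p) * (- (1 / a) - 1 / s) + (s - p) * (s - p) / (a * s)"
    using a assms(1) by (simp add: field_simps)
  finally show ?thesis by (simp add: a_def)
qed

text \<open>Exact because the occupation variables are \<open>0\<close> or \<open>1\<close>: for each of the four values of the
  pair both sides agree.\<close>

lemma bern_bond_swap_ratio:
  assumes n: "2 \<le> n" and e: "e < n" and \<eta>: "\<eta> \<in> configs n" and \<rho>: "\<And>i. i < n \<Longrightarrow> 0 < \<rho> i \<and> \<rho> i < 1"
  shows "bern n \<rho> (\<eta> \<circ> bond_swap n e) / bern n \<rho> \<eta> - 1 =
     (\<rho> (nxt n e) - \<rho> e) * (fluct \<rho> e \<eta> - fluct \<rho> (nxt n e) \<eta>) -
     (\<rho> (nxt n e) - \<rho> e)\<^sup>2 * (fluct \<rho> e \<eta> * fluct \<rho> (nxt n e) \<eta>)"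
proof -
  let ?f = "nxt n e"
  define b where "b i v = (if v = (1::nat) then \<rho> i else 1 - \<rho> i)" for i v
  define R where "R = (\<Prod>i\<in>{..<n} - {e} - {?f}. b i (\<eta> i))"
  have f: "?f < n" "?f \<noteq> e" using n e by (auto simp: nxt_less nxt_neq)
  have b0: "b i v > 0" if "i < n" for i v
    using \<rho>[OF that] by (auto simp: b_def)
  have split: "bern n \<rho> \<xi> = b e (\<xi> e) * (b ?f (\<xi> ?f) * (\<Prod>i\<in>{..<n} - {e} - {?f}. b i (\<xi> i)))" for \<xi>
    using f e unfolding bern_def b_def[symmetric] by (simp add: prod.remove[of _ e] prod.remove[of _ ?f])
  have "bern n \<rho> \<eta> = b e (\<eta> e) * (b ?f (\<eta> ?f) * R)"
    by (simp add: split R_def)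
  moreover have "bern n \<rho> (\<eta> \<circ> bond_swap n e) = b e (\<eta> ?f) * (b ?f (\<eta> e) * R)"
    unfolding split R_def by (simp add: bond_swap_def Transposition.transpose_def)
  moreover have "R > 0"
    unfolding R_def by (intro prod_pos) (auto intro: b0)
  ultimately have "bern n \<rho> (\<eta> \<circ> bond_swap n e) / bern n \<rho> \<eta> = (b e (\<eta> ?f) * b ?f (\<eta> e)) / (b e (\<eta> e) * b ?f (\<eta> ?f))"
    by (simp add: mult.assoc[symmetric])
  also have "\<dots> - 1 = (\<rho> ?f - \<rho> e) * (fluct \<rho> e \<eta> - fluct \<rho> ?f \<eta>) - (\<rho> ?f - \<rho> e)\<^sup>2 * (fluct \<rho> e \<eta> * fluct \<rho> ?f \<eta>)"
  proof -
    define p where "p = \<rho> e"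
    define s where "s = \<rho> ?f"
    have "p \<noteq> 0" "1 - p \<noteq> 0" "s \<noteq> 0" "1 - s \<noteq> 0" using \<rho>[OF e] \<rho>[OF f(1)] by (auto simp: p_def s_def)
    then show ?thesis
      using config_values[OF \<eta> e] config_values[OF \<eta> f(1)]
      using odds_ratio_identity[of p s] odds_ratio_identity[of s p]
      by (auto simp: b_def fluct_def power2_eq_square mult_ac simp flip: p_def s_def; simp add: field_simps)
  qed
  finally show ?thesis .
qed

lemma semigroup_fluct:
  assumes x: "x \<in> configs n"
  shows "ssep_at n t (fluct \<rho> i) x = (occ n x i t - \<rho> i) / (\<rho> i * (1 - \<rho> i))"
proof -
  have "fluct \<rho> i = (\<lambda>\<eta>. (1 / (\<rho> i * (1 - \<rho> i))) * (real (\<eta> i) - \<rho> i))"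
    by (simp add: fluct_def fun_eq_iff)
  then show ?thesis
    by (simp only: semigroup_cmult[OF x] semigroup_diff[OF x] semigroup_const[OF x]) (simp add: occ_def)
qed

lemma semigroup_fluct_fluct:
  assumes x: "x \<in> configs n"
  shows "ssep_at n t (\<lambda>\<eta>. fluct \<rho> i \<eta> * fluct \<rho> j \<eta>) x =
     (corr n x i j t + (occ n x i t - \<rho> i) * (occ n x j t - \<rho> j)) / ((\<rho> i * (1 - \<rho> i)) * (\<rho> j * (1 - \<rho> j)))"
proof -
  define D where "D = (\<rho> i * (1 - \<rho> i)) * (\<rho> j * (1 - \<rho> j))"
  have "(\<lambda>\<eta>. fluct \<rho> i \<eta> * fluct \<rho> j \<eta>) = (\<lambda>\<eta>. (1 / D) *
     ((real (\<eta> i) * real (\<eta> j) - \<rho> j * real (\<eta> i)) - (\<rho> i * real (\<eta> j) - \<rho> i * \<rho> j)))"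
    by (simp add: fluct_def fun_eq_iff flip: D_def) (simp add: algebra_simps)
  then show ?thesis
    unfolding D_def[symmetric]
    by (simp only: semigroup_cmult[OF x] semigroup_diff[OF x] semigroup_const[OF x])
       (simp add: occ_def corr_def algebra_simps diff_divide_distrib add_divide_distrib)
qed

text \<open>\<open>- (a * b) \<le> (b - a)\<^sup>2 / 4\<close> and
  \<open>(d - e)\<^sup>2 \<le> 2 * d\<^sup>2 + 2 * e\<^sup>2\<close>. Applied with \<open>a\<close>,
  \<open>b\<close> the deviations of the mean occupations from the profile at two neighbouring
  sites, and \<open>d\<close>, \<open>e\<close> the gradients of the two.\<close>

lemma neg_mult_le_of_diff:
  fixes a b d e :: real
  assumes "b - a = d - e"
  shows "- (a * b) \<le> d\<^sup>2 / 2 + e\<^sup>2 / 2"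
proof -
  have "(b - a)\<^sup>2 = (d - e)\<^sup>2" using assms by simp
  moreover have "0 \<le> (a + b)\<^sup>2" "0 \<le> (d + e)\<^sup>2" by simp_all
  ultimately have "4 * - (a * b) \<le> 2 * d\<^sup>2 + 2 * e\<^sup>2"
    by (simp add: power2_eq_square algebra_simps)
  then show ?thesis by linarith
qed

text \<open>\<open>R\<close> stands for the discretization error of the heat equation; it is
  multiplied by bounded quantities only. The sum of half squared gradients minus correlations is the
  negative of the sum in \<open>corr_energy_deriv\<close>; its summands are nonnegative, so
  replacing the coefficients by \<open>K\<^sup>2 / c\<^sup>2\<close> only enlarges the
  bound.\<close>

lemma semigroup_drift_le:
  fixes R \<rho> :: "nat \<Rightarrow> real"
  assumes x: "x \<in> configs n" and n: "2 \<le> n" and t: "0 \<le> t" and c: "0 < c"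
    and \<rho>c: "\<And>i. i < n \<Longrightarrow> c \<le> \<rho> i * (1 - \<rho> i)" and \<rho>: "\<And>i. i < n \<Longrightarrow> 0 < \<rho> i \<and> \<rho> i < 1"
    and R: "\<And>i. i < n \<Longrightarrow> \<bar>R i\<bar> \<le> r" and K: "\<And>i. i < n \<Longrightarrow> \<bar>real n * (\<rho> (nxt n i) - \<rho> i)\<bar> \<le> K"
  shows "ssep_at n t (\<lambda>\<eta>. (\<Sum>i<n. R i * fluct \<rho> i \<eta>) -
       (\<Sum>i<n. (real n * (\<rho> (nxt n i) - \<rho> i))\<^sup>2 * (fluct \<rho> i \<eta> * fluct \<rho> (nxt n i) \<eta>))) x
    \<le> real n * r / c + K\<^sup>2 / c\<^sup>2 * ((\<Sum>i<n. (occ n x (nxt n i) t - occ n x i t)\<^sup>2 / 2 - corr n x i (nxt n i) t) + K\<^sup>2)"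
proof -
  let ?A = "\<lambda>i. occ n x i t" and ?C = "\<lambda>i. corr n x i (nxt n i) t" and ?\<chi> = "\<lambda>i. \<rho> i * (1 - \<rho> i)"
  have r0: "0 \<le> r" and K0: "0 \<le> K" using R[of 0] K[of 0] n by auto
  have "R i * ((?A i - \<rho> i) / ?\<chi> i) \<le> r / c" if i: "i < n" for i
  proof -
    have "\<bar>?A i - \<rho> i\<bar> \<le> 1"
      using occ_nonneg[OF x i t] occ_le_1[OF x i t] \<rho>[OF i] by auto
    then have "\<bar>?A i - \<rho> i\<bar> / \<bar>?\<chi> i\<bar> \<le> 1 / c"
      using \<rho>c[OF i] c by (intro frac_le) auto
    then have "\<bar>R i\<bar> * (\<bar>?A i - \<rho> i\<bar> / \<bar>?\<chi> i\<bar>) \<le> r * (1 / c)"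
      using R[OF i] r0 by (intro mult_mono) auto
    moreover have "R i * ((?A i - \<rho> i) / ?\<chi> i) \<le> \<bar>R i\<bar> * (\<bar>?A i - \<rho> i\<bar> / \<bar>?\<chi> i\<bar>)"
      using abs_ge_self[of "R i * ((?A i - \<rho> i) / ?\<chi> i)"] by (simp only: abs_mult abs_divide)
    ultimately show ?thesis by simp
  qed
  then have lin: "(\<Sum>i<n. R i * ((?A i - \<rho> i) / ?\<chi> i)) \<le> real n * r / c"
    using sum_mono[of "{..<n}" "\<lambda>i. R i * ((?A i - \<rho> i) / ?\<chi> i)" "\<lambda>_. r / c"] by simp
  have "- ((real n * (\<rho> (nxt n i) - \<rho> i))\<^sup>2 * ((?C i + (?A i - \<rho> i) * (?A (nxt n i) - \<rho> (nxt n i))) / (?\<chi> i * ?\<chi> (nxt n i))))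
      \<le> K\<^sup>2 / c\<^sup>2 * ((?A (nxt n i) - ?A i)\<^sup>2 / 2 - ?C i + K\<^sup>2 / real n)" if i: "i < n" for i
  proof -
    let ?j = "nxt n i"
    define g where "g = (real n * (\<rho> ?j - \<rho> i))\<^sup>2 / (?\<chi> i * ?\<chi> ?j)"
    define B where "B = (?A ?j - ?A i)\<^sup>2 / 2 - ?C i + K\<^sup>2 / real n"
    have j: "?j < n" "?j \<noteq> i" using n i by (auto simp: nxt_less nxt_neq)
    have C: "?C i \<le> 0" using corr_nonpos[OF x i j(1) j(2)[symmetric] t] .
    have sq: "(real n * (\<rho> ?j - \<rho> i))\<^sup>2 \<le> K\<^sup>2"
      using power_mono[OF K[OF i], of 2] by simp
    then have grad: "(real n)\<^sup>2 * (\<rho> ?j - \<rho> i)\<^sup>2 \<le> K\<^sup>2" by (simp add: power_mult_distrib)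
    have g: "0 \<le> g" "g \<le> K\<^sup>2 / c\<^sup>2"
    proof -
      have "c * c \<le> ?\<chi> i * ?\<chi> ?j"
        using \<rho>c[OF i] \<rho>c[OF j(1)] c by (intro mult_mono) auto
      then show "g \<le> K\<^sup>2 / c\<^sup>2"
        unfolding g_def using c sq by (intro frac_le) (auto simp: power2_eq_square[of c])
      show "0 \<le> g"
        unfolding g_def using \<rho>[OF i] \<rho>[OF j(1)] by (intro divide_nonneg_nonneg mult_nonneg_nonneg) auto
    qed
    \<comment> \<open>The gradient bound gives even \<open>K\<^sup>2 / n\<^sup>2\<close>, but with
      \<open>K\<^sup>2 / n\<close> the sum over the sites already stays at
      \<open>K\<^sup>2\<close>.\<close>
    have "(\<rho> ?j - \<rho> i)\<^sup>2 \<le> K\<^sup>2 / real n"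
    proof -
      have "real n * (\<rho> ?j - \<rho> i)\<^sup>2 \<le> (real n)\<^sup>2 * (\<rho> ?j - \<rho> i)\<^sup>2"
        using n by (intro mult_right_mono) (auto simp: power2_eq_square)
      with grad show ?thesis using n by (simp add: field_simps)
    qed
    moreover have "- ((?A i - \<rho> i) * (?A ?j - \<rho> ?j)) \<le> (?A ?j - ?A i)\<^sup>2 / 2 + (\<rho> ?j - \<rho> i)\<^sup>2 / 2"
      by (rule neg_mult_le_of_diff) simp
    moreover have "(\<rho> ?j - \<rho> i)\<^sup>2 \<ge> 0" "(?A ?j - ?A i)\<^sup>2 \<ge> 0" by simp_all
    ultimately have "- (?C i + (?A i - \<rho> i) * (?A ?j - \<rho> ?j)) \<le> B" "0 \<le> B"
      unfolding B_def using C by linarith+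
    then have "g * - (?C i + (?A i - \<rho> i) * (?A ?j - \<rho> ?j)) \<le> K\<^sup>2 / c\<^sup>2 * B"
      using mult_left_mono[of "- (?C i + (?A i - \<rho> i) * (?A ?j - \<rho> ?j))" B g] mult_right_mono[of g "K\<^sup>2 / c\<^sup>2" B] g
      by linarith
    then have "- (g * (?C i + (?A i - \<rho> i) * (?A ?j - \<rho> ?j))) \<le> K\<^sup>2 / c\<^sup>2 * B"
      by (simp only: mult_minus_right)
    then show ?thesis
      unfolding g_def B_def by (simp only: times_divide_eq_left times_divide_eq_right)
  qed
  then have "(\<Sum>i<n. - ((real n * (\<rho> (nxt n i) - \<rho> i))\<^sup>2 * ((?C i + (?A i - \<rho> i) * (?A (nxt n i) - \<rho> (nxt n i))) / (?\<chi> i * ?\<chi> (nxt n i)))))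
      \<le> (\<Sum>i<n. K\<^sup>2 / c\<^sup>2 * ((?A (nxt n i) - ?A i)\<^sup>2 / 2 - ?C i + K\<^sup>2 / real n))"
    by (intro sum_mono) auto
  also have "\<dots> = K\<^sup>2 / c\<^sup>2 * (\<Sum>i<n. ((?A (nxt n i) - ?A i)\<^sup>2 / 2 - ?C i) + K\<^sup>2 / real n)"
    by (simp only: sum_distrib_left)
  also have "\<dots> = K\<^sup>2 / c\<^sup>2 * ((\<Sum>i<n. (?A (nxt n i) - ?A i)\<^sup>2 / 2 - ?C i) + K\<^sup>2)"
    using n by (simp add: sum.distrib)
  finally show ?thesis
    using lin by (simp add: semigroup_diff[OF x] semigroup_sum[OF x] semigroup_cmult[OF x] semigroup_fluct[OF x]
        semigroup_fluct_fluct[OF x] sum_negf)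
qed

section \<open>Growth of the entropy relative to a moving profile\<close>

lemma increment_le:
  fixes f :: "real \<Rightarrow> real"
  assumes "s \<le> t" "\<And>u. s \<le> u \<Longrightarrow> u \<le> t \<Longrightarrow> \<exists>D. (f has_real_derivative D) (at u) \<and> D \<le> b"
  shows "f t - f s \<le> (t - s) * b"
proof -
  have "b * s - f s \<le> b * t - f t"
  proof (rule DERIV_nonneg_imp_nondecreasing[OF assms(1)])
    fix u assume "s \<le> u" "u \<le> t"
    then obtain D where "(f has_real_derivative D) (at u)" "D \<le> b" using assms(2) by blast
    then show "\<exists>y. ((\<lambda>u. b * u - f u) has_real_derivative y) (at u) \<and> 0 \<le> y"
      by (intro exI[of _ "b - D"]) (auto intro!: derivative_eq_intros)
  qed
  then show ?thesis by (simp add: algebra_simps)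
qed

lemma prv_nxt: "2 \<le> n \<Longrightarrow> i < n \<Longrightarrow> prv n (nxt n i) = i"
  using nxt_eq_iff_prv[of n i "nxt n i"] by (simp add: nxt_less)

text \<open>Adding a multiple of the expected \<open>corr_energy\<close> to the relative entropy cancels the nearest
  neighbour correlations in the derivative, so that no time integral is needed.\<close>

lemma ent_growth_pos:
  fixes \<rho> \<rho>' :: "nat \<Rightarrow> real \<Rightarrow> real"
  assumes n: "2 \<le> n" and s: "0 \<le> s" "s \<le> t" and c: "0 < c"
    and q: "\<And>\<eta>. \<eta> \<in> configs n \<Longrightarrow> 0 < q \<eta>" and q1: "(\<Sum>\<eta>\<in>configs n. q \<eta>) = 1"
    and \<rho>: "\<And>i u. i < n \<Longrightarrow> s \<le> u \<Longrightarrow> u \<le> t \<Longrightarrow> 0 < \<rho> i u \<and> \<rho> i u < 1"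
    and \<rho>c: "\<And>i u. i < n \<Longrightarrow> s \<le> u \<Longrightarrow> u \<le> t \<Longrightarrow> c \<le> \<rho> i u * (1 - \<rho> i u)"
    and \<rho>': "\<And>i u. i < n \<Longrightarrow> s \<le> u \<Longrightarrow> u \<le> t \<Longrightarrow> (\<rho> i has_real_derivative \<rho>' i u) (at u)"
    and r: "\<And>i u. i < n \<Longrightarrow> s \<le> u \<Longrightarrow> u \<le> t \<Longrightarrow>
      \<bar>(real n)\<^sup>2 * (\<rho> (nxt n i) u + \<rho> (prv n i) u - 2 * \<rho> i u) - \<rho>' i u\<bar> \<le> r"
    and K: "\<And>i u. i < n \<Longrightarrow> s \<le> u \<Longrightarrow> u \<le> t \<Longrightarrow> \<bar>real n * (\<rho> (nxt n i) u - \<rho> i u)\<bar> \<le> K"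
  shows "ent n (law n q t) (bern n (\<lambda>i. \<rho> i t)) \<le> ent n (law n q s) (bern n (\<lambda>i. \<rho> i s)) +
     K\<^sup>2 / c\<^sup>2 + (t - s) * (real n * r / c + K\<^sup>2 / c\<^sup>2 * (1 + K\<^sup>2))"
proof -
  define G where "G = K\<^sup>2 / c\<^sup>2"
  \<comment> \<open>Normalised so that \<open>a\<close> times the factor
    \<open>4 * n\<^sup>2 * (n - 1)\<close> of the nearest neighbour sum equals \<open>G\<close>, the
    coefficient of the same sum with opposite sign in \<open>semigroup_drift_le\<close>.\<close>
  define a where "a = G / (4 * (real n)\<^sup>2 * (real n - 1))"
  define Z where "Z u = (\<Sum>x\<in>configs n. q x * corr_energy n x u)" for u
  define W where "W u x = 4 * (real n)\<^sup>2 * (\<Sum>i<n. corr n x i i u) +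
     4 * (real n)\<^sup>2 * (real n - 1) * (\<Sum>i<n. corr n x i (nxt n i) u - (occ n x (nxt n i) u - occ n x i u)\<^sup>2 / 2)" for u x
  define Z' where "Z' u = (\<Sum>x\<in>configs n. q x * W u x)" for u
  define b where "b = real n * r / c + G * (1 + K\<^sup>2)"
  have G: "G \<ge> 0" by (simp add: G_def)
  have a: "a \<ge> 0" using G n by (simp add: a_def)
  have q0: "0 \<le> q x" if "x \<in> configs n" for x using q[OF that] by simp
  have dZ: "(Z has_real_derivative Z' u) (at u)" if "0 \<le> u" for u
    unfolding Z_def[abs_def] Z'_def W_def by (intro DERIV_sum DERIV_cmult corr_energy_deriv n that)
  let ?\<Phi> = "\<lambda>u. ent n (law n q u) (bern n (\<lambda>i. \<rho> i u))"
  have "(?\<Phi> t + a * Z t) - (?\<Phi> s + a * Z s) \<le> (t - s) * b"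
  proof (rule increment_le[OF s(2)])
    fix u assume u: "s \<le> u" "u \<le> t"
    have u0: "0 \<le> u" using u s by simp
    let ?\<rho> = "\<lambda>i. \<rho> i u"
    define R where "R i = (real n)\<^sup>2 * (?\<rho> (nxt n i) + ?\<rho> (prv n i) - 2 * ?\<rho> i) - \<rho>' i u" for i
    define V where "V \<eta> = (\<Sum>i<n. R i * fluct ?\<rho> i \<eta>) -
       (\<Sum>i<n. (real n * (?\<rho> (nxt n i) - ?\<rho> i))\<^sup>2 * (fluct ?\<rho> i \<eta> * fluct ?\<rho> (nxt n i) \<eta>))" for \<eta>
    have qu: "0 < law n q u \<eta>" if "\<eta> \<in> configs n" for \<eta>
    proof -
      \<comment> \<open>The smallest initial mass is a positive lower bound that the evolution
        preserves.\<close>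
      have "Min (q ` configs n) \<le> law n q u \<eta>"
        using that by (intro law_ge u0) auto
      moreover have "0 < Min (q ` configs n)"
        using that q by (subst Min_gr_iff) auto
      ultimately show ?thesis by linarith
    qed
    have "\<exists>D. (?\<Phi> has_real_derivative D) (at u) \<and>
     D \<le> (\<Sum>\<eta>\<in>configs n. law n q u \<eta> *
       ((real n)\<^sup>2 * (\<Sum>e<n. bern n ?\<rho> (\<eta> \<circ> bond_swap n e) / bern n ?\<rho> \<eta> - 1) -
         bern n ?\<rho> \<eta> * (\<Sum>i<n. \<rho>' i u * fluct ?\<rho> i \<eta>) / bern n ?\<rho> \<eta>))"
      using \<rho>[OF _ u] \<rho>'[OF _ u] by (intro ent_law_deriv qu bern_pos bern_deriv) auto
    then obtain D where D: "(?\<Phi> has_real_derivative D) (at u)" and D_le: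
     "D \<le> (\<Sum>\<eta>\<in>configs n. law n q u \<eta> *
       ((real n)\<^sup>2 * (\<Sum>e<n. bern n ?\<rho> (\<eta> \<circ> bond_swap n e) / bern n ?\<rho> \<eta> - 1) -
         bern n ?\<rho> \<eta> * (\<Sum>i<n. \<rho>' i u * fluct ?\<rho> i \<eta>) / bern n ?\<rho> \<eta>))" by blast
    have V: "(real n)\<^sup>2 * (\<Sum>e<n. bern n ?\<rho> (\<eta> \<circ> bond_swap n e) / bern n ?\<rho> \<eta> - 1) -
         bern n ?\<rho> \<eta> * (\<Sum>i<n. \<rho>' i u * fluct ?\<rho> i \<eta>) / bern n ?\<rho> \<eta> = V \<eta>" if \<eta>: "\<eta> \<in> configs n" for \<eta>
    proof -
      have "bern n ?\<rho> \<eta> \<noteq> 0"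
        using bern_pos[of n ?\<rho> \<eta>] \<rho>[OF _ u] by auto
      moreover have "(\<Sum>e<n. bern n ?\<rho> (\<eta> \<circ> bond_swap n e) / bern n ?\<rho> \<eta> - 1) =
         (\<Sum>e<n. (?\<rho> (nxt n e) - ?\<rho> e) * (fluct ?\<rho> e \<eta> - fluct ?\<rho> (nxt n e) \<eta>) -
           (?\<rho> (nxt n e) - ?\<rho> e)\<^sup>2 * (fluct ?\<rho> e \<eta> * fluct ?\<rho> (nxt n e) \<eta>))"
        using \<rho>[OF _ u] by (intro sum.cong refl bern_bond_swap_ratio n \<eta>) auto
      \<comment> \<open>Shifting the site in the second half of each difference produces the
        discrete Laplacian of the profile, which \<open>\<rho>'\<close> compensates up to
        \<open>R\<close>.\<close>
      moreover have "(\<Sum>e<n. (?\<rho> (nxt n e) - ?\<rho> e) * (fluct ?\<rho> e \<eta> - fluct ?\<rho> (nxt n e) \<eta>)) =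
          (\<Sum>i<n. (?\<rho> (nxt n i) + ?\<rho> (prv n i) - 2 * ?\<rho> i) * fluct ?\<rho> i \<eta>)"
      proof -
        have "(\<Sum>e<n. (?\<rho> (nxt n e) - ?\<rho> e) * fluct ?\<rho> (nxt n e) \<eta>) =
            (\<Sum>e<n. (?\<rho> (nxt n e) - ?\<rho> (prv n (nxt n e))) * fluct ?\<rho> (nxt n e) \<eta>)"
          by (intro sum.cong refl) (simp add: prv_nxt[OF n])
        also have "\<dots> = (\<Sum>i<n. (?\<rho> i - ?\<rho> (prv n i)) * fluct ?\<rho> i \<eta>)"
          by (rule sum_nxt[of "\<lambda>i. (?\<rho> i - ?\<rho> (prv n i)) * fluct ?\<rho> i \<eta>"])
        finally show ?thesis
          by (simp add: right_diff_distrib sum_subtractf)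
             (simp add: algebra_simps sum.distrib sum_subtractf flip: sum_distrib_left)
      qed
      moreover have "(\<Sum>i<n. R i * fluct ?\<rho> i \<eta>) =
          (real n)\<^sup>2 * (\<Sum>i<n. (?\<rho> (nxt n i) + ?\<rho> (prv n i) - 2 * ?\<rho> i) * fluct ?\<rho> i \<eta>) - (\<Sum>i<n. \<rho>' i u * fluct ?\<rho> i \<eta>)"
        by (simp add: R_def left_diff_distrib sum_subtractf sum_distrib_left mult.assoc right_diff_distrib)
      moreover have "(\<Sum>i<n. (real n * (?\<rho> (nxt n i) - ?\<rho> i))\<^sup>2 * (fluct ?\<rho> i \<eta> * fluct ?\<rho> (nxt n i) \<eta>)) =
          (real n)\<^sup>2 * (\<Sum>i<n. (?\<rho> (nxt n i) - ?\<rho> i)\<^sup>2 * (fluct ?\<rho> i \<eta> * fluct ?\<rho> (nxt n i) \<eta>))"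
        unfolding power_mult_distrib by (simp add: sum_distrib_left mult.assoc)
      ultimately show ?thesis
        by (simp only: V_def sum_subtractf nonzero_mult_div_cancel_left not_False_eq_True right_diff_distrib)
    qed
    have Vx: "ssep_at n u V x \<le> real n * r / c + G * ((\<Sum>i<n. (occ n x (nxt n i) u - occ n x i u)\<^sup>2 / 2 - corr n x i (nxt n i) u) + K\<^sup>2)"
      if x: "x \<in> configs n" for x
      unfolding V_def[abs_def] G_def
      using \<rho>[OF _ u] \<rho>c[OF _ u] r[OF _ u] K[OF _ u] by (intro semigroup_drift_le x n u0 c) (auto simp: R_def)
    \<comment> \<open>The two multiples of \<open>E\<close> cancel. The diagonal leaves
      \<open>G * S / (n - 1)\<close> with \<open>S \<le> n / 4\<close>, which is at most
      \<open>G\<close> for \<open>2 \<le> n\<close>; this is the 1 in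
      \<open>1 + K\<^sup>2\<close>.\<close>
    have step: "ssep_at n u V x + a * W u x \<le> b"
      if x: "x \<in> configs n" for x
    proof -
      define E where "E = (\<Sum>i<n. (occ n x (nxt n i) u - occ n x i u)\<^sup>2 / 2 - corr n x i (nxt n i) u)"
      define S where "S = (\<Sum>i<n. corr n x i i u)"
      have E: "(\<Sum>i<n. corr n x i (nxt n i) u - (occ n x (nxt n i) u - occ n x i u)\<^sup>2 / 2) = - E"
        unfolding E_def sum_negf[symmetric] by simp
      have "S \<le> real n / 4" unfolding S_def by (rule sum_corr_diag_le[OF x u0])
      then have "G * S / (real n - 1) \<le> G * (real n / 4) / (real n - 1)"
        using n G by (intro divide_right_mono mult_left_mono) auto
      also have "\<dots> = G * ((real n / 4) / (real n - 1))" by simp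
      also have "\<dots> \<le> G * 1"
        using n G by (intro mult_left_mono) (auto simp: divide_le_eq)
      finally have "G * S / (real n - 1) \<le> G" by simp
      moreover have "a * (4 * (real n)\<^sup>2 * S + 4 * (real n)\<^sup>2 * (real n - 1) * (- E)) = G * S / (real n - 1) - G * E"
        using n by (simp add: a_def field_simps)
      ultimately show ?thesis
        using Vx[OF x] unfolding W_def E E_def[symmetric] S_def[symmetric] b_def by (simp add: distrib_left)
    qed
    have "D \<le> (\<Sum>\<eta>\<in>configs n. law n q u \<eta> * V \<eta>)"
      using D_le V by simp
    also have "\<dots> = (\<Sum>x\<in>configs n. q x * ssep_at n u V x)"
      by (rule law_expectation)
    finally have "D + a * Z' u \<le> (\<Sum>x\<in>configs n. q x * (ssep_at n u V x + a * W u x))"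
      by (simp add: Z'_def sum_distrib_left distrib_left sum.distrib mult.left_commute)
    also have "\<dots> \<le> (\<Sum>x\<in>configs n. q x * b)"
      by (intro sum_mono mult_left_mono step q0)
    also have "\<dots> = b" by (simp add: q1 flip: sum_distrib_right)
    finally have "D + a * Z' u \<le> b" .
    moreover have "((\<lambda>u. ?\<Phi> u + a * Z u) has_real_derivative D + a * Z' u) (at u)"
      by (intro DERIV_add D DERIV_cmult dZ u0)
    ultimately show "\<exists>D. ((\<lambda>u. ?\<Phi> u + a * Z u) has_real_derivative D) (at u) \<and> D \<le> b" by blast
  qed
  \<comment> \<open>Boundary terms: the energy is at most 0 at \<open>s\<close> and at least
    \<open>- (n\<^sup>3 / 8)\<close> at \<open>t\<close>, which costs at most
    \<open>G = K\<^sup>2 / c\<^sup>2\<close>.\<close>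
  moreover have "a * Z s \<le> 0"
    unfolding Z_def by (intro mult_nonneg_nonpos sum_nonpos mult_nonneg_nonpos corr_energy_bounds a q0 s)
  moreover have "- G \<le> a * Z t"
  proof -
    have "0 \<le> t" using s by simp
    have "(\<Sum>x\<in>configs n. q x * - (real n ^ 3 / 8)) \<le> Z t"
      unfolding Z_def by (intro sum_mono mult_left_mono corr_energy_bounds q0 \<open>0 \<le> t\<close>)
    then have "- (real n ^ 3 / 8) \<le> Z t"
      by (simp only: sum_distrib_right[symmetric] q1)
    then have "a * - (real n ^ 3 / 8) \<le> a * Z t"
      by (rule mult_left_mono[OF _ a])
    moreover have "a * (real n ^ 3 / 8) \<le> G"
    proof -
      have "a * (real n ^ 3 / 8) = G * (real n / (32 * (real n - 1)))"
        using n by (simp add: a_def power2_eq_square power3_eq_cube field_simps)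
      also have "\<dots> \<le> G * 1"
        using n G by (intro mult_left_mono) (auto simp: divide_le_eq)
      finally show ?thesis by simp
    qed
    ultimately show ?thesis by linarith
  qed
  ultimately show ?thesis unfolding b_def G_def by linarith
qed

lemma tendsto_x_ln_x_div:
  fixes f :: "'a \<Rightarrow> real"
  assumes "(f \<longlongrightarrow> l) F" "\<forall>\<^sub>F x in F. 0 \<le> f x" "0 \<le> l" "0 < r"
  shows "((\<lambda>x. f x * ln (f x / r)) \<longlongrightarrow> l * ln (l / r)) F"
proof -
  have "((\<lambda>x. (f x / r) * ln (f x / r)) \<longlongrightarrow> (l / r) * ln (l / r)) F"
    by (rule continuous_on_tendsto_compose[OF continuous_on_x_ln_x])
       (use assms in \<open>auto intro!: tendsto_intros elim!: eventually_mono\<close>)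
  then have "((\<lambda>x. r * ((f x / r) * ln (f x / r))) \<longlongrightarrow> r * ((l / r) * ln (l / r))) F"
    by (rule tendsto_mult_left)
  then show ?thesis using assms(4) by simp
qed

lemma ent_growth:
  fixes \<rho> \<rho>' :: "nat \<Rightarrow> real \<Rightarrow> real"
  assumes n: "2 \<le> n" and s: "0 \<le> s" "s \<le> t" and c: "0 < c"
    and q: "\<And>\<eta>. \<eta> \<in> configs n \<Longrightarrow> 0 \<le> q \<eta>" and q1: "(\<Sum>\<eta>\<in>configs n. q \<eta>) = 1"
    and \<rho>: "\<And>i u. i < n \<Longrightarrow> s \<le> u \<Longrightarrow> u \<le> t \<Longrightarrow> 0 < \<rho> i u \<and> \<rho> i u < 1"
    and \<rho>c: "\<And>i u. i < n \<Longrightarrow> s \<le> u \<Longrightarrow> u \<le> t \<Longrightarrow> c \<le> \<rho> i u * (1 - \<rho> i u)"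
    and \<rho>': "\<And>i u. i < n \<Longrightarrow> s \<le> u \<Longrightarrow> u \<le> t \<Longrightarrow> (\<rho> i has_real_derivative \<rho>' i u) (at u)"
    and r: "\<And>i u. i < n \<Longrightarrow> s \<le> u \<Longrightarrow> u \<le> t \<Longrightarrow>
      \<bar>(real n)\<^sup>2 * (\<rho> (nxt n i) u + \<rho> (prv n i) u - 2 * \<rho> i u) - \<rho>' i u\<bar> \<le> r"
    and K: "\<And>i u. i < n \<Longrightarrow> s \<le> u \<Longrightarrow> u \<le> t \<Longrightarrow> \<bar>real n * (\<rho> (nxt n i) u - \<rho> i u)\<bar> \<le> K"
  shows "ent n (law n q t) (bern n (\<lambda>i. \<rho> i t)) \<le> ent n (law n q s) (bern n (\<lambda>i. \<rho> i s)) +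
     K\<^sup>2 / c\<^sup>2 + (t - s) * (real n * r / c + K\<^sup>2 / c\<^sup>2 * (1 + K\<^sup>2))"
proof -
  \<comment> \<open>The entropy is differentiable in time only for strictly positive laws, hence the
    approximation by mixtures with the uniform law.\<close>
  let ?N = "real (card (configs n))"
  define p where "p k \<eta> = (1 - 1 / real (k + 2)) * q \<eta> + 1 / real (k + 2) * (1 / ?N)" for k \<eta>
  have "configs n \<noteq> {}"
    using q1 by auto
  then have N: "?N > 0" by (simp add: card_gt_0_iff)
  have p_pos: "0 < p k \<eta>" if "\<eta> \<in> configs n" for k \<eta>
    unfolding p_def using q[OF that] N by (intro add_nonneg_pos mult_nonneg_nonneg mult_pos_pos divide_pos_pos) auto
  have p_sum: "(\<Sum>\<eta>\<in>configs n. p k \<eta>) = 1" for k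
    unfolding p_def sum.distrib sum_distrib_left[symmetric] q1 using N \<open>configs n \<noteq> {}\<close> by simp
  have law_p: "law n (p k) u \<eta> = (1 - 1 / real (k + 2)) * law n q u \<eta> + 1 / real (k + 2) * law n (\<lambda>_. 1 / ?N) u \<eta>" for k u \<eta>
    by (simp add: law_def p_def sum.distrib sum_distrib_left algebra_simps sum_subtractf)
  have e0: "(\<lambda>k. 1 / real (k + 2)) \<longlonglongrightarrow> 0"
    using LIMSEQ_ignore_initial_segment[OF lim_1_over_n, of 2] by simp
  have law_lim: "(\<lambda>k. law n (p k) u \<eta>) \<longlonglongrightarrow> law n q u \<eta>" for u \<eta>
  proof -
    have "(\<lambda>k. law n (p k) u \<eta>) \<longlonglongrightarrow> (1 - 0) * law n q u \<eta> + 0 * law n (\<lambda>_. 1 / ?N) u \<eta>"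
      unfolding law_p by (intro tendsto_intros e0)
    then show ?thesis by simp
  qed
  have lim: "(\<lambda>k. ent n (law n (p k) u) (bern n (\<lambda>i. \<rho> i u))) \<longlonglongrightarrow> ent n (law n q u) (bern n (\<lambda>i. \<rho> i u))"
    if u: "s \<le> u" "u \<le> t" for u
    unfolding ent_def
  proof (intro tendsto_sum tendsto_x_ln_x_div law_lim)
    fix \<eta> assume \<eta>: "\<eta> \<in> configs n"
    have "0 \<le> u" using u s by simp
    then show "0 \<le> law n q u \<eta>" "\<forall>\<^sub>F k in sequentially. 0 \<le> law n (p k) u \<eta>"
      using \<eta> q less_imp_le[OF p_pos] by (auto intro!: law_ge always_eventually)
    show "0 < bern n (\<lambda>i. \<rho> i u) \<eta>"
      using \<rho> u by (intro bern_pos) auto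
  qed
  show ?thesis
  proof (rule LIMSEQ_le[OF lim])
    show "(\<lambda>k. ent n (law n (p k) s) (bern n (\<lambda>i. \<rho> i s)) +
     K\<^sup>2 / c\<^sup>2 + (t - s) * (real n * r / c + K\<^sup>2 / c\<^sup>2 * (1 + K\<^sup>2))) \<longlonglongrightarrow>
       ent n (law n q s) (bern n (\<lambda>i. \<rho> i s)) +
     K\<^sup>2 / c\<^sup>2 + (t - s) * (real n * r / c + K\<^sup>2 / c\<^sup>2 * (1 + K\<^sup>2))"
      by (intro tendsto_add lim tendsto_const) (use s in auto)
    show "\<exists>N. \<forall>k\<ge>N. ent n (law n (p k) t) (bern n (\<lambda>i. \<rho> i t)) \<le> ent n (law n (p k) s) (bern n (\<lambda>i. \<rho> i s)) +
     K\<^sup>2 / c\<^sup>2 + (t - s) * (real n * r / c + K\<^sup>2 / c\<^sup>2 * (1 + K\<^sup>2))"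
      by (intro exI allI impI ent_growth_pos[where \<rho>' = \<rho>'] n s c p_pos p_sum \<rho> \<rho>c \<rho>' r K)
  qed (use s in auto)
qed

section \<open>The heat equation on the torus\<close>

lemma torus_integrable:
  fixes f :: "real \<Rightarrow> real"
  assumes "f \<in> borel_measurable borel" "\<And>\<theta>. 0 \<le> \<theta> \<Longrightarrow> \<theta> < 1 \<Longrightarrow> \<bar>f \<theta>\<bar> \<le> B"
  shows "set_integrable lborel {0..<1::real} f"
  unfolding set_integrable_def
  using assms by (intro integrableI_bounded_set_indicator[where B = B]) auto

lemma torus_integrable_continuous:
  fixes f :: "real \<Rightarrow> real"
  assumes "continuous_on {0..1} f"
  shows "set_integrable lborel {0..<1::real} f"
  by (rule set_integrable_subset[OF borel_integrable_atLeastAtMost'[OF assms]]) auto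

lemma torus_integral_eq_integral:
  assumes "continuous_on {0..1} f"
  shows "torus_integral f = integral {0..1} f"
proof -
  have "torus_integral f = integral {0..<1} f"
    unfolding torus_integral_def
    by (rule set_borel_integral_eq_integral(2)[OF torus_integrable_continuous[OF assms]])
  also have "\<dots> = integral {0..1} f"
    by (rule integral_spike_set; rule negligible_subset[of "{1}"]) auto
  finally show ?thesis .
qed

lemma torus_integral_mono:
  assumes "set_integrable lborel {0..<1} f" "set_integrable lborel {0..<1} g"
    "\<And>\<theta>. 0 \<le> \<theta> \<Longrightarrow> \<theta> < 1 \<Longrightarrow> f \<theta> \<le> g \<theta>"
  shows "torus_integral f \<le> torus_integral g"
  unfolding torus_integral_def by (rule set_integral_mono) (use assms in auto)

lemma torus_integral_const [simp]: "torus_integral (\<lambda>_. c) = c"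
  by (simp add: torus_integral_def set_lebesgue_integral_def)

lemma torus_integral_cmult: "torus_integral (\<lambda>\<theta>. c * f \<theta>) = c * torus_integral f"
  by (simp add: torus_integral_def)

lemma torus_integral_add:
  "set_integrable lborel {0..<1} f \<Longrightarrow> set_integrable lborel {0..<1} g \<Longrightarrow>
    torus_integral (\<lambda>\<theta>. f \<theta> + g \<theta>) = torus_integral f + torus_integral g"
  unfolding torus_integral_def by (rule set_integral_add)

lemma torus_integral_diff:
  "set_integrable lborel {0..<1} f \<Longrightarrow> set_integrable lborel {0..<1} g \<Longrightarrow>
    torus_integral (\<lambda>\<theta>. f \<theta> - g \<theta>) = torus_integral f - torus_integral g"
  unfolding torus_integral_def by (rule set_integral_diff)

lemma torus_integral_abs_le:
  assumes "set_integrable lborel {0..<1} f" "set_integrable lborel {0..<1} g"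
    "\<And>\<theta>. 0 \<le> \<theta> \<Longrightarrow> \<theta> < 1 \<Longrightarrow> \<bar>f \<theta>\<bar> \<le> g \<theta>"
  shows "\<bar>torus_integral f\<bar> \<le> torus_integral g"
proof -
  have "torus_integral f \<le> torus_integral g"
    using assms(3) by (intro torus_integral_mono assms) (fastforce simp: abs_le_iff)
  moreover have "torus_integral (\<lambda>\<theta>. (-1) * f \<theta>) \<le> torus_integral g"
    using assms(3) by (intro torus_integral_mono assms set_integrable_mult_right) (fastforce simp: abs_le_iff)
  ultimately show ?thesis unfolding torus_integral_cmult by linarith
qed

lemma torus_periodic_int:
  assumes "torus_periodic g"
  shows "g (\<theta> + of_int k) = g \<theta>"
proof -
  have nat: "g (\<theta> + of_nat k) = g \<theta>" for k \<theta>
  proof (induction k)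
    case (Suc k)
    have "g (\<theta> + of_nat (Suc k)) = g ((\<theta> + of_nat k) + 1)" by (simp add: algebra_simps)
    with Suc assms show ?case by (simp add: torus_periodic_def)
  qed simp
  show ?thesis
  proof (cases "k \<ge> 0")
    case True
    then show ?thesis using nat[of \<theta> "nat k"] by simp
  next
    case False
    then show ?thesis using nat[of "\<theta> + of_int k" "nat (- k)"] by simp
  qed
qed

lemma torus_periodic_bounded:
  assumes "torus_periodic g" "continuous_on UNIV g"
  obtains B where "\<And>\<theta>. \<bar>g \<theta>\<bar> \<le> B"
proof -
  have "bounded (g ` {0..1})"
    by (intro compact_imp_bounded compact_continuous_image continuous_on_subset[OF assms(2)]) auto
  then obtain B where "\<forall>y\<in>g ` {0..1}. norm y \<le> B"
    unfolding bounded_iff by blast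
  then have B: "\<bar>g \<theta>\<bar> \<le> B" if "\<theta> \<in> {0..1}" for \<theta>
    using that by auto
  have "\<bar>g \<theta>\<bar> \<le> B" for \<theta>
    using B[of "frac \<theta>"] torus_periodic_int[OF assms(1), of "frac \<theta>" "\<lfloor>\<theta>\<rfloor>"] frac_lt_1[of \<theta>]
    by (simp add: frac_def)
  then show ?thesis using that by blast
qed

text \<open>By induction on \<open>j\<close>, the sum over the first \<open>j\<close> cells differs
  from the integral over them by at most \<open>j / n * (e / 2)\<close>, uniform continuity
  controlling each cell.\<close>

lemma riemann_sum_tendsto:
  assumes "continuous_on UNIV F"
  shows "(\<lambda>n. (1 / real n) * (\<Sum>i<n. F (real i / real n))) \<longlonglongrightarrow> torus_integral F"
proof (rule LIMSEQ_I)
  fix e :: real assume e: "0 < e"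
  have cont: "continuous_on A F" for A using continuous_on_subset[OF assms] by auto
  have "uniformly_continuous_on {0..1} F"
    by (intro compact_uniformly_continuous cont) auto
  then obtain d where d: "d > 0" "\<And>x y. x \<in> {0..1} \<Longrightarrow> y \<in> {0..1} \<Longrightarrow> dist y x < d \<Longrightarrow> dist (F y) (F x) < e / 2"
    unfolding uniformly_continuous_on_def using e half_gt_zero by metis
  obtain N where N: "N > 0" "1 / real N < d"
    using d(1) by (metis nat_approx_posE zero_less_Suc)
  have "norm ((1 / real n) * (\<Sum>i<n. F (real i / real n)) - torus_integral F) < e" if n: "N \<le> n" for n
  proof -
    have n0: "n > 0" using n N by simp
    have "1 / real n \<le> 1 / real N" using n N by (intro frac_le) auto
    then have nd: "1 / real n < d" using N by linarith
    have "\<bar>(\<Sum>i<j. F (real i / real n) / real n) - integral {0..real j / real n} F\<bar> \<le> real j / real n * (e / 2)"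
      if "j \<le> n" for j
      using that
    proof (induction j)
      case (Suc j)
      let ?a = "real j / real n" and ?b = "real (Suc j) / real n"
      have ab: "0 \<le> ?a" "?a \<le> ?b" "?b - ?a = 1 / real n"
        using n0 by (auto simp: divide_right_mono diff_divide_distrib[symmetric])
      have b1: "?b \<le> 1" using Suc.prems n0 by simp
      have "integral {0..?b} F = integral {0..?a} F + integral {?a..?b} F"
        using Henstock_Kurzweil_Integration.integral_combine[OF ab(1,2) integrable_continuous_interval[OF cont]] by simp
      moreover have "\<bar>integral {?a..?b} (\<lambda>x. F x - F ?a)\<bar> \<le> e / 2 * (?b - ?a)"
        unfolding real_norm_def[symmetric]
      proof (rule integral_bound[OF ab(2)])
        show "continuous_on {?a..?b} (\<lambda>x. F x - F ?a)" by (intro continuous_intros cont)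
        fix x assume x: "x \<in> {?a..?b}"
        then have x': "?a \<le> x" "x \<le> ?b" by auto
        have "0 \<le> x" "x \<le> 1" "?a \<le> 1" "\<bar>x - ?a\<bar> < d" using x' ab b1 nd by linarith+
        then have "dist x ?a < d" "x \<in> {0..1}" "?a \<in> {0..1}" by (auto simp: dist_real_def)
        then show "norm (F x - F ?a) \<le> e / 2"
          using d(2)[of ?a x] by (auto simp: dist_real_def)
      qed
      moreover have "integral {?a..?b} (\<lambda>x. F x - F ?a) = integral {?a..?b} F - F ?a / real n"
        using ab by (subst Henstock_Kurzweil_Integration.integral_diff)
          (auto intro!: integrable_continuous_interval cont continuous_intros)
      moreover have "\<bar>(\<Sum>i<j. F (real i / real n) / real n) - integral {0..?a} F\<bar> \<le> ?a * (e / 2)"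
        using Suc by simp
      ultimately show ?case
        using ab(3) by (simp add: add_divide_distrib algebra_simps abs_le_iff)
    qed simp
    from this[of n] have "\<bar>(\<Sum>i<n. F (real i / real n) / real n) - integral {0..1} F\<bar> \<le> e / 2"
      using n0 by simp
    then show ?thesis
      using e by (simp add: torus_integral_eq_integral[OF cont] sum_divide_distrib)
  qed
  then show "\<exists>no. \<forall>n\<ge>no. norm ((1 / real n) * (\<Sum>i<n. F (real i / real n)) - torus_integral F) < e"
    by blast
qed

text \<open>The phase \<open>\<phi>\<close> covers the sine as well and makes the family closed under derivatives.\<close>

definition wave :: "nat \<Rightarrow> real \<Rightarrow> real \<Rightarrow> real" where
  "wave k \<phi> \<theta> = cos (2 * pi * real k * \<theta> + \<phi>)"

lemma wave_periodic: "wave k \<phi> (\<theta> + 1) = wave k \<phi> \<theta>"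
proof -
  have "wave k \<phi> (\<theta> + 1) = cos ((2 * pi * real k * \<theta> + \<phi>) + 2 * real k * pi)"
    by (simp add: wave_def algebra_simps)
  also have "\<dots> = wave k \<phi> \<theta>"
    using cos_add[of "2 * pi * real k * \<theta> + \<phi>" "2 * real k * pi"] by (simp add: wave_def)
  finally show ?thesis .
qed

lemma abs_wave_le_1: "\<bar>wave k \<phi> \<theta>\<bar> \<le> 1"
  by (simp add: wave_def)

lemma wave_deriv: "(wave k \<phi> has_real_derivative 2 * pi * real k * wave k (\<phi> + pi / 2) \<theta>) (at \<theta>)"
proof -
  have "((\<lambda>\<theta>. cos (2 * pi * real k * \<theta> + \<phi>)) has_real_derivative
      - sin (2 * pi * real k * \<theta> + \<phi>) * (2 * pi * real k)) (at \<theta>)"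
    by (auto intro!: derivative_eq_intros)
  moreover have "wave k (\<phi> + pi / 2) \<theta> = - sin (2 * pi * real k * \<theta> + \<phi>)"
    using cos_add[of "2 * pi * real k * \<theta> + \<phi>" "pi / 2"] by (simp add: wave_def add.assoc)
  ultimately show ?thesis
    by (simp add: wave_def[abs_def] mult_ac)
qed

lemma wave_add_pi: "wave k (\<phi> + pi / 2 + pi / 2) \<theta> = - wave k \<phi> \<theta>"
  using cos_add[of "2 * pi * real k * \<theta> + \<phi>" pi] by (simp add: wave_def add.assoc)

lemma continuous_wave [continuous_intros]: "continuous_on A (wave k \<phi>)"
  unfolding wave_def[abs_def] by (intro continuous_intros)

text \<open>Each derivative contributes a factor and shifts the phase by a quarter period. Waves are
  thereby admissible test functions in the assumption on the initial laws.\<close>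

lemma wave_smooth: "torus_smooth (wave k \<phi>)"
proof -
  have "(deriv ^^ j) (wave k \<phi>) = (\<lambda>\<theta>. (2 * pi * real k) ^ j * wave k (\<phi> + real j * (pi / 2)) \<theta>)" for j
  proof (induction j)
    case (Suc j)
    have "deriv (\<lambda>\<theta>. (2 * pi * real k) ^ j * wave k (\<phi> + real j * (pi / 2)) \<theta>) \<theta> =
        (2 * pi * real k) ^ j * (2 * pi * real k * wave k (\<phi> + real j * (pi / 2) + pi / 2) \<theta>)" for \<theta>
      by (intro DERIV_imp_deriv DERIV_cmult wave_deriv)
    moreover have "\<phi> + real (Suc j) * (pi / 2) = \<phi> + real j * (pi / 2) + pi / 2"
      by (simp add: algebra_simps)
    ultimately show ?case
      by (simp only: funpow.simps o_apply Suc fun_eq_iff power_Suc) simp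
  qed simp
  moreover have "wave k \<psi> differentiable (at \<theta>)" for \<psi> \<theta>
    unfolding real_differentiable_def by (rule exI, rule wave_deriv)
  ultimately show ?thesis
    by (simp add: torus_smooth_def torus_periodic_def wave_periodic)
qed

lemma wave_second_difference:
  fixes h :: real
  shows
  "wave k \<phi> (\<theta> + h) + wave k \<phi> (\<theta> - h) - 2 * wave k \<phi> \<theta> = - 2 * (1 - cos (2 * pi * real k * h)) * wave k \<phi> \<theta>"
proof -
  have cos_eq: "cos (a + b) + cos (a - b) - 2 * cos a = - 2 * (1 - cos b) * cos a" for a b :: real
    unfolding cos_add cos_diff by (simp add: algebra_simps)
  let ?a = "2 * pi * real k * \<theta> + \<phi>" and ?b = "2 * pi * real k * h"
  have eqs: "wave k \<phi> (\<theta> + h) = cos (?a + ?b)" "wave k \<phi> (\<theta> - h) = cos (?a - ?b)" "wave k \<phi> \<theta> = cos ?a"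
    by (auto simp: wave_def algebra_simps)
  show ?thesis unfolding eqs by (rule cos_eq)
qed

text \<open>By the half-angle formula the expression is the square of
  \<open>2 * n * sin (a / (2 * n))\<close>, which contains a difference quotient of the sine at
  0.\<close>

lemma discrete_eigenvalue_tendsto:
  "(\<lambda>n. (real n)\<^sup>2 * (2 * (1 - cos (a / real n)))) \<longlonglongrightarrow> a\<^sup>2"
proof -
  have "((\<lambda>x. sin (a / 2 * x)) has_real_derivative a / 2) (at 0)"
    by (auto intro!: derivative_eq_intros)
  then have "((\<lambda>h. sin (a / 2 * h) / h) \<longlongrightarrow> a / 2) (at 0)"
    by (simp add: DERIV_def)
  moreover have "filterlim (\<lambda>n. 1 / real n) (at 0) sequentially"
    unfolding filterlim_at using lim_1_over_n by (auto intro: eventually_mono[OF eventually_gt_at_top[of 0]])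
  ultimately have "(\<lambda>n. sin (a / 2 * (1 / real n)) / (1 / real n)) \<longlonglongrightarrow> a / 2"
    by (rule filterlim_compose)
  then have "(\<lambda>n. (2 * (sin (a / 2 * (1 / real n)) / (1 / real n)))\<^sup>2) \<longlonglongrightarrow> (2 * (a / 2))\<^sup>2"
    by (intro tendsto_power tendsto_mult_left)
  moreover have "(2 * (sin (a / 2 * (1 / real n)) / (1 / real n)))\<^sup>2 = (real n)\<^sup>2 * (2 * (1 - cos (a / real n)))" for n
  proof -
    have "cos (a / real n) = 1 - 2 * (sin (a / 2 * (1 / real n)))\<^sup>2"
      using cos_double_sin[of "a / 2 * (1 / real n)"] by simp
    then show ?thesis by (simp add: power_mult_distrib)
  qed
  ultimately show ?thesis by simp
qed

lemma density_profile_integrable: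
  assumes "density_profile m0" "\<And>\<theta>. \<bar>g \<theta>\<bar> \<le> B" "g \<in> borel_measurable borel"
  shows "set_integrable lborel {0..<1} (\<lambda>\<theta>. g \<theta> * m0 \<theta>)"
proof (rule torus_integrable)
  show "(\<lambda>\<theta>. g \<theta> * m0 \<theta>) \<in> borel_measurable borel"
    using assms by (auto simp: density_profile_def)
  show "\<bar>g \<theta> * m0 \<theta>\<bar> \<le> B" for \<theta>
  proof -
    have "\<bar>m0 \<theta>\<bar> \<le> 1" using assms(1) by (auto simp: density_profile_def)
    then have "\<bar>g \<theta>\<bar> * \<bar>m0 \<theta>\<bar> \<le> \<bar>g \<theta>\<bar> * 1" by (intro mult_left_mono) auto
    then show ?thesis using assms(2)[of \<theta>] by (simp add: abs_mult)
  qed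
qed

section \<open>Solutions of the heat equation at positive times\<close>

lemma heat_solution_derivs:
  assumes "heat_solution m0 m"
  obtains m_x m_xx where
    "\<And>t \<theta>. 0 < t \<Longrightarrow> ((\<lambda>s. m s \<theta>) has_real_derivative m_xx t \<theta>) (at t)"
    "\<And>t \<theta>. 0 < t \<Longrightarrow> ((\<lambda>x. m t x) has_real_derivative m_x t \<theta>) (at \<theta>)"
    "\<And>t \<theta>. 0 < t \<Longrightarrow> ((\<lambda>x. m_x t x) has_real_derivative m_xx t \<theta>) (at \<theta>)"
    "continuous_on ({0<..} \<times> UNIV) (\<lambda>(t, \<theta>). m_x t \<theta>)"
    "continuous_on ({0<..} \<times> UNIV) (\<lambda>(t, \<theta>). m_xx t \<theta>)"
proof -
  from assms have "\<exists>m_t m_x m_xx.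
        (\<forall>t>0. \<forall>\<theta>.
           ((\<lambda>s. m s \<theta>) has_real_derivative m_t t \<theta>) (at t) \<and>
           ((\<lambda>x. m t x) has_real_derivative m_x t \<theta>) (at \<theta>) \<and>
           ((\<lambda>x. m_x t x) has_real_derivative m_xx t \<theta>) (at \<theta>) \<and>
           m_t t \<theta> = m_xx t \<theta>) \<and>
        continuous_on ({0<..} \<times> UNIV) (\<lambda>(t, \<theta>). m t \<theta>) \<and>
        continuous_on ({0<..} \<times> UNIV) (\<lambda>(t, \<theta>). m_t t \<theta>) \<and>
        continuous_on ({0<..} \<times> UNIV) (\<lambda>(t, \<theta>). m_x t \<theta>) \<and>
        continuous_on ({0<..} \<times> UNIV) (\<lambda>(t, \<theta>). m_xx t \<theta>)"
    unfolding heat_solution_def by (elim conjE)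
  then obtain m_t m_x m_xx where D: "\<forall>t>0. \<forall>\<theta>.
           ((\<lambda>s. m s \<theta>) has_real_derivative m_t t \<theta>) (at t) \<and>
           ((\<lambda>x. m t x) has_real_derivative m_x t \<theta>) (at \<theta>) \<and>
           ((\<lambda>x. m_x t x) has_real_derivative m_xx t \<theta>) (at \<theta>) \<and>
           m_t t \<theta> = m_xx t \<theta>"
    and C: "continuous_on ({0<..} \<times> UNIV) (\<lambda>(t, \<theta>). m_x t \<theta>)"
        "continuous_on ({0<..} \<times> UNIV) (\<lambda>(t, \<theta>). m_xx t \<theta>)"
    by (elim exE conjE)
  show ?thesis
  proof (rule that[OF _ _ _ C])
    fix t \<theta> :: real assume "0 < t"
    note conj = D[rule_format, OF this, of \<theta>]
    from conj[THEN conjunct1] conj[THEN conjunct2, THEN conjunct2, THEN conjunct2] show "((\<lambda>s. m s \<theta>) has_real_derivative m_xx t \<theta>) (at t)"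
      by simp
  qed (use D in auto)
qed

lemma heat_solution_continuous:
  assumes "heat_solution m0 m" "0 < t"
  shows "torus_periodic (m t)" "continuous_on UNIV (m t)"
proof -
  show "torus_periodic (m t)"
    using assms by (simp add: heat_solution_def)
  obtain m_x where "\<And>\<theta>. ((\<lambda>x. m t x) has_real_derivative m_x t \<theta>) (at \<theta>)"
    using heat_solution_derivs[OF assms(1)] assms(2) by metis
  then show "continuous_on UNIV (m t)"
    by (meson DERIV_isCont continuous_at_imp_continuous_on)
qed

text \<open>At positive times the Fourier coefficient solves a linear ordinary differential
  equation, by differentiation under the integral and two integrations by parts; its constant is
  determined by letting the time tend to 0.\<close>

lemma heat_wave_evolution:
  assumes heat: "heat_solution m0 m" and m0: "density_profile m0" and t: "0 < t"
  shows "torus_integral (\<lambda>\<theta>. wave k \<phi> \<theta> * m t \<theta>) =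
     exp (- ((2 * pi * real k)\<^sup>2 * t)) * torus_integral (\<lambda>\<theta>. wave k \<phi> \<theta> * m0 \<theta>)"
proof (rule heat_solution_derivs[OF heat])
  fix m_x m_xx assume
    dt: "\<And>t \<theta>. 0 < t \<Longrightarrow> ((\<lambda>s. m s \<theta>) has_real_derivative m_xx t \<theta>) (at t)" and
    dx: "\<And>t \<theta>. 0 < t \<Longrightarrow> ((\<lambda>x. m t x) has_real_derivative m_x t \<theta>) (at \<theta>)" and
    dxx: "\<And>t \<theta>. 0 < t \<Longrightarrow> ((\<lambda>x. m_x t x) has_real_derivative m_xx t \<theta>) (at \<theta>)" and
    cxx: "continuous_on ({0<..} \<times> UNIV) (\<lambda>(t, \<theta>). m_xx t \<theta>)"
  let ?e = "wave k \<phi>" and ?l = "2 * pi * real k"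
  define y where "y t = integral {0..1} (\<lambda>\<theta>. ?e \<theta> * m t \<theta>)" for t
  have cm: "continuous_on A (m t)" "torus_periodic (m t)" if "0 < t" for t A
    using heat_solution_continuous[OF heat that] continuous_on_subset by auto
  have y: "y t = torus_integral (\<lambda>\<theta>. ?e \<theta> * m t \<theta>)" if "0 < t" for t
    unfolding y_def by (rule torus_integral_eq_integral[symmetric]) (intro continuous_intros cm that)
  have dy: "(y has_real_derivative - (?l\<^sup>2) * y t) (at t)" if t: "0 < t" for t
  proof -
    have "((\<lambda>t. integral (cbox 0 1) (\<lambda>\<theta>. ?e \<theta> * m t \<theta>)) has_real_derivative
        integral (cbox 0 1) (\<lambda>\<theta>. ?e \<theta> * m_xx t \<theta>)) (at t within {0<..})"
    proof (rule leibniz_rule_field_derivative[where U = "{0<..}"])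
      show "((\<lambda>t. ?e \<theta> * m t \<theta>) has_real_derivative ?e \<theta> * m_xx t \<theta>) (at t within {0<..})" if "t \<in> {0<..}" for t \<theta>
        using that by (intro DERIV_cmult has_field_derivative_at_within[OF dt]) auto
      show "(\<lambda>\<theta>. ?e \<theta> * m t \<theta>) integrable_on cbox 0 1" if "t \<in> {0<..}" for t
        using that by (intro integrable_continuous continuous_intros cm) auto
      have "continuous_on ({0<..} \<times> cbox 0 1) (\<lambda>p. ?e (snd p))"
        by (rule continuous_on_compose2[OF continuous_wave[of UNIV]]) (auto intro!: continuous_intros)
      moreover have "continuous_on ({0<..} \<times> cbox 0 1) (\<lambda>(t, \<theta>). m_xx t \<theta>)"
        by (rule continuous_on_subset[OF cxx]) auto
      ultimately show "continuous_on ({0<..} \<times> cbox 0 1) (\<lambda>(t, \<theta>). ?e \<theta> * m_xx t \<theta>)"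
        unfolding case_prod_beta by (intro continuous_intros)
    qed (use t in auto)
    then have D: "(y has_real_derivative integral {0..1} (\<lambda>\<theta>. ?e \<theta> * m_xx t \<theta>)) (at t)"
      using t at_within_open[of t "{0<..}"] by (simp add: y_def[abs_def])
    \<comment> \<open>Periodicity of \<open>m_x\<close> is not part of the definition; it follows
      from that of \<open>m t\<close> by uniqueness of derivatives. These equalities make the
      boundary terms cancel.\<close>
    have per: "m_x t 1 = m_x t 0" "m t 1 = m t 0" "?e 1 = ?e 0" "wave k (\<phi> + pi / 2) 1 = wave k (\<phi> + pi / 2) 0"
    proof -
      have "((\<lambda>x. m t (x + 1)) has_real_derivative m_x t 1) (at 0)"
        using DERIV_shift[THEN iffD1, OF dx[OF t, of "0 + 1"]] by simp
      moreover have shift: "(\<lambda>x. m t (x + 1)) = m t"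
        using cm(2)[OF t] by (auto simp: torus_periodic_def)
      ultimately have "(m t has_real_derivative m_x t 1) (at 0)"
        by (simp only:)
      then show "m_x t 1 = m_x t 0"
        using dx[OF t, of 0] by (rule DERIV_unique)
      show "m t 1 = m t 0"
        using fun_cong[OF shift, of 0] by simp
      show "?e 1 = ?e 0" "wave k (\<phi> + pi / 2) 1 = wave k (\<phi> + pi / 2) 0"
        using wave_periodic[of k _ 0] by auto
    qed
    \<comment> \<open>Both integrations by parts at once: \<open>e * m_x - e' * m\<close> is an
      antiderivative of \<open>e * m_xx - e'' * m\<close>, and
      \<open>e'' = - l\<^sup>2 * e\<close>.\<close>
    have "((\<lambda>\<theta>. ?e \<theta> * m_xx t \<theta> + ?l\<^sup>2 * (?e \<theta> * m t \<theta>)) has_integral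
       (?e 1 * m_x t 1 - ?l * wave k (\<phi> + pi / 2) 1 * m t 1) - (?e 0 * m_x t 0 - ?l * wave k (\<phi> + pi / 2) 0 * m t 0)) {0..1}"
    proof (rule fundamental_theorem_of_calculus)
      fix \<theta> :: real
      have "((\<lambda>\<theta>. ?e \<theta> * m_x t \<theta> - ?l * wave k (\<phi> + pi / 2) \<theta> * m t \<theta>) has_real_derivative
         ?e \<theta> * m_xx t \<theta> + ?l\<^sup>2 * (?e \<theta> * m t \<theta>)) (at \<theta>)"
        by (rule DERIV_cong[OF DERIV_diff[OF DERIV_mult'[OF wave_deriv dxx[OF t]] DERIV_mult'[OF DERIV_cmult[OF wave_deriv] dx[OF t]]]])
           (simp only: wave_add_pi, simp add: power2_eq_square algebra_simps)
      then show "((\<lambda>\<theta>. ?e \<theta> * m_x t \<theta> - ?l * wave k (\<phi> + pi / 2) \<theta> * m t \<theta>) has_vector_derivative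
         ?e \<theta> * m_xx t \<theta> + ?l\<^sup>2 * (?e \<theta> * m t \<theta>)) (at \<theta> within {0..1})"
        by (simp add: has_real_derivative_iff_has_vector_derivative has_vector_derivative_at_within)
    qed auto
    then have "((\<lambda>\<theta>. ?e \<theta> * m_xx t \<theta> + ?l\<^sup>2 * (?e \<theta> * m t \<theta>)) has_integral 0) {0..1}"
      unfolding per by simp
    moreover have "((\<lambda>\<theta>. ?l\<^sup>2 * (?e \<theta> * m t \<theta>)) has_integral ?l\<^sup>2 * y t) {0..1}"
      unfolding y_def by (intro has_integral_mult_right integrable_integral integrable_continuous_interval continuous_intros cm t)
    ultimately have "((\<lambda>\<theta>. (?e \<theta> * m_xx t \<theta> + ?l\<^sup>2 * (?e \<theta> * m t \<theta>)) - ?l\<^sup>2 * (?e \<theta> * m t \<theta>))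
        has_integral 0 - ?l\<^sup>2 * y t) {0..1}"
      by (rule has_integral_diff)
    then have "((\<lambda>\<theta>. ?e \<theta> * m_xx t \<theta>) has_integral - (?l\<^sup>2) * y t) {0..1}"
      by (simp only: add_diff_cancel_right' diff_0 mult_minus_left)
    with D show ?thesis by (simp add: integral_unique)
  qed
  \<comment> \<open>Integrating factor: \<open>g\<close> is constant on the positive times, and its
    limit at 0 is the initial coefficient.\<close>
  define g where "g t = y t * exp (?l\<^sup>2 * t)" for t
  have dg: "(g has_real_derivative 0) (at t)" if "0 < t" for t
  proof -
    have "((\<lambda>t. exp (?l\<^sup>2 * t)) has_real_derivative ?l\<^sup>2 * exp (?l\<^sup>2 * t)) (at t)"
      by (auto intro!: derivative_eq_intros)
    from DERIV_mult'[OF dy[OF that] this] show ?thesis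
      unfolding g_def[abs_def] by (rule DERIV_cong) (simp add: mult_ac)
  qed
  have const: "g s = g t" if "0 < s" for s
  proof -
    have "\<exists>c. \<forall>x\<in>{0<..}. g x = c"
    proof (rule has_field_derivative_zero_constant)
      show "(g has_real_derivative 0) (at x within {0<..})" if "x \<in> {0<..}" for x
        using that by (intro has_field_derivative_at_within[OF dg]) simp
    qed simp
    then show ?thesis using that t by auto
  qed
  define y0 where "y0 = torus_integral (\<lambda>\<theta>. ?e \<theta> * m0 \<theta>)"
  have "(y \<longlongrightarrow> y0) (at_right 0)"
  proof -
    have "((\<lambda>t. torus_integral (\<lambda>\<theta>. \<bar>m t \<theta> - m0 \<theta>\<bar>)) \<longlongrightarrow> 0) (at_right 0)"
      using heat by (simp add: heat_solution_def)
    \<comment> \<open>Waves are bounded by 1, so the continuity in \<open>L\<^sup>1\<close> at time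
      0 passes to the coefficients.\<close>
    moreover have "\<forall>\<^sub>F t in at_right 0. norm (y t - y0) \<le> torus_integral (\<lambda>\<theta>. \<bar>m t \<theta> - m0 \<theta>\<bar>)"
      unfolding eventually_at_right_field
    proof (intro exI[of _ 1] conjI allI impI)
      fix t :: real assume t: "0 < t"
      have i1: "set_integrable lborel {0..<1} (\<lambda>\<theta>. ?e \<theta> * m t \<theta>)"
        by (intro torus_integrable_continuous continuous_intros cm t)
      have wm: "?e \<in> borel_measurable borel"
        by (intro borel_measurable_continuous_onI continuous_wave)
      have i2: "set_integrable lborel {0..<1} (\<lambda>\<theta>. ?e \<theta> * m0 \<theta>)"
        by (rule density_profile_integrable[OF m0 abs_wave_le_1 wm])
      have i3: "set_integrable lborel {0..<1} (\<lambda>\<theta>. \<bar>m t \<theta> - m0 \<theta>\<bar>)"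
      proof -
        have "set_integrable lborel {0..<1} (m t)"
          by (intro torus_integrable_continuous cm t)
        moreover have "set_integrable lborel {0..<1} m0"
          using density_profile_integrable[OF m0, of "\<lambda>_. 1" 1] by simp
        ultimately show ?thesis
          by (intro set_integrable_abs set_integral_diff(1))
      qed
      have "\<bar>torus_integral (\<lambda>\<theta>. ?e \<theta> * m t \<theta> - ?e \<theta> * m0 \<theta>)\<bar> \<le> torus_integral (\<lambda>\<theta>. \<bar>m t \<theta> - m0 \<theta>\<bar>)"
      proof (rule torus_integral_abs_le[OF set_integral_diff(1)[OF i1 i2] i3])
        show "\<bar>?e \<theta> * m t \<theta> - ?e \<theta> * m0 \<theta>\<bar> \<le> \<bar>m t \<theta> - m0 \<theta>\<bar>" for \<theta>
          unfolding right_diff_distrib[symmetric] abs_mult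
          using abs_wave_le_1 by (intro mult_left_le_one_le) auto
      qed
      then show "norm (y t - y0) \<le> torus_integral (\<lambda>\<theta>. \<bar>m t \<theta> - m0 \<theta>\<bar>)"
        by (simp add: y[OF t] y0_def torus_integral_diff[OF i1 i2])
    qed auto
    ultimately have "((\<lambda>t. y t - y0) \<longlongrightarrow> 0) (at_right 0)"
      by (rule Lim_null_comparison[rotated])
    then show ?thesis by (simp add: LIM_zero_iff)
  qed
  then have "(g \<longlongrightarrow> y0 * exp (?l\<^sup>2 * 0)) (at_right 0)"
    unfolding g_def[abs_def] by (intro tendsto_intros)
  moreover have "(g \<longlongrightarrow> g t) (at_right 0)"
    by (rule tendsto_eventually) (auto simp: eventually_at_right_field intro!: exI[of _ 1] const)
  ultimately have "g t = y0"
    using tendsto_unique[of "at_right (0::real)" g "g t"] by (simp add: trivial_limit_at_right_real)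
  then show ?thesis
    unfolding y[OF t, symmetric] y0_def[symmetric] by (simp add: g_def exp_minus field_simps)
qed

text \<open>Taylor expansion to second order on both sides of \<open>x\<close>: the first-order
  terms cancel, and each remainder contributes half of \<open>f''\<close> at an intermediate
  point.\<close>

lemma second_difference_bound:
  fixes f :: "real \<Rightarrow> real" and h :: real
  assumes f': "\<And>x. (f has_real_derivative f' x) (at x)" and f'': "\<And>x. (f' has_real_derivative f'' x) (at x)"
    and h: "0 < h" and bd: "\<And>z. \<bar>z - x\<bar> \<le> h \<Longrightarrow> \<bar>f'' z - l\<bar> \<le> e"
  shows "\<bar>f (x + h) + f (x - h) - 2 * f x - h\<^sup>2 * l\<bar> \<le> h\<^sup>2 * e"
proof -
  define D where "D k = (if k = 0 then f else if k = 1 then f' else f'')" for k :: nat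
  have D: "\<forall>k z. k < 2 \<and> x - h \<le> z \<and> z \<le> x + h \<longrightarrow> (D k has_real_derivative D (Suc k) z) (at z)"
    using f' f'' by (auto simp: D_def less_2_cases_iff)
  have taylor: "\<exists>z. \<bar>z - x\<bar> \<le> h \<and> f w = f x + f' x * (w - x) + f'' z / 2 * (w - x)\<^sup>2" if w: "w = x + h \<or> w = x - h" for w
  proof -
    have "\<exists>z. (if w < x then w < z \<and> z < x else x < z \<and> z < w) \<and>
        f w = (\<Sum>k<2. D k x / fact k * (w - x) ^ k) + D 2 z / fact 2 * (w - x) ^ 2"
      by (rule Taylor[of 2 D f "x - h" "x + h" x w]) (use D w h in \<open>auto simp: D_def\<close>)
    then obtain z where z: "if w < x then w < z \<and> z < x else x < z \<and> z < w"
        "f w = (\<Sum>k<2. D k x / fact k * (w - x) ^ k) + D 2 z / fact 2 * (w - x) ^ 2" by blast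
    have "\<bar>z - x\<bar> \<le> h" using z(1) w h by (auto split: if_splits)
    moreover have "f w = f x + f' x * (w - x) + f'' z / 2 * (w - x)\<^sup>2"
      using z(2) by (simp add: D_def numeral_2_eq_2)
    ultimately show ?thesis by blast
  qed
  obtain z1 where z1: "\<bar>z1 - x\<bar> \<le> h" "f (x + h) = f x + f' x * h + f'' z1 / 2 * h\<^sup>2"
    using taylor[of "x + h"] by auto
  obtain z2 where z2: "\<bar>z2 - x\<bar> \<le> h" "f (x - h) = f x - f' x * h + f'' z2 / 2 * h\<^sup>2"
    using taylor[of "x - h"] by auto
  have "f (x + h) + f (x - h) - 2 * f x - h\<^sup>2 * l = h\<^sup>2 * ((f'' z1 - l) / 2 + (f'' z2 - l) / 2)"
    using z1 z2 by (simp add: field_simps)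
  also have "\<bar>\<dots>\<bar> = h\<^sup>2 * \<bar>(f'' z1 - l) / 2 + (f'' z2 - l) / 2\<bar>"
    by (simp add: abs_mult)
  also have "\<dots> \<le> h\<^sup>2 * e"
    using bd[OF z1(1)] bd[OF z2(1)] by (intro mult_left_mono zero_le_power2) (auto simp: abs_le_iff field_simps)
  finally show ?thesis .
qed

text \<open>Both estimates are uniform in time and space because the spatial derivatives are
  continuous on a compact set of positive times; this is where \<open>0 < s\<close> enters.\<close>

lemma heat_discretization:
  assumes heat: "heat_solution m0 m" and s: "0 < s"
  obtains m_t K where
    "\<And>u \<theta>. 0 < u \<Longrightarrow> ((\<lambda>u. m u \<theta>) has_real_derivative m_t u \<theta>) (at u)"
    "\<And>u \<theta> n. s \<le> u \<Longrightarrow> u \<le> t \<Longrightarrow> 0 \<le> \<theta> \<Longrightarrow> \<theta> \<le> 1 \<Longrightarrow> 1 \<le> n \<Longrightarrow>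
       \<bar>real n * (m u (\<theta> + 1 / real n) - m u \<theta>)\<bar> \<le> K"
    "\<And>e. 0 < e \<Longrightarrow> \<forall>\<^sub>F n in sequentially. \<forall>u\<in>{s..t}. \<forall>\<theta>\<in>{0..1}.
       \<bar>(real n)\<^sup>2 * (m u (\<theta> + 1 / real n) + m u (\<theta> - 1 / real n) - 2 * m u \<theta>) - m_t u \<theta>\<bar> \<le> e"
proof (rule heat_solution_derivs[OF heat])
  fix m_x m_xx assume
    dt: "\<And>t \<theta>. 0 < t \<Longrightarrow> ((\<lambda>s. m s \<theta>) has_real_derivative m_xx t \<theta>) (at t)" and
    dx: "\<And>t \<theta>. 0 < t \<Longrightarrow> ((\<lambda>x. m t x) has_real_derivative m_x t \<theta>) (at \<theta>)" and
    dxx: "\<And>t \<theta>. 0 < t \<Longrightarrow> ((\<lambda>x. m_x t x) has_real_derivative m_xx t \<theta>) (at \<theta>)" and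
    cx: "continuous_on ({0<..} \<times> UNIV) (\<lambda>(t, \<theta>). m_x t \<theta>)" and
    cxx: "continuous_on ({0<..} \<times> UNIV) (\<lambda>(t, \<theta>). m_xx t \<theta>)"
  \<comment> \<open>The margin of length 1 on either side contains all points
    \<open>\<theta> + 1 / n\<close> and \<open>\<theta> - 1 / n\<close>.\<close>
  let ?Q = "{s..t} \<times> {-1..2::real}"
  have Q: "?Q \<subseteq> {0<..} \<times> UNIV" "compact ?Q" using s by (auto intro: compact_Times)
  have "bounded ((\<lambda>(t, \<theta>). m_x t \<theta>) ` ?Q)"
    by (intro compact_imp_bounded compact_continuous_image continuous_on_subset[OF cx] Q)
  then obtain K where K: "\<And>u \<theta>. s \<le> u \<Longrightarrow> u \<le> t \<Longrightarrow> -1 \<le> \<theta> \<Longrightarrow> \<theta> \<le> 2 \<Longrightarrow> \<bar>m_x u \<theta>\<bar> \<le> K"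
    by (fastforce simp: bounded_iff)
  have unif: "uniformly_continuous_on ?Q (\<lambda>(t, \<theta>). m_xx t \<theta>)"
    by (intro compact_uniformly_continuous continuous_on_subset[OF cxx] Q)
  show ?thesis
  proof (rule that[of m_xx K])
    show "\<And>u \<theta>. 0 < u \<Longrightarrow> ((\<lambda>u. m u \<theta>) has_real_derivative m_xx u \<theta>) (at u)" by (rule dt)
    fix u \<theta> :: real and n :: nat assume A: "s \<le> u" "u \<le> t" "0 \<le> \<theta>" "\<theta> \<le> 1" "1 \<le> n"
    then have u: "0 < u" using s by linarith
    have h: "0 < 1 / real n" "1 / real n \<le> 1" using A by auto
    obtain z where z: "\<theta> < z" "z < \<theta> + 1 / real n" "m u (\<theta> + 1 / real n) - m u \<theta> = (\<theta> + 1 / real n - \<theta>) * m_x u z"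
      using MVT2[of \<theta> "\<theta> + 1 / real n" "m u" "m_x u"] dx[OF u] h by auto
    have "real n * (m u (\<theta> + 1 / real n) - m u \<theta>) = m_x u z"
      using z(3) A by simp
    then show "\<bar>real n * (m u (\<theta> + 1 / real n) - m u \<theta>)\<bar> \<le> K"
      using K[of u z] A z h by simp
  next
    fix e :: real assume e: "0 < e"
    obtain d where d: "d > 0" "\<And>p q. p \<in> ?Q \<Longrightarrow> q \<in> ?Q \<Longrightarrow> dist q p < d \<Longrightarrow>
        dist ((\<lambda>(t, \<theta>). m_xx t \<theta>) q) ((\<lambda>(t, \<theta>). m_xx t \<theta>) p) < e"
      using unif e unfolding uniformly_continuous_on_def by metis
    have "\<forall>\<^sub>F n in sequentially. 1 / real n < d"
      using order_tendstoD(2)[OF lim_1_over_n d(1)] .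
    then show "\<forall>\<^sub>F n in sequentially. \<forall>u\<in>{s..t}. \<forall>\<theta>\<in>{0..1}.
       \<bar>(real n)\<^sup>2 * (m u (\<theta> + 1 / real n) + m u (\<theta> - 1 / real n) - 2 * m u \<theta>) - m_xx u \<theta>\<bar> \<le> e"
      using eventually_ge_at_top[of 1]
    proof eventually_elim
      case (elim n)
      have h: "0 < 1 / real n" "1 / real n \<le> 1" using elim by auto
      show ?case
      proof (intro ballI)
        fix u \<theta> assume u: "u \<in> {s..t}" and \<theta>: "\<theta> \<in> {0..1::real}"
        then have u0: "0 < u" using s by auto
        have "\<bar>m u (\<theta> + 1 / real n) + m u (\<theta> - 1 / real n) - 2 * m u \<theta> - (1 / real n)\<^sup>2 * m_xx u \<theta>\<bar> \<le> (1 / real n)\<^sup>2 * e"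
        proof (rule second_difference_bound[OF dx[OF u0] dxx[OF u0] h(1)])
          fix z assume z: "\<bar>z - \<theta>\<bar> \<le> 1 / real n"
          moreover have "- 1 \<le> z" "z \<le> 2" using z \<theta> h unfolding atLeastAtMost_iff by linarith+
          ultimately have "(u, z) \<in> ?Q" "(u, \<theta>) \<in> ?Q" "dist (u, z) (u, \<theta>) < d"
            using u \<theta> h elim by (auto simp: dist_Pair_Pair dist_real_def)
          then show "\<bar>m_xx u z - m_xx u \<theta>\<bar> \<le> e"
            using d(2)[of "(u, \<theta>)" "(u, z)"] by (auto simp: dist_real_def)
        qed
        then have "(real n)\<^sup>2 * \<bar>m u (\<theta> + 1 / real n) + m u (\<theta> - 1 / real n) - 2 * m u \<theta> - (1 / real n)\<^sup>2 * m_xx u \<theta>\<bar> \<le>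
            (real n)\<^sup>2 * ((1 / real n)\<^sup>2 * e)"
          by (intro mult_left_mono) auto
        also have "(real n)\<^sup>2 * ((1 / real n)\<^sup>2 * e) = e"
          using elim by (simp add: power_divide)
        also have "(real n)\<^sup>2 * \<bar>m u (\<theta> + 1 / real n) + m u (\<theta> - 1 / real n) - 2 * m u \<theta> - (1 / real n)\<^sup>2 * m_xx u \<theta>\<bar> =
            \<bar>(real n)\<^sup>2 * (m u (\<theta> + 1 / real n) + m u (\<theta> - 1 / real n) - 2 * m u \<theta> - (1 / real n)\<^sup>2 * m_xx u \<theta>)\<bar>"
          by (simp add: abs_mult)
        also have "(real n)\<^sup>2 * (m u (\<theta> + 1 / real n) + m u (\<theta> - 1 / real n) - 2 * m u \<theta> - (1 / real n)\<^sup>2 * m_xx u \<theta>) =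
            (real n)\<^sup>2 * (m u (\<theta> + 1 / real n) + m u (\<theta> - 1 / real n) - 2 * m u \<theta>) - m_xx u \<theta>"
          using elim by (simp add: algebra_simps power_divide)
        finally show "\<bar>(real n)\<^sup>2 * (m u (\<theta> + 1 / real n) + m u (\<theta> - 1 / real n) - 2 * m u \<theta>) - m_xx u \<theta>\<bar> \<le> e" .
      qed
    qed
  qed
qed

section \<open>The hydrodynamic limit\<close>

text \<open>Generated by scaled waves and sums only, so that statements linear in the test function
  have just two cases; closure under products is proved separately, for the approximation
  theorem.\<close>

inductive trig_poly :: "(real \<Rightarrow> real) \<Rightarrow> bool" where
  wave: "trig_poly (\<lambda>\<theta>. c * wave k \<phi> \<theta>)"
| add: "trig_poly f \<Longrightarrow> trig_poly g \<Longrightarrow> trig_poly (\<lambda>\<theta>. f \<theta> + g \<theta>)"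

text \<open>The product formula for cosines; \<open>k \<le> j\<close> keeps the difference of the
  frequencies a natural number.\<close>

lemma wave_mult:
  assumes "k \<le> j"
  shows "wave j \<phi> \<theta> * wave k \<psi> \<theta> = 1 / 2 * wave (j - k) (\<phi> - \<psi>) \<theta> + 1 / 2 * wave (j + k) (\<phi> + \<psi>) \<theta>"
proof -
  let ?a = "2 * pi * real j * \<theta> + \<phi>" and ?b = "2 * pi * real k * \<theta> + \<psi>"
  have "wave (j - k) (\<phi> - \<psi>) \<theta> = cos (?a - ?b)" "wave (j + k) (\<phi> + \<psi>) \<theta> = cos (?a + ?b)"
    using assms by (simp_all add: wave_def of_nat_diff algebra_simps)
  moreover have "wave j \<phi> \<theta> = cos ?a" "wave k \<psi> \<theta> = cos ?b"
    by (simp_all add: wave_def)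
  ultimately show ?thesis
    by (simp only: cos_times_cos) (simp add: field_simps)
qed

lemma trig_poly_wave_mult: "trig_poly (\<lambda>\<theta>. (c * wave j \<phi> \<theta>) * (d * wave k \<psi> \<theta>))"
proof -
  have *: "trig_poly (\<lambda>\<theta>. (c * wave j \<phi> \<theta>) * (d * wave k \<psi> \<theta>))" if "k \<le> j" for c j \<phi> d k \<psi>
  proof -
    have "(\<lambda>\<theta>. (c * wave j \<phi> \<theta>) * (d * wave k \<psi> \<theta>)) =
       (\<lambda>\<theta>. (c * d / 2) * wave (j - k) (\<phi> - \<psi>) \<theta> + (c * d / 2) * wave (j + k) (\<phi> + \<psi>) \<theta>)"
    proof
      fix \<theta>
      have "(c * wave j \<phi> \<theta>) * (d * wave k \<psi> \<theta>) = c * d * (wave j \<phi> \<theta> * wave k \<psi> \<theta>)" by simp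
      then show "(c * wave j \<phi> \<theta>) * (d * wave k \<psi> \<theta>) =
         (c * d / 2) * wave (j - k) (\<phi> - \<psi>) \<theta> + (c * d / 2) * wave (j + k) (\<phi> + \<psi>) \<theta>"
        unfolding wave_mult[OF that] by (simp add: distrib_left)
    qed
    then show ?thesis by (simp only:) (intro trig_poly.intros)
  qed
  show ?thesis
  proof (cases "k \<le> j")
    case False
    then show ?thesis using *[of j k d \<psi> c \<phi>] by (simp add: mult.commute)
  qed (rule *)
qed

lemma trig_poly_mult:
  assumes "trig_poly f" "trig_poly g"
  shows "trig_poly (\<lambda>\<theta>. f \<theta> * g \<theta>)"
  using assms
proof (induction f)
  case (wave c j \<phi>)
  from this show ?case
    by (induction g) (auto intro: trig_poly_wave_mult trig_poly.add simp: distrib_left)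
next
  case (add f f')
  then show ?case by (auto intro: trig_poly.add simp: distrib_right)
qed

text \<open>On the unit circle a real-linear functional is a combination of cosine and sine, the
  sine being a wave of phase \<open>- (pi / 2)\<close>; sums and products are covered by
  closure.\<close>

lemma trig_poly_real_polynomial:
  fixes p :: "complex \<Rightarrow> real"
  assumes "real_polynomial_function p"
  shows "trig_poly (\<lambda>\<theta>. p (cis (2 * pi * \<theta>)))"
  using assms
proof (induction p)
  case (linear f)
  then interpret bounded_linear f .
  have "f (cis (2 * pi * \<theta>)) = f 1 * wave 1 0 \<theta> + f \<i> * wave 1 (- (pi / 2)) \<theta>" for \<theta>
  proof -
    have "cis (2 * pi * \<theta>) = cos (2 * pi * \<theta>) *\<^sub>R 1 + sin (2 * pi * \<theta>) *\<^sub>R \<i>"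
      by (simp add: complex_eq_iff)
    then have "f (cis (2 * pi * \<theta>)) = cos (2 * pi * \<theta>) * f 1 + sin (2 * pi * \<theta>) * f \<i>"
      by (simp only: add scaleR) simp
    moreover have "wave 1 (- (pi / 2)) \<theta> = sin (2 * pi * \<theta>)"
      using cos_diff[of "2 * pi * \<theta>" "pi / 2"] by (simp add: wave_def)
    ultimately show ?thesis by (simp add: wave_def)
  qed
  then show ?case by (auto intro: trig_poly.intros)
next
  case (const c)
  have "c = c * wave 0 0 \<theta>" for \<theta> by (simp add: wave_def)
  then show ?case using trig_poly.wave[of c 0 0] by (simp add: wave_def)
qed (auto intro: trig_poly_mult trig_poly.add)

lemma trig_poly_continuous: "trig_poly p \<Longrightarrow> continuous_on A p"
  by (induction rule: trig_poly.induct) (auto intro!: continuous_intros)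

lemma trig_poly_approximation:
  assumes per: "torus_periodic g" and cont: "continuous_on UNIV g" and e: "0 < e"
  obtains p where "trig_poly p" "\<And>\<theta>. 0 \<le> \<theta> \<Longrightarrow> \<theta> < 1 \<Longrightarrow> \<bar>g \<theta> - p \<theta>\<bar> < e"
proof -
  have "g 1 = g 0" using per unfolding torus_periodic_def by (metis add_0)
  \<comment> \<open>A periodic function is a loop; its trivial homotopy with itself yields
    continuity of the induced function on the circle, including the point of angle 0, where
    \<open>Arg2pi\<close> jumps.\<close>
  then have "homotopic_loops UNIV g g"
    unfolding homotopic_loops_refl path_def pathstart_def pathfinish_def
    using continuous_on_subset[OF cont] by auto
  then have "continuous_on (sphere 0 1) (g \<circ> (\<lambda>z. Arg2pi z / (2 * pi)))"
    using homotopic_loops_imp_homotopic_circlemaps homotopic_with_imp_continuous by blast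
  then obtain p where p: "real_polynomial_function p"
      "\<And>z. z \<in> sphere 0 1 \<Longrightarrow> \<bar>(g \<circ> (\<lambda>z. Arg2pi z / (2 * pi))) z - p z\<bar> < e"
    using Stone_Weierstrass_real_polynomial_function[OF compact_sphere _ e] by blast
  show ?thesis
  proof (rule that[OF trig_poly_real_polynomial[OF p(1)]])
    fix \<theta> :: real assume \<theta>: "0 \<le> \<theta>" "\<theta> < 1"
    have "Arg2pi (cis (2 * pi * \<theta>)) = 2 * pi * \<theta>"
      by (rule Arg2pi_unique[of 1]) (use \<theta> in \<open>auto simp: cis_conv_exp\<close>)
    then show "\<bar>g \<theta> - p (cis (2 * pi * \<theta>))\<bar> < e"
      using p(2)[of "cis (2 * pi * \<theta>)"] by simp
  qed
qed

section \<open>Deviations of the empirical mean\<close>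

definition pvec :: "nat \<Rightarrow> (config \<Rightarrow> real) \<Rightarrow> bool" where
  "pvec n q \<longleftrightarrow> (\<forall>\<eta>\<in>configs n. 0 \<le> q \<eta>) \<and> (\<Sum>\<eta>\<in>configs n. q \<eta>) = 1"

text \<open>Deviation in mean rather than in probability: it obeys a triangle inequality and
  controls expectations directly.\<close>

definition mean_dev :: "nat \<Rightarrow> (config \<Rightarrow> real) \<Rightarrow> (real \<Rightarrow> real) \<Rightarrow> real \<Rightarrow> real" where
  "mean_dev n q G b = (\<Sum>\<eta>\<in>configs n. q \<eta> * \<bar>empirical_mean n \<eta> G - b\<bar>)"

lemma pvec_law: "pvec n q \<Longrightarrow> 0 \<le> t \<Longrightarrow> pvec n (law n q t)"
  by (auto simp: pvec_def sum_law intro: law_ge)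

lemma mean_dev_nonneg: "pvec n q \<Longrightarrow> 0 \<le> mean_dev n q G b"
  unfolding mean_dev_def pvec_def by (auto intro!: sum_nonneg)

lemma expectation_mono:
  assumes "pvec n q" "\<And>\<eta>. \<eta> \<in> configs n \<Longrightarrow> f \<eta> \<le> c"
  shows "(\<Sum>\<eta>\<in>configs n. q \<eta> * f \<eta>) \<le> c"
proof -
  have "(\<Sum>\<eta>\<in>configs n. q \<eta> * f \<eta>) \<le> (\<Sum>\<eta>\<in>configs n. q \<eta> * c)"
    using assms by (intro sum_mono mult_left_mono) (auto simp: pvec_def)
  also have "\<dots> = c" using assms(1) by (simp add: pvec_def flip: sum_distrib_right)
  finally show ?thesis .
qed

lemma abs_empirical_mean_le:
  assumes "\<eta> \<in> configs n" "1 \<le> n" "\<And>\<theta>. 0 \<le> \<theta> \<Longrightarrow> \<theta> < 1 \<Longrightarrow> \<bar>G \<theta>\<bar> \<le> B"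
  shows "\<bar>empirical_mean n \<eta> G\<bar> \<le> B"
proof -
  have "\<bar>\<Sum>i<n. G (real i / real n) * real (\<eta> i)\<bar> \<le> (\<Sum>i<n. B)"
  proof (rule order_trans[OF sum_abs sum_mono])
    fix i assume i: "i \<in> {..<n}"
    have "\<bar>G (real i / real n)\<bar> \<le> B"
      using i assms(2) by (intro assms(3)) auto
    moreover from this have "0 \<le> B" by linarith
    ultimately show "\<bar>G (real i / real n) * real (\<eta> i)\<bar> \<le> B"
      using config_values[OF assms(1), of i] i by auto
  qed
  then show ?thesis
    using assms(2) by (simp add: empirical_mean_def abs_mult field_simps)
qed

lemma empirical_mean_add: "empirical_mean n \<eta> (\<lambda>\<theta>. f \<theta> + g \<theta>) = empirical_mean n \<eta> f + empirical_mean n \<eta> g"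
  by (simp add: empirical_mean_def sum.distrib distrib_left distrib_right)

lemma empirical_mean_diff: "empirical_mean n \<eta> (\<lambda>\<theta>. f \<theta> - g \<theta>) = empirical_mean n \<eta> f - empirical_mean n \<eta> g"
  by (simp add: empirical_mean_def sum_subtractf right_diff_distrib left_diff_distrib diff_divide_distrib)

lemma empirical_mean_cmult: "empirical_mean n \<eta> (\<lambda>\<theta>. c * f \<theta>) = c * empirical_mean n \<eta> f"
  by (simp add: empirical_mean_def sum_distrib_left mult_ac)

lemma periodic_site:
  assumes g: "torus_periodic g" and n: "2 \<le> n" and i: "i < n"
  shows "g (real (nxt n i) / real n) = g (real i / real n + 1 / real n)"
    "g (real (prv n i) / real n) = g (real i / real n - 1 / real n)"
proof -
  have per: "g (\<theta> + 1) = g \<theta>" for \<theta> using g by (simp add: torus_periodic_def)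
  show "g (real (nxt n i) / real n) = g (real i / real n + 1 / real n)"
  proof (cases "i = n - 1")
    case True
    then have "real i / real n + 1 / real n = 0 + 1"
      using n by (simp add: of_nat_diff field_simps)
    moreover have "nxt n i = 0" using True i by (simp add: nxt_eq)
    ultimately show ?thesis by (simp only: per) simp
  qed (use i in \<open>simp add: nxt_eq add_divide_distrib add.commute\<close>)
  show "g (real (prv n i) / real n) = g (real i / real n - 1 / real n)"
  proof (cases "i = 0")
    case True
    then have "real (prv n i) / real n = (real i / real n - 1 / real n) + 1"
      using n by (simp add: of_nat_diff prv_def field_simps)
    then show ?thesis by (simp only: per)
  qed (use i in \<open>simp add: prv_def of_nat_diff diff_divide_distrib\<close>)
qed

text \<open>Self-adjointness of the discrete Laplacian, by shifting the summation site.\<close>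

lemma sum_nxt_prv:
  assumes n: "2 \<le> n"
  shows "(\<Sum>i<n. G i * (F (nxt n i) + F (prv n i) - 2 * F i)) = (\<Sum>i<n. (G (nxt n i) + G (prv n i) - 2 * G i) * (F i :: real))"
proof -
  have "(\<Sum>i<n. G i * F (nxt n i)) = (\<Sum>i<n. G (prv n (nxt n i)) * F (nxt n i))"
    by (intro sum.cong refl) (simp add: prv_nxt[OF n])
  also have "\<dots> = (\<Sum>i<n. G (prv n i) * F i)"
    by (rule sum_nxt[of "\<lambda>i. G (prv n i) * F i"])
  finally have 1: "(\<Sum>i<n. G i * F (nxt n i)) = (\<Sum>i<n. G (prv n i) * F i)" .
  have "(\<Sum>i<n. G i * F (prv n i)) = (\<Sum>i<n. G (nxt n i) * F (prv n (nxt n i)))"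
    by (rule sum_nxt[of "\<lambda>i. G i * F (prv n i)", symmetric])
  also have "\<dots> = (\<Sum>i<n. G (nxt n i) * F i)"
    by (intro sum.cong refl) (simp add: prv_nxt[OF n])
  finally show ?thesis using 1
    by (simp add: distrib_left distrib_right right_diff_distrib left_diff_distrib sum.distrib sum_subtractf mult_ac)
qed

text \<open>Mean occupations solve the discrete heat equation, and \<open>wave\<close> is an exact
  eigenfunction for every \<open>n\<close>, so its coefficient decays exactly exponentially.\<close>

lemma wave_occ_evolution:
  assumes x: "x \<in> configs n" and n: "2 \<le> n"
  shows "(\<Sum>i<n. wave k \<phi> (real i / real n) * occ n x i t) =
     exp (- ((real n)\<^sup>2 * (2 * (1 - cos (2 * pi * real k / real n))) * t)) * (\<Sum>i<n. wave k \<phi> (real i / real n) * real (x i))"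
proof -
  define G where "G i = wave k \<phi> (real i / real n)" for i
  define l where "l = (real n)\<^sup>2 * (2 * (1 - cos (2 * pi * real k / real n)))"
  define f where "f t = (\<Sum>i<n. G i * occ n x i t)" for t
  have per: "torus_periodic (wave k \<phi>)"
    by (simp add: torus_periodic_def wave_periodic)
  have eig: "G (nxt n i) + G (prv n i) - 2 * G i = - (2 * (1 - cos (2 * pi * real k / real n))) * G i" if "i < n" for i
    using wave_second_difference[of k \<phi> "real i / real n" "1 / real n"] by (simp add: G_def periodic_site[OF per n that])
  have df: "(f has_real_derivative - l * f t) (at t)" for t
  proof -
    have "(f has_real_derivative (\<Sum>i<n. G i * ((real n)\<^sup>2 * (\<Sum>e<n. occ n x (bond_swap n e i) t - occ n x i t)))) (at t)"
      unfolding f_def[abs_def] by (intro DERIV_sum DERIV_cmult occ_deriv x)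
    moreover have "(\<Sum>i<n. G i * ((real n)\<^sup>2 * (\<Sum>e<n. occ n x (bond_swap n e i) t - occ n x i t))) =
        (real n)\<^sup>2 * (\<Sum>i<n. G i * (occ n x (nxt n i) t + occ n x (prv n i) t - 2 * occ n x i t))"
    proof -
      have "(\<Sum>e<n. occ n x (bond_swap n e i) t - occ n x i t) = occ n x (nxt n i) t + occ n x (prv n i) t - 2 * occ n x i t"
        if "i < n" for i
        by (rule sum_bond_swap_diff[OF n that, of "\<lambda>i. occ n x i t"])
      then have "(\<Sum>i<n. G i * ((real n)\<^sup>2 * (\<Sum>e<n. occ n x (bond_swap n e i) t - occ n x i t))) =
          (\<Sum>i<n. (real n)\<^sup>2 * (G i * (occ n x (nxt n i) t + occ n x (prv n i) t - 2 * occ n x i t)))"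
        by (intro sum.cong refl) (simp add: mult.left_commute)
      then show ?thesis by (simp only: sum_distrib_left[symmetric])
    qed
    moreover have "\<dots> = (real n)\<^sup>2 * (\<Sum>i<n. - (2 * (1 - cos (2 * pi * real k / real n))) * G i * occ n x i t)"
      unfolding sum_nxt_prv[OF n, of G "\<lambda>i. occ n x i t"] by (simp add: eig)
    moreover have "\<dots> = - l * f t"
      by (simp only: mult.assoc sum_distrib_left[symmetric]) (simp add: l_def f_def algebra_simps)
    ultimately show ?thesis by simp
  qed
  have "((\<lambda>t. f t * exp (l * t)) has_real_derivative 0) (at t)" for t
  proof -
    have "((\<lambda>t. exp (l * t)) has_real_derivative l * exp (l * t)) (at t)"
      by (auto intro!: derivative_eq_intros)
    from DERIV_mult'[OF df this] show ?thesis by (rule DERIV_cong) (simp add: mult_ac)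
  qed
  then have "f t * exp (l * t) = f 0 * exp (l * 0)"
    using DERIV_isconst_all by blast
  then have "f t = exp (- (l * t)) * f 0"
    by (simp add: exp_minus field_simps)
  then show ?thesis
    by (simp add: f_def G_def l_def occ_0)
qed

text \<open>Variance plus squared bias; the variance is at most the sum of the absolute
  correlations, one half for each of the \<open>n\<close> rows.\<close>

lemma semigroup_square_deviation_le:
  assumes x: "x \<in> configs n" and t: "0 \<le> t" and G: "\<And>i. i < n \<Longrightarrow> \<bar>G i\<bar> \<le> 1"
  shows "ssep_at n t (\<lambda>\<eta>. ((\<Sum>i<n. G i * real (\<eta> i)) - a)\<^sup>2) x \<le> real n / 2 + ((\<Sum>i<n. G i * occ n x i t) - a)\<^sup>2"
proof -
  have sq: "((\<Sum>i<n. G i * y i) - a)\<^sup>2 = (\<Sum>i<n. \<Sum>j<n. G i * G j * (y i * y j)) - 2 * a * (\<Sum>i<n. G i * y i) + a\<^sup>2"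
    for y :: "nat \<Rightarrow> real"
  proof -
    have "(\<Sum>i<n. G i * y i)\<^sup>2 = (\<Sum>i<n. \<Sum>j<n. G i * G j * (y i * y j))"
      by (simp add: power2_eq_square sum_product mult_ac)
    then show ?thesis by (simp add: power2_diff)
  qed
  have "ssep_at n t (\<lambda>\<eta>. ((\<Sum>i<n. G i * real (\<eta> i)) - a)\<^sup>2) x =
      (\<Sum>i<n. \<Sum>j<n. G i * G j * (corr n x i j t + occ n x i t * occ n x j t)) - 2 * a * (\<Sum>i<n. G i * occ n x i t) + a\<^sup>2"
    unfolding sq
    by (simp only: semigroup_add[OF x] semigroup_diff[OF x] semigroup_cmult[OF x] semigroup_sum[OF x] semigroup_const[OF x])
       (simp add: occ_def corr_def)
  also have "\<dots> = (\<Sum>i<n. \<Sum>j<n. G i * G j * corr n x i j t) + ((\<Sum>i<n. G i * occ n x i t) - a)\<^sup>2"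
    unfolding sq by (simp add: distrib_left sum.distrib)
  also have "(\<Sum>i<n. \<Sum>j<n. G i * G j * corr n x i j t) \<le> (\<Sum>i<n. \<Sum>j<n. \<bar>corr n x i j t\<bar>)"
  proof (intro sum_mono)
    fix i j assume "i \<in> {..<n}" "j \<in> {..<n}"
    then have "\<bar>G i\<bar> * \<bar>G j\<bar> \<le> 1 * 1" using G by (intro mult_mono) auto
    then have "\<bar>G i\<bar> * \<bar>G j\<bar> * \<bar>corr n x i j t\<bar> \<le> 1 * \<bar>corr n x i j t\<bar>" by (intro mult_right_mono) auto
    then show "G i * G j * corr n x i j t \<le> \<bar>corr n x i j t\<bar>"
      using abs_ge_self[of "G i * G j * corr n x i j t"] by (simp add: abs_mult)
  qed
  also have "\<dots> \<le> (\<Sum>i<n. 1 / 2)"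
    by (intro sum_mono sum_abs_corr_le x t) auto
  finally show ?thesis by simp
qed

lemma wave_square_deviation_le:
  assumes q: "pvec n q" and n: "2 \<le> n" and t: "0 \<le> t"
  shows "(\<Sum>\<eta>\<in>configs n. law n q t \<eta> * (empirical_mean n \<eta> (wave k \<phi>) - b)\<^sup>2) \<le> 1 / (2 * real n) +
    (\<Sum>x\<in>configs n. q x * (exp (- ((real n)\<^sup>2 * (2 * (1 - cos (2 * pi * real k / real n))) * t)) * empirical_mean n x (wave k \<phi>) - b)\<^sup>2)"
proof -
  let ?l = "(real n)\<^sup>2 * (2 * (1 - cos (2 * pi * real k / real n)))" and ?G = "\<lambda>i. wave k \<phi> (real i / real n)"
  have bound: "ssep_at n t (\<lambda>\<eta>. (empirical_mean n \<eta> (wave k \<phi>) - b)\<^sup>2) x \<le>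
      1 / (2 * real n) + (exp (- (?l * t)) * empirical_mean n x (wave k \<phi>) - b)\<^sup>2" if x: "x \<in> configs n" for x
  proof -
    have scale: "(1 / real n * y - b)\<^sup>2 = (1 / (real n)\<^sup>2) * (y - real n * b)\<^sup>2" for y
    proof -
      have "1 / real n * y - b = (1 / real n) * (y - real n * b)" using n by (simp add: field_simps)
      then show ?thesis by (simp only: power_mult_distrib) (simp add: power_divide)
    qed
    have "ssep_at n t (\<lambda>\<eta>. (empirical_mean n \<eta> (wave k \<phi>) - b)\<^sup>2) x =
       (1 / (real n)\<^sup>2) * ssep_at n t (\<lambda>\<eta>. ((\<Sum>i<n. ?G i * real (\<eta> i)) - real n * b)\<^sup>2) x"
      unfolding empirical_mean_def scale semigroup_cmult[OF x] ..
    also have "\<dots> \<le> (1 / (real n)\<^sup>2) * (real n / 2 + ((\<Sum>i<n. ?G i * occ n x i t) - real n * b)\<^sup>2)"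
      by (intro mult_left_mono semigroup_square_deviation_le x t abs_wave_le_1) auto
    also have "\<dots> = 1 / (2 * real n) + (1 / (real n)\<^sup>2) * ((\<Sum>i<n. ?G i * occ n x i t) - real n * b)\<^sup>2"
      using n by (simp add: distrib_left power2_eq_square)
    also have "(\<Sum>i<n. ?G i * occ n x i t) = exp (- (?l * t)) * (\<Sum>i<n. ?G i * real (x i))"
      by (rule wave_occ_evolution[OF x n])
    also have "(1 / (real n)\<^sup>2) * (exp (- (?l * t)) * (\<Sum>i<n. ?G i * real (x i)) - real n * b)\<^sup>2 =
       (exp (- (?l * t)) * empirical_mean n x (wave k \<phi>) - b)\<^sup>2"
      unfolding scale[symmetric] empirical_mean_def by (simp add: mult_ac)
    finally show ?thesis .
  qed
  have "(\<Sum>\<eta>\<in>configs n. law n q t \<eta> * (empirical_mean n \<eta> (wave k \<phi>) - b)\<^sup>2) =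
      (\<Sum>x\<in>configs n. q x * ssep_at n t (\<lambda>\<eta>. (empirical_mean n \<eta> (wave k \<phi>) - b)\<^sup>2) x)"
    by (rule law_expectation)
  also have "\<dots> \<le> (\<Sum>x\<in>configs n. q x * (1 / (2 * real n) + (exp (- (?l * t)) * empirical_mean n x (wave k \<phi>) - b)\<^sup>2))"
    using q by (intro sum_mono mult_left_mono bound) (auto simp: pvec_def)
  also have "\<dots> = (\<Sum>x\<in>configs n. q x) * (1 / (2 * real n)) + (\<Sum>x\<in>configs n. q x * (exp (- (?l * t)) * empirical_mean n x (wave k \<phi>) - b)\<^sup>2)"
    by (simp only: distrib_left sum.distrib sum_distrib_right)
  finally show ?thesis using q by (simp add: pvec_def)
qed

definition tail_prob :: "nat \<Rightarrow> (config \<Rightarrow> real) \<Rightarrow> (real \<Rightarrow> real) \<Rightarrow> real \<Rightarrow> real \<Rightarrow> real" where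
  "tail_prob n q G b \<delta> = (\<Sum>\<eta>\<in>{\<eta> \<in> configs n. \<bar>empirical_mean n \<eta> G - b\<bar> > \<delta>}. q \<eta>)"

lemma tail_prob_eq: "tail_prob n q G b \<delta> = (\<Sum>\<eta>\<in>configs n. q \<eta> * of_bool (\<bar>empirical_mean n \<eta> G - b\<bar> > \<delta>))"
  unfolding tail_prob_def by (rule sum.mono_neutral_cong_left) auto

lemma tail_prob_le_mean_dev:
  assumes "pvec n q" "0 < \<delta>"
  shows "tail_prob n q G b \<delta> \<le> mean_dev n q G b / \<delta>"
  unfolding tail_prob_eq mean_dev_def sum_divide_distrib
proof (rule sum_mono)
  fix \<eta> assume "\<eta> \<in> configs n"
  then have "0 \<le> q \<eta>" using assms by (auto simp: pvec_def)
  moreover have "of_bool (\<bar>empirical_mean n \<eta> G - b\<bar> > \<delta>) \<le> \<bar>empirical_mean n \<eta> G - b\<bar> / \<delta>"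
    using assms by auto
  ultimately show "q \<eta> * of_bool (\<bar>empirical_mean n \<eta> G - b\<bar> > \<delta>) \<le> q \<eta> * \<bar>empirical_mean n \<eta> G - b\<bar> / \<delta>"
    using mult_left_mono by fastforce
qed

lemma tail_prob_nonneg: "pvec n q \<Longrightarrow> 0 \<le> tail_prob n q G b \<delta>"
  unfolding tail_prob_def pvec_def by (auto intro!: sum_nonneg)

text \<open>The initial assumption is a convergence in probability; empirical means of waves are
  bounded by 1, so it extends to second moments. The decay factors converge by
  \<open>discrete_eigenvalue_tendsto\<close>.\<close>

lemma wave_mean_dev_tendsto:
  assumes Q: "\<And>n. 1 \<le> n \<Longrightarrow> pvec n (Q n)" and t: "0 \<le> t" and b: "\<bar>b\<bar> \<le> 1"
    and init: "\<And>\<delta>. 0 < \<delta> \<Longrightarrow> (\<lambda>n. tail_prob n (Q n) (wave k \<phi>) b \<delta>) \<longlonglongrightarrow> 0"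
  shows "(\<lambda>n. mean_dev n (law n (Q n) t) (wave k \<phi>) (exp (- ((2 * pi * real k)\<^sup>2 * t)) * b)) \<longlonglongrightarrow> 0"
proof (rule tendstoI)
  fix e :: real assume e: "0 < e"
  \<comment> \<open>The majorant \<open>R n\<close> below tends to \<open>d + d / 2\<close>, three
    quarters of \<open>e\<close>.\<close>
  define d where "d = e / 2"
  have d: "0 < d" using e by (simp add: d_def)
  define c where "c = exp (- ((2 * pi * real k)\<^sup>2 * t))"
  define cn where "cn n = exp (- ((real n)\<^sup>2 * (2 * (1 - cos (2 * pi * real k / real n))) * t))" for n
  define R where "R n = d + (1 / (2 * real n) + 2 * (cn n - c)\<^sup>2 + d\<^sup>2 / 2 + 8 * tail_prob n (Q n) (wave k \<phi>) b (d / 2)) / d" for n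
  have c: "0 \<le> c" "c \<le> 1" using t by (auto simp: c_def)
  have "cn \<longlonglongrightarrow> c"
    unfolding cn_def[abs_def] c_def by (intro tendsto_intros discrete_eigenvalue_tendsto)
  moreover have "(\<lambda>n. 1 / (2 * real n)) \<longlonglongrightarrow> 0"
    using tendsto_mult[OF tendsto_const[of "1 / 2"] lim_1_over_n] by simp
  ultimately have "R \<longlonglongrightarrow> d + (0 + 2 * (c - c)\<^sup>2 + d\<^sup>2 / 2 + 8 * 0) / d"
    unfolding R_def[abs_def] using d by (intro tendsto_intros init) auto
  then have "R \<longlonglongrightarrow> d + d / 2"
    using d by (simp add: power2_eq_square)
  then have "\<forall>\<^sub>F n in sequentially. R n < e"
    by (rule order_tendstoD) (use e in \<open>simp add: d_def\<close>)
  then show "\<forall>\<^sub>F n in sequentially. dist (mean_dev n (law n (Q n) t) (wave k \<phi>) (exp (- ((2 * pi * real k)\<^sup>2 * t)) * b)) 0 < e"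
    using eventually_ge_at_top[of 2]
  proof eventually_elim
    case (elim n)
    let ?E = "\<lambda>\<eta>. empirical_mean n \<eta> (wave k \<phi>)"
    have q: "pvec n (Q n)" and ql: "pvec n (law n (Q n) t)" using elim Q pvec_law t by auto
    \<comment> \<open>The error splits into that of the decay factor and that of the initial mean.
      The latter is at most \<open>d / 2\<close> except on the tail event, where its square is at
      most 4; doubling gives the 8.\<close>
    have sq: "(cn n * ?E x - c * b)\<^sup>2 \<le> 2 * (cn n - c)\<^sup>2 + d\<^sup>2 / 2 + 8 * of_bool (\<bar>?E x - b\<bar> > d / 2)"
      if x: "x \<in> configs n" for x
    proof -
      have E1: "\<bar>?E x\<bar> \<le> 1" using elim by (intro abs_empirical_mean_le x abs_wave_le_1) auto
      have "cn n * ?E x - c * b = (cn n - c) * ?E x + c * (?E x - b)" by (simp add: algebra_simps)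
      then have "(cn n * ?E x - c * b)\<^sup>2 \<le> 2 * ((cn n - c) * ?E x)\<^sup>2 + 2 * (c * (?E x - b))\<^sup>2"
        using sum_squares_bound[of "(cn n - c) * ?E x" "c * (?E x - b)"] by (simp add: power2_sum)
      also have "((cn n - c) * ?E x)\<^sup>2 \<le> (cn n - c)\<^sup>2"
        using E1 by (simp add: power_mult_distrib mult_left_le abs_square_le_1)
      also have "(c * (?E x - b))\<^sup>2 \<le> (?E x - b)\<^sup>2"
        using c by (simp add: power_mult_distrib mult_left_le_one_le power_le_one)
      also have "(?E x - b)\<^sup>2 \<le> d\<^sup>2 / 4 + 4 * of_bool (\<bar>?E x - b\<bar> > d / 2)"
      proof (cases "\<bar>?E x - b\<bar> > d / 2")
        case True
        have "\<bar>?E x - b\<bar> \<le> 2" using E1 b by linarith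
        then have "\<bar>?E x - b\<bar>\<^sup>2 \<le> 2\<^sup>2" by (intro power_mono) auto
        then show ?thesis using True by (simp add: add_increasing)
      next
        case False
        then have "\<bar>?E x - b\<bar>\<^sup>2 \<le> (d / 2)\<^sup>2" by (intro power_mono) auto
        then show ?thesis using False by (simp add: power_divide)
      qed
      finally show ?thesis by simp
    qed
    have "(\<Sum>\<eta>\<in>configs n. law n (Q n) t \<eta> * (?E \<eta> - c * b)\<^sup>2) \<le>
        1 / (2 * real n) + (\<Sum>x\<in>configs n. Q n x * (cn n * ?E x - c * b)\<^sup>2)"
      unfolding cn_def by (rule wave_square_deviation_le[OF q]) (use elim t in auto)
    also have "(\<Sum>x\<in>configs n. Q n x * (cn n * ?E x - c * b)\<^sup>2) \<le>
        (\<Sum>x\<in>configs n. Q n x * (2 * (cn n - c)\<^sup>2 + d\<^sup>2 / 2 + 8 * of_bool (\<bar>?E x - b\<bar> > d / 2)))"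
      using q by (intro sum_mono mult_left_mono sq) (auto simp: pvec_def)
    also have "\<dots> = (\<Sum>x\<in>configs n. Q n x * (2 * (cn n - c)\<^sup>2 + d\<^sup>2 / 2) + 8 * (Q n x * of_bool (\<bar>?E x - b\<bar> > d / 2)))"
      by (intro sum.cong refl) (simp add: algebra_simps)
    also have "\<dots> = (\<Sum>x\<in>configs n. Q n x) * (2 * (cn n - c)\<^sup>2 + d\<^sup>2 / 2) + 8 * tail_prob n (Q n) (wave k \<phi>) b (d / 2)"
      by (simp only: sum.distrib sum_distrib_left[symmetric] sum_distrib_right[symmetric] tail_prob_eq)
    finally have msq: "(\<Sum>\<eta>\<in>configs n. law n (Q n) t \<eta> * (?E \<eta> - c * b)\<^sup>2) \<le>
        1 / (2 * real n) + 2 * (cn n - c)\<^sup>2 + d\<^sup>2 / 2 + 8 * tail_prob n (Q n) (wave k \<phi>) b (d / 2)"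
      using q by (simp add: pvec_def)
    \<comment> \<open>Converts a second moment into a first absolute moment: either
      \<open>\<bar>y\<bar> \<le> d\<close>, or \<open>\<bar>y\<bar>\<close> is at most its square
      divided by \<open>d\<close>.\<close>
    have "\<bar>y\<bar> \<le> d + y\<^sup>2 / d" for y
    proof (cases "\<bar>y\<bar> \<le> d")
      case False
      then have "\<bar>y\<bar> * d \<le> \<bar>y\<bar> * \<bar>y\<bar>" using d by (intro mult_left_mono) auto
      then have "\<bar>y\<bar> \<le> y\<^sup>2 / d" using d by (simp add: le_divide_eq power2_eq_square)
      then show ?thesis using d by linarith
    qed (use d in \<open>simp add: add_increasing2\<close>)
    then have "mean_dev n (law n (Q n) t) (wave k \<phi>) (c * b) \<le>
        (\<Sum>\<eta>\<in>configs n. law n (Q n) t \<eta> * (d + (?E \<eta> - c * b)\<^sup>2 / d))"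
      unfolding mean_dev_def using ql by (intro sum_mono mult_left_mono) (auto simp: pvec_def)
    also have "\<dots> = (\<Sum>\<eta>\<in>configs n. law n (Q n) t \<eta>) * d + (\<Sum>\<eta>\<in>configs n. law n (Q n) t \<eta> * (?E \<eta> - c * b)\<^sup>2) / d"
      by (simp only: distrib_left sum.distrib sum_distrib_right sum_divide_distrib times_divide_eq_right)
    also have "\<dots> \<le> R n"
      using ql divide_right_mono[OF msq less_imp_le[OF d]] by (simp add: pvec_def R_def)
    finally show ?case
      using elim mean_dev_nonneg[OF ql] by (simp add: c_def)
  qed
qed

lemma mean_dev_cmult: "mean_dev n q (\<lambda>\<theta>. c * G \<theta>) (c * b) = \<bar>c\<bar> * mean_dev n q G b"
  by (simp add: mean_dev_def empirical_mean_cmult sum_distrib_left abs_mult mult.left_commute flip: right_diff_distrib)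

lemma mean_dev_add_le:
  assumes "pvec n q"
  shows "mean_dev n q (\<lambda>\<theta>. F \<theta> + G \<theta>) (a + b) \<le> mean_dev n q F a + mean_dev n q G b"
  unfolding mean_dev_def sum.distrib[symmetric] distrib_left[symmetric]
  using assms by (intro sum_mono mult_left_mono) (auto simp: pvec_def empirical_mean_add)

text \<open>Trigonometric polynomials approximate the test function uniformly. For \<open>f\<close>
  only some bound \<open>B\<close> is at hand: that the heat solution takes values in [0, 1] is
  deduced later from this law of large numbers.\<close>

lemma mean_dev_tendsto_continuous:
  assumes Q: "\<And>n. 1 \<le> n \<Longrightarrow> pvec n (Q n)" and f: "continuous_on UNIV f" "torus_periodic f"
    and wave: "\<And>k \<phi>. (\<lambda>n. mean_dev n (Q n) (wave k \<phi>) (torus_integral (\<lambda>\<theta>. wave k \<phi> \<theta> * f \<theta>))) \<longlonglongrightarrow> 0"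
    and G: "continuous_on UNIV G" "torus_periodic G"
  shows "(\<lambda>n. mean_dev n (Q n) G (torus_integral (\<lambda>\<theta>. G \<theta> * f \<theta>))) \<longlonglongrightarrow> 0"
proof -
  have cf: "continuous_on A f" for A using continuous_on_subset[OF f(1)] by auto
  have cG: "continuous_on A G" for A using continuous_on_subset[OF G(1)] by auto
  have trig: "(\<lambda>n. mean_dev n (Q n) p (torus_integral (\<lambda>\<theta>. p \<theta> * f \<theta>))) \<longlonglongrightarrow> 0" if "trig_poly p" for p
    using that
  proof induction
    case (wave c k \<phi>)
    have "(\<lambda>n. \<bar>c\<bar> * mean_dev n (Q n) (wave k \<phi>) (torus_integral (\<lambda>\<theta>. wave k \<phi> \<theta> * f \<theta>))) \<longlonglongrightarrow> \<bar>c\<bar> * 0"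
      by (intro tendsto_mult_left assms(4))
    then show ?case
      by (simp add: mult.assoc torus_integral_cmult mean_dev_cmult)
  next
    case (add p q)
    have "torus_integral (\<lambda>\<theta>. (p \<theta> + q \<theta>) * f \<theta>) = torus_integral (\<lambda>\<theta>. p \<theta> * f \<theta>) + torus_integral (\<lambda>\<theta>. q \<theta> * f \<theta>)"
      unfolding distrib_right
      by (intro torus_integral_add torus_integrable_continuous continuous_intros trig_poly_continuous add cf)
    note eq = this
    have "\<forall>\<^sub>F n in sequentially. norm (mean_dev n (Q n) (\<lambda>\<theta>. p \<theta> + q \<theta>) (torus_integral (\<lambda>\<theta>. (p \<theta> + q \<theta>) * f \<theta>))) \<le>
        mean_dev n (Q n) p (torus_integral (\<lambda>\<theta>. p \<theta> * f \<theta>)) + mean_dev n (Q n) q (torus_integral (\<lambda>\<theta>. q \<theta> * f \<theta>))"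
      using eventually_ge_at_top[of 1]
    proof eventually_elim
      case (elim n)
      then show ?case
        unfolding eq using mean_dev_add_le[OF Q[OF elim]] mean_dev_nonneg[OF Q[OF elim]] by simp
    qed
    moreover have "(\<lambda>n. mean_dev n (Q n) p (torus_integral (\<lambda>\<theta>. p \<theta> * f \<theta>)) + mean_dev n (Q n) q (torus_integral (\<lambda>\<theta>. q \<theta> * f \<theta>))) \<longlonglongrightarrow> 0"
      using tendsto_add[OF add.IH] by simp
    ultimately show ?case by (rule Lim_null_comparison)
  qed
  obtain B where B: "\<And>\<theta>. \<bar>f \<theta>\<bar> \<le> B"
    using torus_periodic_bounded[OF f(2,1)] by blast
  have B0: "0 \<le> B" using B[of 0] by linarith
  show ?thesis
  proof (rule tendstoI)
    fix e :: real assume e: "0 < e"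
    \<comment> \<open>Replacing \<open>G\<close> by \<open>p\<close> costs \<open>d\<close> in the
      empirical mean and \<open>d * B\<close> in the integral, together
      \<open>e / 2\<close>.\<close>
    define d where "d = e / (2 * (1 + B))"
    have d: "0 < d" "d * (1 + B) = e / 2" using e B0 by (auto simp: d_def field_simps)
    obtain p where p: "trig_poly p" "\<And>\<theta>. 0 \<le> \<theta> \<Longrightarrow> \<theta> < 1 \<Longrightarrow> \<bar>G \<theta> - p \<theta>\<bar> < d"
      using trig_poly_approximation[OF G(2,1) d(1)] by blast
    have cp: "continuous_on A p" for A by (rule trig_poly_continuous[OF p(1)])
    let ?I = "\<lambda>g. torus_integral (\<lambda>\<theta>. g \<theta> * f \<theta>)"
    have "\<bar>?I G - ?I p\<bar> \<le> d * B"
    proof -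
      have "?I G - ?I p = torus_integral (\<lambda>\<theta>. G \<theta> * f \<theta> - p \<theta> * f \<theta>)"
        by (intro torus_integral_diff[symmetric] torus_integrable_continuous continuous_intros cp cG cf)
      also have "\<bar>\<dots>\<bar> \<le> torus_integral (\<lambda>_. d * B)"
      proof (rule torus_integral_abs_le)
        fix \<theta> :: real assume "0 \<le> \<theta>" "\<theta> < 1"
        then have "\<bar>G \<theta> - p \<theta>\<bar> * \<bar>f \<theta>\<bar> \<le> d * B"
          using p(2) B d by (intro mult_mono) (auto intro: less_imp_le)
        then show "\<bar>G \<theta> * f \<theta> - p \<theta> * f \<theta>\<bar> \<le> d * B"
          by (simp add: abs_mult flip: left_diff_distrib)
      qed (intro torus_integrable_continuous continuous_intros cp cG cf)+
      finally show ?thesis by simp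
    qed
    have le: "mean_dev n (Q n) G (?I G) \<le> mean_dev n (Q n) p (?I p) + e / 2" if n: "1 \<le> n" for n
    proof -
      have "\<bar>empirical_mean n \<eta> G - ?I G\<bar> \<le> \<bar>empirical_mean n \<eta> p - ?I p\<bar> + e / 2" if \<eta>: "\<eta> \<in> configs n" for \<eta>
      proof -
        have "\<bar>empirical_mean n \<eta> (\<lambda>\<theta>. G \<theta> - p \<theta>)\<bar> \<le> d"
          using p(2) by (intro abs_empirical_mean_le \<eta> n) (auto intro: less_imp_le)
        then have "\<bar>empirical_mean n \<eta> G - empirical_mean n \<eta> p\<bar> \<le> d"
          by (simp add: empirical_mean_diff)
        moreover have "d + d * B = e / 2" using d(2) by (simp add: distrib_left)
        ultimately show ?thesis using \<open>\<bar>?I G - ?I p\<bar> \<le> d * B\<close> by linarith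
      qed
      then have "mean_dev n (Q n) G (?I G) \<le> (\<Sum>\<eta>\<in>configs n. Q n \<eta> * (\<bar>empirical_mean n \<eta> p - ?I p\<bar> + e / 2))"
        unfolding mean_dev_def using Q[OF n] by (intro sum_mono mult_left_mono) (auto simp: pvec_def)
      also have "\<dots> = mean_dev n (Q n) p (?I p) + (\<Sum>\<eta>\<in>configs n. Q n \<eta>) * (e / 2)"
        by (simp only: distrib_left sum.distrib mean_dev_def sum_distrib_right)
      finally show ?thesis using Q[OF n] by (simp add: pvec_def)
    qed
    have "\<forall>\<^sub>F n in sequentially. mean_dev n (Q n) p (?I p) < e / 2"
      using order_tendstoD(2)[OF trig[OF p(1)], of "e / 2"] e by simp
    then show "\<forall>\<^sub>F n in sequentially. dist (mean_dev n (Q n) G (?I G)) 0 < e"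
      using eventually_ge_at_top[of 1]
    proof eventually_elim
      case (elim n)
      then show ?case using le[of n] mean_dev_nonneg[OF Q, of n G "?I G"] by simp
    qed
  qed
qed

lemma expectation_tendsto:
  assumes Q: "\<And>n. 1 \<le> n \<Longrightarrow> pvec n (Q n)" and lim: "(\<lambda>n. mean_dev n (Q n) G b) \<longlonglongrightarrow> 0"
  shows "(\<lambda>n. \<Sum>\<eta>\<in>configs n. Q n \<eta> * empirical_mean n \<eta> G) \<longlonglongrightarrow> b"
proof -
  have "\<forall>\<^sub>F n in sequentially. norm ((\<Sum>\<eta>\<in>configs n. Q n \<eta> * empirical_mean n \<eta> G) - b) \<le> mean_dev n (Q n) G b"
    using eventually_ge_at_top[of 1]
  proof eventually_elim
    case (elim n)
    have "b = (\<Sum>\<eta>\<in>configs n. Q n \<eta> * b)"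
      using Q[OF elim] by (simp add: pvec_def flip: sum_distrib_right)
    then have "(\<Sum>\<eta>\<in>configs n. Q n \<eta> * empirical_mean n \<eta> G) - b = (\<Sum>\<eta>\<in>configs n. Q n \<eta> * (empirical_mean n \<eta> G - b))"
      by (simp add: right_diff_distrib sum_subtractf)
    also have "norm \<dots> \<le> (\<Sum>\<eta>\<in>configs n. norm (Q n \<eta> * (empirical_mean n \<eta> G - b)))"
      by (rule norm_sum)
    also have "\<dots> = mean_dev n (Q n) G b"
      unfolding mean_dev_def using Q[OF elim] by (intro sum.cong) (auto simp: pvec_def abs_mult)
    finally show ?case .
  qed
  from Lim_null_comparison[OF this lim] show ?thesis by (simp add: LIM_zero_iff)
qed

text \<open>The initial assumption is applied to waves, which are smooth; the conclusion covers all
  continuous test functions, in particular those built from \<open>m t\<close> itself.\<close>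

lemma heat_lln:
  assumes m0: "density_profile m0" and heat: "heat_solution m0 m"
    and Q: "\<And>n. 1 \<le> n \<Longrightarrow> pvec n (Q n)"
    and init: "\<And>G \<delta>. torus_smooth G \<Longrightarrow> 0 < \<delta> \<Longrightarrow>
      (\<lambda>n. tail_prob n (Q n) G (torus_integral (\<lambda>\<theta>. G \<theta> * m0 \<theta>)) \<delta>) \<longlonglongrightarrow> 0"
    and t: "0 < t" and G: "continuous_on UNIV G" "torus_periodic G"
  shows "(\<lambda>n. mean_dev n (law n (Q n) t) G (torus_integral (\<lambda>\<theta>. G \<theta> * m t \<theta>))) \<longlonglongrightarrow> 0"
proof (rule mean_dev_tendsto_continuous[OF _ _ _ _ G])
  show "continuous_on UNIV (m t)" "torus_periodic (m t)"
    using heat_solution_continuous[OF heat t] by auto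
  show "pvec n (law n (Q n) t)" if "1 \<le> n" for n
    using Q[OF that] t by (intro pvec_law) auto
  fix k \<phi>
  have "\<bar>torus_integral (\<lambda>\<theta>. wave k \<phi> \<theta> * m0 \<theta>)\<bar> \<le> torus_integral (\<lambda>_. 1)"
  proof (rule torus_integral_abs_le)
    show "set_integrable lborel {0..<1} (\<lambda>\<theta>. wave k \<phi> \<theta> * m0 \<theta>)"
      by (rule density_profile_integrable[OF m0 abs_wave_le_1])
         (intro borel_measurable_continuous_onI continuous_wave)
    show "\<bar>wave k \<phi> \<theta> * m0 \<theta>\<bar> \<le> 1" for \<theta>
      using m0 abs_wave_le_1[of k \<phi> \<theta>] by (auto simp: abs_mult density_profile_def intro: mult_le_one)
  qed (rule torus_integrable_continuous, intro continuous_intros)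
  then show "(\<lambda>n. mean_dev n (law n (Q n) t) (wave k \<phi>) (torus_integral (\<lambda>\<theta>. wave k \<phi> \<theta> * m t \<theta>))) \<longlonglongrightarrow> 0"
    unfolding heat_wave_evolution[OF heat m0 t]
    using t by (intro wave_mean_dev_tendsto Q init wave_smooth) auto
qed

lemma torus_continuous_nonpos:
  assumes f: "continuous_on UNIV f" "torus_periodic f" and le: "torus_integral (\<lambda>\<theta>. (max 0 (f \<theta>))\<^sup>2) \<le> 0"
  shows "f \<theta> \<le> 0"
proof -
  have c: "continuous_on {0..1} (\<lambda>\<theta>. (max 0 (f \<theta>))\<^sup>2)"
    using continuous_on_subset[OF f(1)] by (intro continuous_intros) auto
  have "integral {0..1} (\<lambda>\<theta>. (max 0 (f \<theta>))\<^sup>2) = 0"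
    using le torus_integral_eq_integral[OF c] integral_nonneg[OF integrable_continuous_interval[OF c]] by auto
  then have z: "(max 0 (f x))\<^sup>2 = 0" if "x \<in> {0..1}" for x
    using integral_eq_0_iff[of 0 1 "\<lambda>\<theta>. (max 0 (f \<theta>))\<^sup>2"] c that by auto
  have "frac \<theta> \<in> {0..1}"
    using frac_lt_1[of \<theta>] frac_ge_0[of \<theta>] by (simp del: frac_ge_0)
  from z[OF this] have "f (frac \<theta>) \<le> 0" by (simp add: max_def split: if_splits)
  then show ?thesis
    using torus_periodic_int[OF f(2), of "frac \<theta>" "\<lfloor>\<theta>\<rfloor>"] by (simp add: frac_def)
qed

text \<open>Limits of empirical densities lie between 0 and 1 because occupation variables do. The
  test function is the part of \<open>f\<close> that violates the bound: the law of large numbers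
  then forces its square to have integral at most 0.\<close>

lemma lln_density_bounds:
  assumes Q: "\<And>n. 1 \<le> n \<Longrightarrow> pvec n (Q n)" and f: "continuous_on UNIV f" "torus_periodic f"
    and lln: "\<And>G. continuous_on UNIV G \<Longrightarrow> torus_periodic G \<Longrightarrow>
       (\<lambda>n. mean_dev n (Q n) G (torus_integral (\<lambda>\<theta>. G \<theta> * f \<theta>))) \<longlonglongrightarrow> 0"
  shows "0 \<le> f \<theta>" "f \<theta> \<le> 1"
proof -
  have cf: "continuous_on A f" for A using continuous_on_subset[OF f(1)] by auto
  have "- f \<theta> \<le> 0"
  proof (rule torus_continuous_nonpos[where f = "\<lambda>\<theta>. - f \<theta>"])
    let ?G = "\<lambda>\<theta>. max 0 (- f \<theta>)"
    have "0 \<le> torus_integral (\<lambda>\<theta>. ?G \<theta> * f \<theta>)"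
    proof (rule LIMSEQ_le_const[OF expectation_tendsto[OF Q lln]])
      show "\<exists>N. \<forall>n\<ge>N. 0 \<le> (\<Sum>\<eta>\<in>configs n. Q n \<eta> * empirical_mean n \<eta> ?G)"
        using Q by (intro exI[of _ 1] allI impI sum_nonneg mult_nonneg_nonneg)
          (auto simp: pvec_def empirical_mean_def intro!: divide_nonneg_nonneg sum_nonneg)
    qed (use f in \<open>auto simp: torus_periodic_def intro!: continuous_intros\<close>)
    also have "(\<lambda>\<theta>. ?G \<theta> * f \<theta>) = (\<lambda>\<theta>. (-1) * (?G \<theta>)\<^sup>2)"
      by (auto simp: max_def power2_eq_square)
    finally show "torus_integral (\<lambda>\<theta>. (?G \<theta>)\<^sup>2) \<le> 0"
      unfolding torus_integral_cmult by simp
  qed (use f in \<open>auto simp: torus_periodic_def intro!: continuous_intros\<close>)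
  then show "0 \<le> f \<theta>" by simp
  have "f \<theta> - 1 \<le> 0"
  proof (rule torus_continuous_nonpos[where f = "\<lambda>\<theta>. f \<theta> - 1"])
    let ?G = "\<lambda>\<theta>. max 0 (f \<theta> - 1)"
    have cG: "continuous_on A ?G" for A by (intro continuous_intros cf)
    have "torus_integral (\<lambda>\<theta>. ?G \<theta> * f \<theta>) \<le> torus_integral ?G"
    proof (rule LIMSEQ_le[OF expectation_tendsto[OF Q lln] riemann_sum_tendsto])
      show "\<exists>N. \<forall>n\<ge>N. (\<Sum>\<eta>\<in>configs n. Q n \<eta> * empirical_mean n \<eta> ?G) \<le> 1 / real n * (\<Sum>i<n. ?G (real i / real n))"
      proof (intro exI[of _ 1] allI impI expectation_mono)
        fix n \<eta> assume "1 \<le> n" "\<eta> \<in> configs n"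
        then show "empirical_mean n \<eta> ?G \<le> 1 / real n * (\<Sum>i<n. ?G (real i / real n))"
          unfolding empirical_mean_def using config_values[of \<eta> n]
          by (intro mult_left_mono sum_mono) fastforce+
      qed (use Q in auto)
    qed (use f in \<open>auto simp: torus_periodic_def intro!: continuous_intros\<close>)
    moreover have "(\<lambda>\<theta>. ?G \<theta> * f \<theta>) = (\<lambda>\<theta>. ?G \<theta> + (?G \<theta>)\<^sup>2)"
      by (auto simp: max_def power2_eq_square algebra_simps)
    moreover have "torus_integral (\<lambda>\<theta>. ?G \<theta> + (?G \<theta>)\<^sup>2) = torus_integral ?G + torus_integral (\<lambda>\<theta>. (?G \<theta>)\<^sup>2)"
      by (intro torus_integral_add torus_integrable_continuous continuous_intros cG)
    ultimately show "torus_integral (\<lambda>\<theta>. (?G \<theta>)\<^sup>2) \<le> 0" by simp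
  qed (use f in \<open>auto simp: torus_periodic_def intro!: continuous_intros\<close>)
  then show "f \<theta> \<le> 1" by simp
qed

section \<open>Convergence of the entropy\<close>

lemma integral_finite_valued:
  assumes "prob_space M" "finite S" "Y \<in> M \<rightarrow>\<^sub>M count_space S"
  shows "(LINT \<omega>|M. g (Y \<omega>)) = (\<Sum>x\<in>S. measure M (Y -` {x} \<inter> space M) * (g x :: real))"
proof -
  interpret prob_space M by fact
  have "(LINT \<omega>|M. g (Y \<omega>)) = (LINT \<omega>|M. (\<Sum>x\<in>S. indicator (Y -` {x} \<inter> space M) \<omega> * g x))"
  proof (rule Bochner_Integration.integral_cong[OF refl])
    fix \<omega> assume \<omega>: "\<omega> \<in> space M"
    then have "Y \<omega> \<in> S" using measurable_space[OF assms(3)] by simp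
    moreover have "(\<Sum>x\<in>S. indicator (Y -` {x} \<inter> space M) \<omega> * g x) = (\<Sum>x\<in>S. if x = Y \<omega> then g x else 0)"
      using \<omega> by (intro sum.cong) (auto simp: indicator_def)
    ultimately show "g (Y \<omega>) = (\<Sum>x\<in>S. indicator (Y -` {x} \<inter> space M) \<omega> * g x)"
      using assms(2) by simp
  qed
  also have "\<dots> = (\<Sum>x\<in>S. measure M (Y -` {x} \<inter> space M) * g x)"
  proof (subst Bochner_Integration.integral_sum)
    fix x assume "x \<in> S"
    then have "Y -` {x} \<inter> space M \<in> sets M"
      by (intro measurable_sets[OF assms(3)]) auto
    then show "integrable M (\<lambda>\<omega>. indicator (Y -` {x} \<inter> space M) \<omega> * g x)"
      by (intro integrable_mult_left integrable_real_indicator) (auto simp: emeasure_eq_measure)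
  qed (auto intro!: sum.cong simp: Int_absorb2)
  finally show ?thesis .
qed

text \<open>Conditioning on time 0: the conditional expectation has the same integral as
  \<open>f (X t \<omega>)\<close>, and by the Markov property it is a function of the initial
  state.\<close>

lemma markov_process_expectation:
  assumes mp: "markov_process S L \<mu> M X" and S: "finite S" and t: "0 \<le> t"
  shows "(LINT \<omega>|M. f (X t \<omega>)) = (\<Sum>x\<in>S. measure \<mu> {x} * markov_semigroup L t f x)"
proof -
  have ps: "prob_space M" and X: "\<And>t. 0 \<le> t \<Longrightarrow> X t \<in> M \<rightarrow>\<^sub>M count_space S"
    and X0: "distr M (count_space S) (X 0) = \<mu>"
    and cond: "AE \<omega> in M. real_cond_exp M (past S M X 0) (\<lambda>\<omega>. f (X t \<omega>)) \<omega> = markov_semigroup L (t - 0) f (X 0 \<omega>)"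
    using mp t unfolding markov_process_def by auto
  interpret prob_space M by fact
  have meas: "(\<lambda>\<omega>. g (X u \<omega>)) \<in> borel_measurable M" if "0 \<le> u" for g :: "_ \<Rightarrow> real" and u
    by (rule measurable_compose[OF X[OF that]]) simp
  have "subalgebra M (past S M X 0)"
    unfolding subalgebra_def past_def
  proof (intro conjI)
    have sub: "{X u -` A \<inter> space M |u A. 0 \<le> u \<and> u \<le> 0 \<and> A \<subseteq> S} \<subseteq> sets M"
      using measurable_sets[OF X] by auto
    then have pow: "{X u -` A \<inter> space M |u A. 0 \<le> u \<and> u \<le> 0 \<and> A \<subseteq> S} \<subseteq> Pow (space M)"
      by auto
    show "space (sigma (space M) {X u -` A \<inter> space M |u A. 0 \<le> u \<and> u \<le> 0 \<and> A \<subseteq> S}) = space M"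
      using pow by simp
    show "sets (sigma (space M) {X u -` A \<inter> space M |u A. 0 \<le> u \<and> u \<le> 0 \<and> A \<subseteq> S}) \<subseteq> sets M"
      using pow sub by (simp add: sets.sigma_sets_subset)
  qed
  then interpret finite_measure_subalgebra M "past S M X 0"
    by unfold_locales
  have int: "integrable M (\<lambda>\<omega>. f (X t \<omega>))"
  proof (rule integrable_const_bound[where B = "\<Sum>x\<in>S. \<bar>f x\<bar>"])
    have "\<bar>f (X t \<omega>)\<bar> \<le> (\<Sum>x\<in>S. \<bar>f x\<bar>)" if "\<omega> \<in> space M" for \<omega>
      using measurable_space[OF X[OF t] that] S by (intro member_le_sum[of _ S "\<lambda>x. \<bar>f x\<bar>"]) auto
    then show "AE \<omega> in M. norm (f (X t \<omega>)) \<le> (\<Sum>x\<in>S. \<bar>f x\<bar>)" by auto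
  qed (rule meas[OF t])
  have "(LINT \<omega>|M. f (X t \<omega>)) = (LINT \<omega>|M. real_cond_exp M (past S M X 0) (\<lambda>\<omega>. f (X t \<omega>)) \<omega>)"
    by (rule real_cond_exp_int(2)[OF int, symmetric])
  also have "\<dots> = (LINT \<omega>|M. markov_semigroup L t f (X 0 \<omega>))"
    using cond by (intro integral_cong_AE meas) auto
  also have "\<dots> = (\<Sum>x\<in>S. measure M (X 0 -` {x} \<inter> space M) * markov_semigroup L t f x)"
    by (rule integral_finite_valued[OF ps S X]) simp
  also have "\<dots> = (\<Sum>x\<in>S. measure \<mu> {x} * markov_semigroup L t f x)"
    unfolding X0[symmetric] by (intro sum.cong refl) (auto simp: measure_distr X)
  finally show ?thesis .
qed

lemma markov_process_law:
  assumes mp: "markov_process (configs n) (ssep_generator n) \<mu> M X" and t: "0 \<le> t" and \<eta>: "\<eta> \<in> configs n"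
  shows "measure M (X t -` {\<eta>} \<inter> space M) = law n (\<lambda>x. measure \<mu> {x}) t \<eta>"
proof -
  have "prob_space M" "X t \<in> M \<rightarrow>\<^sub>M count_space (configs n)"
    using mp t by (auto simp: markov_process_def)
  from integral_finite_valued[OF this(1) finite_configs this(2), of "\<lambda>\<xi>. of_bool (\<xi> = \<eta>)"]
  have "(LINT \<omega>|M. of_bool (X t \<omega> = \<eta>)) = measure M (X t -` {\<eta>} \<inter> space M)"
    using \<eta> by (simp add: of_bool_def if_distrib[of "(*) _"] cong: if_cong)
  with markov_process_expectation[OF mp finite_configs t, of "\<lambda>\<xi>. of_bool (\<xi> = \<eta>)"]
  show ?thesis by (simp add: law_def)
qed

lemma markov_process_tail:
  assumes mp: "markov_process (configs n) (ssep_generator n) \<mu> M X" and t: "0 \<le> t"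
  shows "measure M {\<omega> \<in> space M. \<bar>empirical_mean n (X t \<omega>) G - b\<bar> > \<delta>} =
     tail_prob n (law n (\<lambda>x. measure \<mu> {x}) t) G b \<delta>"
proof -
  let ?A = "{\<eta> \<in> configs n. \<bar>empirical_mean n \<eta> G - b\<bar> > \<delta>}"
  have ps: "prob_space M" and X: "X t \<in> M \<rightarrow>\<^sub>M count_space (configs n)"
    using mp t by (auto simp: markov_process_def)
  interpret prob_space M by fact
  have "{\<omega> \<in> space M. \<bar>empirical_mean n (X t \<omega>) G - b\<bar> > \<delta>} = (\<Union>\<eta>\<in>?A. X t -` {\<eta>} \<inter> space M)"
    using measurable_space[OF X] by auto
  also have "measure M \<dots> = (\<Sum>\<eta>\<in>?A. measure M (X t -` {\<eta>} \<inter> space M))"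
    by (rule finite_measure_finite_Union) (auto simp: disjoint_family_on_def intro!: measurable_sets[OF X])
  also have "\<dots> = tail_prob n (law n (\<lambda>x. measure \<mu> {x}) t) G b \<delta>"
    unfolding tail_prob_def by (intro sum.cong refl markov_process_law[OF mp t]) auto
  finally show ?thesis .
qed

text \<open>Every Bernoulli mass is positive, so the density times the reference mass gives back the
  mass. The default value \<open>undefined\<close> of the product law agrees with the extensionality
  built into \<open>configs n\<close>.\<close>

lemma relative_entropy_eq_ent:
  assumes "0 < \<alpha>" "\<alpha> < 1"
  shows "relative_entropy (configs n) (bernoulli_product n \<alpha>) \<mu> = ent n (\<lambda>\<eta>. measure \<mu> {\<eta>}) (bern n (\<lambda>_. \<alpha>))"
proof -
  have "measure (bernoulli_product n \<alpha>) {\<eta>} = bern n (\<lambda>_. \<alpha>) \<eta>" if \<eta>: "\<eta> \<in> configs n" for \<eta>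
  proof -
    have *: "pmf (map_pmf of_bool (bernoulli_pmf \<alpha>)) (of_bool b :: nat) = pmf (bernoulli_pmf \<alpha>) b" for b
      by (rule pmf_map_inj') (auto simp: inj_def)
    have "pmf (map_pmf of_bool (bernoulli_pmf \<alpha>)) (\<eta> i) = (if \<eta> i = 1 then \<alpha> else 1 - \<alpha>)" if "i < n" for i
      using config_values[OF \<eta> that] *[of True] *[of False] assms by auto
    moreover have "\<eta> i = undefined" if "i \<notin> {..<n}" for i
      using \<eta> that by (auto simp: configs_def PiE_def extensional_def)
    ultimately show ?thesis
      unfolding bernoulli_product_def measure_pmf_single bern_def
      by (subst pmf_Pi') (auto intro!: prod.cong)
  qed
  moreover have "bern n (\<lambda>_. \<alpha>) \<eta> \<noteq> 0" for \<eta>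
    using bern_pos[of n "\<lambda>_. \<alpha>" \<eta>] assms by auto
  ultimately show ?thesis
    by (auto simp: relative_entropy_def ent_def Let_def intro!: sum.cong)
qed

text \<open>Logarithms of product masses are affine in the configuration, so changing the reference
  measure alters the entropy by the expectation of a linear functional of the empirical measure plus
  a constant.\<close>

lemma ent_change_reference:
  assumes q: "pvec n q" and \<rho>: "\<And>i. i < n \<Longrightarrow> 0 < \<rho> i \<and> \<rho> i < 1" and \<alpha>: "0 < \<alpha>" "\<alpha> < 1"
  shows "ent n q (bern n (\<lambda>_. \<alpha>)) = ent n q (bern n \<rho>) +
    ((\<Sum>\<eta>\<in>configs n. q \<eta> * (\<Sum>i<n. (ln (\<rho> i / \<alpha>) - ln ((1 - \<rho> i) / (1 - \<alpha>))) * real (\<eta> i))) +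
     (\<Sum>i<n. ln ((1 - \<rho> i) / (1 - \<alpha>))))"
proof -
  let ?D = "\<lambda>\<eta>. (\<Sum>i<n. (ln (\<rho> i / \<alpha>) - ln ((1 - \<rho> i) / (1 - \<alpha>))) * real (\<eta> i))"
  let ?K = "\<Sum>i<n. ln ((1 - \<rho> i) / (1 - \<alpha>))"
  have "q \<eta> * ln (q \<eta> / bern n (\<lambda>_. \<alpha>) \<eta>) = q \<eta> * ln (q \<eta> / bern n \<rho> \<eta>) + (q \<eta> * ?D \<eta> + q \<eta> * ?K)"
    if \<eta>: "\<eta> \<in> configs n" for \<eta>
  proof (cases "q \<eta> = 0")
    case False
    then have qp: "0 < q \<eta>" using q \<eta> by (auto simp: pvec_def less_le)
    have pos: "0 < bern n \<rho> \<eta>" "0 < bern n (\<lambda>_. \<alpha>) \<eta>"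
      using \<rho> \<alpha> by (auto intro!: bern_pos)
    have "ln (bern n \<rho> \<eta>) - ln (bern n (\<lambda>_. \<alpha>) \<eta>) = ?D \<eta> + ?K"
    proof -
      have nz: "\<rho> i \<noteq> 0" "\<rho> i \<noteq> 1" if "i < n" for i
        using \<rho>[OF that] by auto
      have "ln (bern n \<rho> \<eta>) = (\<Sum>i<n. ln (if \<eta> i = 1 then \<rho> i else 1 - \<rho> i))"
        unfolding bern_def using nz by (intro ln_prod) auto
      moreover have "ln (bern n (\<lambda>_. \<alpha>) \<eta>) = (\<Sum>i<n. ln (if \<eta> i = 1 then \<alpha> else 1 - \<alpha>))"
        unfolding bern_def using \<alpha> by (intro ln_prod) auto
      moreover have "ln (if \<eta> i = 1 then \<rho> i else 1 - \<rho> i) - ln (if \<eta> i = 1 then \<alpha> else 1 - \<alpha>) =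
         (ln (\<rho> i / \<alpha>) - ln ((1 - \<rho> i) / (1 - \<alpha>))) * real (\<eta> i) + ln ((1 - \<rho> i) / (1 - \<alpha>))" if "i < n" for i
        using config_values[OF \<eta> that] \<rho>[OF that] \<alpha> by (auto simp: ln_div)
      ultimately show ?thesis
        by (simp add: sum.distrib flip: sum_subtractf)
    qed
    moreover have "ln (q \<eta> / bern n (\<lambda>_. \<alpha>) \<eta>) = ln (q \<eta> / bern n \<rho> \<eta>) + (ln (bern n \<rho> \<eta>) - ln (bern n (\<lambda>_. \<alpha>) \<eta>))"
      using qp pos by (simp add: ln_div)
    ultimately show ?thesis by (simp add: distrib_left)
  qed simp
  then have "ent n q (bern n (\<lambda>_. \<alpha>)) = (\<Sum>\<eta>\<in>configs n. q \<eta> * ln (q \<eta> / bern n \<rho> \<eta>) + (q \<eta> * ?D \<eta> + q \<eta> * ?K))"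
    unfolding ent_def by (rule sum.cong[OF refl])
  also have "\<dots> = ent n q (bern n \<rho>) + ((\<Sum>\<eta>\<in>configs n. q \<eta> * ?D \<eta>) + (\<Sum>\<eta>\<in>configs n. q \<eta>) * ?K)"
    by (simp only: sum.distrib ent_def sum_distrib_right)
  finally show ?thesis using q by (simp add: pvec_def)
qed

text \<open>The constant profile \<alpha> is stationary and has no gradient, so
  \<open>ent_growth\<close> applies with \<open>K = r = 0\<close> and all error terms
  vanish.\<close>

lemma ent_law_antimono:
  assumes n: "2 \<le> n" and q: "pvec n q" and t: "0 \<le> t" and \<alpha>: "0 < \<alpha>" "\<alpha> < 1"
  shows "ent n (law n q t) (bern n (\<lambda>_. \<alpha>)) \<le> ent n q (bern n (\<lambda>_. \<alpha>))"
proof -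
  have "ent n (law n q t) (bern n (\<lambda>_. \<alpha>)) \<le> ent n (law n q 0) (bern n (\<lambda>_. \<alpha>)) +
      0\<^sup>2 / (\<alpha> * (1 - \<alpha>))\<^sup>2 + (t - 0) * (real n * 0 / (\<alpha> * (1 - \<alpha>)) + 0\<^sup>2 / (\<alpha> * (1 - \<alpha>))\<^sup>2 * (1 + 0\<^sup>2))"
    by (rule ent_growth[where \<rho>' = "\<lambda>_ _. 0"]) (use n q t \<alpha> in \<open>auto simp: pvec_def\<close>)
  also have "ent n (law n q 0) (bern n (\<lambda>_. \<alpha>)) = ent n q (bern n (\<lambda>_. \<alpha>))"
    unfolding ent_def by (intro sum.cong refl) (simp add: law_0)
  finally show ?thesis by simp
qed

text \<open>Affine, so that \<open>mix \<epsilon>\<close> composed with a solution of the heat equation is again one.\<close>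

definition mix :: "real \<Rightarrow> real \<Rightarrow> real" where
  "mix \<epsilon> x = (1 - \<epsilon>) * x + \<epsilon> / 2"

text \<open>Minus the cross entropy between the Bernoulli laws with parameters \<open>x\<close> and
  \<open>mix \<epsilon> x\<close>; it has the sign of \<open>h\<close>, to which it reduces at
  \<open>\<epsilon> = 0\<close>.\<close>

definition cross_entropy :: "real \<Rightarrow> real \<Rightarrow> real" where
  "cross_entropy \<epsilon> x = x * ln (mix \<epsilon> x) + (1 - x) * ln (1 - mix \<epsilon> x)"

lemma mix_bounds:
  assumes "0 < \<epsilon>" "\<epsilon> < 1" "0 \<le> x" "x \<le> 1"
  shows "\<epsilon> / 2 \<le> mix \<epsilon> x" "mix \<epsilon> x \<le> 1 - \<epsilon> / 2"
proof -
  show "\<epsilon> / 2 \<le> mix \<epsilon> x" using assms by (simp add: mix_def)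
  have "(1 - \<epsilon>) * x \<le> (1 - \<epsilon>) * 1" using assms by (intro mult_left_mono) auto
  then show "mix \<epsilon> x \<le> 1 - \<epsilon> / 2" by (simp add: mix_def)
qed

text \<open>Uniform in \<open>x\<close> although \<open>ln x\<close> is unbounded:
  \<open>mix \<epsilon> x \<ge> (1 - \<epsilon>) * x\<close> gives the lower estimate, and
  \<open>ln z \<le> z - 1\<close> at \<open>z = mix \<epsilon> x / x\<close> the upper one, since
  \<open>\<epsilon> \<le> - ln (1 - \<epsilon>)\<close>.\<close>

lemma x_ln_mix_bound:
  assumes "0 < \<epsilon>" "\<epsilon> < 1" "0 \<le> x" "x \<le> 1"
  shows "\<bar>x * ln (mix \<epsilon> x) - x * ln x\<bar> \<le> - ln (1 - \<epsilon>)"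
proof (cases "x = 0")
  case True
  then show ?thesis using assms by simp
next
  case False
  then have x: "0 < x" using assms by simp
  have m: "0 < mix \<epsilon> x" using mix_bounds(1)[OF assms] assms by linarith
  have l0: "\<epsilon> \<le> - ln (1 - \<epsilon>)" using ln_le_minus_one[of "1 - \<epsilon>"] assms by simp
  have "ln (mix \<epsilon> x / x) \<le> mix \<epsilon> x / x - 1"
    using x m by (intro ln_le_minus_one) auto
  then have "x * ln (mix \<epsilon> x / x) \<le> x * (mix \<epsilon> x / x - 1)"
    using x by (intro mult_left_mono) auto
  also have "\<dots> = \<epsilon> / 2 - \<epsilon> * x" using x by (simp add: mix_def field_simps)
  also have "\<dots> \<le> \<epsilon>" using assms mult_nonneg_nonneg[of \<epsilon> x] by linarith
  finally have up: "x * ln (mix \<epsilon> x / x) \<le> - ln (1 - \<epsilon>)" using l0 by linarith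
  have "ln (1 - \<epsilon>) \<le> ln (mix \<epsilon> x / x)"
    using x m assms by (subst ln_le_cancel_iff) (auto simp: mix_def field_simps)
  then have "x * ln (1 - \<epsilon>) \<le> x * ln (mix \<epsilon> x / x)"
    using x by (intro mult_left_mono) auto
  moreover have "ln (1 - \<epsilon>) \<le> x * ln (1 - \<epsilon>)"
    using assms by (simp add: mult_le_cancel_right1)
  ultimately have "ln (1 - \<epsilon>) \<le> x * ln (mix \<epsilon> x / x)" by linarith
  moreover have "x * ln (mix \<epsilon> x) - x * ln x = x * ln (mix \<epsilon> x / x)"
    using x m by (simp add: ln_div right_diff_distrib)
  ultimately show ?thesis using up by (simp add: abs_le_iff)
qed

lemma cross_entropy_bound:
  assumes "0 < \<epsilon>" "\<epsilon> < 1" "0 \<le> x" "x \<le> 1"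
  shows "\<bar>cross_entropy \<epsilon> x - h x\<bar> \<le> - 2 * ln (1 - \<epsilon>)"
proof -
  have "1 - mix \<epsilon> x = mix \<epsilon> (1 - x)" by (simp add: mix_def field_simps)
  then show ?thesis
    using x_ln_mix_bound[OF assms] x_ln_mix_bound[of \<epsilon> "1 - x"] assms
    by (simp add: cross_entropy_def h_def abs_le_iff)
qed

section \<open>The entropy function: continuity, modulus and Gibbs' inequality\<close>

lemma continuous_on_h: "continuous_on {0..1} h"
proof -
  have "continuous_on {0..1} (\<lambda>x::real. (1 - x) * ln (1 - x))"
    by (rule continuous_on_compose2[OF continuous_on_x_ln_x, of _ "\<lambda>x. 1 - x"]) (auto intro!: continuous_intros)
  then show ?thesis
    unfolding h_def[abs_def] by (intro continuous_on_add continuous_on_subset[OF continuous_on_x_ln_x]) auto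
qed

lemma h_measurable: "h \<in> borel_measurable borel"
  unfolding h_def[abs_def] by measurable

lemma h_bounded:
  obtains B where "0 \<le> B" "\<And>x. 0 \<le> x \<Longrightarrow> x \<le> 1 \<Longrightarrow> \<bar>h x\<bar> \<le> B"
proof -
  have "bounded (h ` {0..1})"
    by (intro compact_imp_bounded compact_continuous_image continuous_on_h) auto
  then obtain B where "\<forall>y\<in>h ` {0..1}. norm y \<le> B" unfolding bounded_iff by blast
  then have B: "\<bar>h x\<bar> \<le> B" if "0 \<le> x" "x \<le> 1" for x using that by auto
  moreover have "0 \<le> B" using B[of 0] by linarith
  ultimately show ?thesis using that by blast
qed

lemma h_integrable:
  fixes f :: "real \<Rightarrow> real"
  assumes "f \<in> borel_measurable borel" "\<And>\<theta>. 0 \<le> f \<theta> \<and> f \<theta> \<le> 1"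
  shows "set_integrable lborel {0..<1} (\<lambda>\<theta>. h (f \<theta>))"
proof -
  obtain B where B: "\<And>x. 0 \<le> x \<Longrightarrow> x \<le> 1 \<Longrightarrow> \<bar>h x\<bar> \<le> B" using h_bounded by blast
  show ?thesis
    by (rule torus_integrable[where B = B]) (use assms B in \<open>auto intro: measurable_compose[OF _ h_measurable]\<close>)
qed

text \<open>Nearby points are covered by uniform continuity; at distance at least \<open>d\<close>
  the oscillation \<open>2 * B\<close> is at most \<open>2 * B / d * \<bar>x - y\<bar>\<close>. The
  linear form lets convergence in \<open>L\<^sup>1\<close> pass through \<open>h\<close>.\<close>

lemma h_modulus:
  assumes "0 < e"
  obtains C where "0 \<le> C" "\<And>x y. 0 \<le> x \<Longrightarrow> x \<le> 1 \<Longrightarrow> 0 \<le> y \<Longrightarrow> y \<le> 1 \<Longrightarrow> \<bar>h x - h y\<bar> \<le> e + C * \<bar>x - y\<bar>"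
proof -
  obtain B where B0: "0 \<le> B" and B: "\<And>x. 0 \<le> x \<Longrightarrow> x \<le> 1 \<Longrightarrow> \<bar>h x\<bar> \<le> B" using h_bounded by blast
  have "uniformly_continuous_on {0..1} h"
    by (intro compact_uniformly_continuous continuous_on_h) auto
  then obtain d where d: "0 < d" "\<And>x y. x \<in> {0..1} \<Longrightarrow> y \<in> {0..1} \<Longrightarrow> dist y x < d \<Longrightarrow> dist (h y) (h x) < e"
    unfolding uniformly_continuous_on_def using assms by metis
  show ?thesis
  proof (rule that[of "2 * B / d"])
    show "0 \<le> 2 * B / d" using B0 d by simp
    fix x y :: real assume xy: "0 \<le> x" "x \<le> 1" "0 \<le> y" "y \<le> 1"
    show "\<bar>h x - h y\<bar> \<le> e + 2 * B / d * \<bar>x - y\<bar>"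
    proof (cases "\<bar>x - y\<bar> < d")
      case True
      then have "\<bar>h x - h y\<bar> < e" using d(2)[of y x] xy by (simp add: dist_real_def)
      moreover have "0 \<le> 2 * B / d * \<bar>x - y\<bar>" using B0 d by simp
      ultimately show ?thesis by linarith
    next
      case False
      then have "2 * B / d * d \<le> 2 * B / d * \<bar>x - y\<bar>" using B0 d by (intro mult_left_mono) auto
      then have "2 * B \<le> 2 * B / d * \<bar>x - y\<bar>" using d by simp
      then show ?thesis using B[OF xy(1,2)] B[OF xy(3,4)] assms by linarith
    qed
  qed
qed

text \<open>Termwise \<open>y * ln a \<le> y * ln y + a - y\<close>; the corrections for the two
  outcomes cancel.\<close>

lemma gibbs_bernoulli:
  assumes "0 < \<alpha>" "\<alpha> < 1" "0 \<le> x" "x \<le> 1"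
  shows "x * ln \<alpha> + (1 - x) * ln (1 - \<alpha>) \<le> h x"
proof -
  have *: "y * ln a \<le> y * ln y + a - y" if "0 \<le> y" "0 < a" for y a :: real
  proof (cases "y = 0")
    case False
    then have y: "0 < y" using that by simp
    have "y * ln (a / y) \<le> y * (a / y - 1)"
      using y that by (intro mult_left_mono ln_le_minus_one) auto
    then show ?thesis using y that by (simp add: ln_div right_diff_distrib)
  qed (use that in simp)
  show ?thesis
    using *[of x \<alpha>] *[of "1 - x" "1 - \<alpha>"] assms by (simp add: h_def)
qed

text \<open>In the bound of \<open>ent_growth\<close> only \<open>n * r / c\<close> grows with
  \<open>n\<close>, and the discretization error \<open>r\<close> is arbitrarily small for large
  \<open>n\<close>; division by \<open>n\<close> makes the other error terms vanish in the
  limit.\<close>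

lemma ent_heat_growth:
  assumes heat: "heat_solution m0 m" and Q: "\<And>n. 1 \<le> n \<Longrightarrow> pvec n (Q n)"
    and m01: "\<And>u \<theta>. 0 < u \<Longrightarrow> 0 \<le> m u \<theta> \<and> m u \<theta> \<le> 1"
    and s: "0 < s" "s \<le> t" and \<epsilon>: "0 < \<epsilon>" "\<epsilon> < 1" and e: "0 < e"
  shows "\<forall>\<^sub>F n in sequentially.
    (1 / real n) * ent n (law n (Q n) t) (bern n (\<lambda>i. mix \<epsilon> (m t (real i / real n)))) \<le>
    (1 / real n) * ent n (law n (Q n) s) (bern n (\<lambda>i. mix \<epsilon> (m s (real i / real n)))) + e"
proof -
  obtain m_t K where
    dt: "\<And>u \<theta>. 0 < u \<Longrightarrow> ((\<lambda>u. m u \<theta>) has_real_derivative m_t u \<theta>) (at u)" and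
    grad: "\<And>u \<theta> n. s \<le> u \<Longrightarrow> u \<le> t \<Longrightarrow> 0 \<le> \<theta> \<Longrightarrow> \<theta> \<le> 1 \<Longrightarrow> 1 \<le> n \<Longrightarrow>
       \<bar>real n * (m u (\<theta> + 1 / real n) - m u \<theta>)\<bar> \<le> K" and
    lap: "\<And>e. 0 < e \<Longrightarrow> \<forall>\<^sub>F n in sequentially. \<forall>u\<in>{s..t}. \<forall>\<theta>\<in>{0..1}.
       \<bar>(real n)\<^sup>2 * (m u (\<theta> + 1 / real n) + m u (\<theta> - 1 / real n) - 2 * m u \<theta>) - m_t u \<theta>\<bar> \<le> e"
    by (rule heat_discretization[OF heat s(1), of t]) blast
  \<comment> \<open>The mixed profile lies in \<open>[a, 1 - a]\<close>, whence
    \<open>\<rho> * (1 - \<rho>) \<ge> a * (1 - a) = c\<close>.\<close>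
  define a where "a = \<epsilon> / 2"
  define c where "c = a * (1 - a)"
  have a: "0 < a" "a < 1" using \<epsilon> by (auto simp: a_def)
  have c: "0 < c" using a by (simp add: c_def)
  \<comment> \<open>Makes \<open>(t - s) * r / c \<le> e / 2\<close>; the \<open>+ 1\<close> covers
    \<open>s = t\<close>.\<close>
  define r where "r = e * c / (2 * (t - s + 1))"
  have r: "0 < r" using e c s by (simp add: r_def)
  define C where "C = K\<^sup>2 / c\<^sup>2 + (t - s) * (K\<^sup>2 / c\<^sup>2 * (1 + K\<^sup>2))"
  have "(\<lambda>n. 1 / real n * C) \<longlonglongrightarrow> 0"
    using tendsto_mult[OF lim_1_over_n tendsto_const[of C]] by simp
  then have "\<forall>\<^sub>F n in sequentially. 1 / real n * C < e / 2"
    by (rule order_tendstoD) (use e in simp)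
  with lap[OF r] eventually_ge_at_top[of 2] show ?thesis
  proof eventually_elim
    case (elim n)
    have n: "2 \<le> n" by fact
    let ?\<rho> = "\<lambda>i u. mix \<epsilon> (m u (real i / real n))"
    have pos: "0 < u" if "s \<le> u" for u using that s by linarith
    have per: "torus_periodic (m u)" if "s \<le> u" for u
      using heat_solution_continuous(1)[OF heat pos[OF that]] .
    have \<rho>: "a \<le> ?\<rho> i u" "?\<rho> i u \<le> 1 - a" if "s \<le> u" for i u
      using mix_bounds[OF \<epsilon>] m01[OF pos[OF that]] by (auto simp: a_def)
    have site: "0 \<le> real i / real n" "real i / real n \<le> 1" if "i < n" for i
      using that by auto
    have "ent n (law n (Q n) t) (bern n (\<lambda>i. ?\<rho> i t)) \<le> ent n (law n (Q n) s) (bern n (\<lambda>i. ?\<rho> i s)) +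
     K\<^sup>2 / c\<^sup>2 + (t - s) * (real n * r / c + K\<^sup>2 / c\<^sup>2 * (1 + K\<^sup>2))"
    proof (rule ent_growth[where \<rho>' = "\<lambda>i u. (1 - \<epsilon>) * m_t u (real i / real n)", OF n _ s(2) c])
      show "0 \<le> s" using s by simp
      show "\<And>\<eta>. \<eta> \<in> configs n \<Longrightarrow> 0 \<le> Q n \<eta>" "(\<Sum>\<eta>\<in>configs n. Q n \<eta>) = 1"
        using Q[of n] n by (auto simp: pvec_def)
      fix i u assume i: "i < n" and u: "s \<le> u" "u \<le> t"
      show "0 < ?\<rho> i u \<and> ?\<rho> i u < 1" using \<rho>[OF u(1), of i] a by linarith
      have "0 \<le> (?\<rho> i u - a) * (1 - a - ?\<rho> i u)"
        using \<rho>[OF u(1), of i] by (intro mult_nonneg_nonneg) auto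
      then show "c \<le> ?\<rho> i u * (1 - ?\<rho> i u)" by (simp add: c_def algebra_simps)
      show "(?\<rho> i has_real_derivative (1 - \<epsilon>) * m_t u (real i / real n)) (at u)"
        unfolding mix_def by (auto intro!: derivative_eq_intros dt pos u)
      have "(real n)\<^sup>2 * (?\<rho> (nxt n i) u + ?\<rho> (prv n i) u - 2 * ?\<rho> i u) - (1 - \<epsilon>) * m_t u (real i / real n) =
          (1 - \<epsilon>) * ((real n)\<^sup>2 * (m u (real i / real n + 1 / real n) + m u (real i / real n - 1 / real n) - 2 * m u (real i / real n)) -
            m_t u (real i / real n))"
        unfolding periodic_site[OF per[OF u(1)] n i] by (simp add: mix_def algebra_simps)
      also have "\<bar>\<dots>\<bar> \<le> 1 * r"
        unfolding abs_mult using elim(1) site[OF i] u \<epsilon> by (intro mult_mono) auto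
      finally show "\<bar>(real n)\<^sup>2 * (?\<rho> (nxt n i) u + ?\<rho> (prv n i) u - 2 * ?\<rho> i u) - (1 - \<epsilon>) * m_t u (real i / real n)\<bar> \<le> r"
        by simp
      have "real n * (?\<rho> (nxt n i) u - ?\<rho> i u) = (1 - \<epsilon>) * (real n * (m u (real i / real n + 1 / real n) - m u (real i / real n)))"
        unfolding periodic_site[OF per[OF u(1)] n i] by (simp add: mix_def algebra_simps)
      also have "\<bar>\<dots>\<bar> \<le> 1 * K"
        unfolding abs_mult[of "1 - \<epsilon>"] using grad[OF u site[OF i], of n] n \<epsilon> by (intro mult_mono) auto
      finally show "\<bar>real n * (?\<rho> (nxt n i) u - ?\<rho> i u)\<bar> \<le> K" by simp
    qed
    also have "\<dots> = ent n (law n (Q n) s) (bern n (\<lambda>i. ?\<rho> i s)) + (C + real n * ((t - s) * r / c))"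
      by (simp add: C_def algebra_simps)
    finally have "(1 / real n) * ent n (law n (Q n) t) (bern n (\<lambda>i. ?\<rho> i t)) \<le>
        (1 / real n) * (ent n (law n (Q n) s) (bern n (\<lambda>i. ?\<rho> i s)) + (C + real n * ((t - s) * r / c)))"
      by (intro mult_left_mono) auto
    also have "\<dots> = (1 / real n) * ent n (law n (Q n) s) (bern n (\<lambda>i. ?\<rho> i s)) + 1 / real n * C + (t - s) * r / c"
      using n by (simp add: distrib_left)
    also have "(t - s) * r / c \<le> e / 2"
    proof -
      have "(t - s) * r / c = e / 2 * ((t - s) / (t - s + 1))"
        using c by (simp add: r_def)
      also have "\<dots> \<le> e / 2 * 1"
        using e s by (intro mult_left_mono) auto
      finally show ?thesis by simp
    qed
    finally show ?case using elim(3) by linarith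
  qed
qed

text \<open>Mixing keeps the logarithms continuous even where \<open>f\<close> is 0 or 1, so both
  parts of \<open>ent_change_reference\<close> converge: the linear functional by the law of large
  numbers, the constant as a Riemann sum.\<close>

lemma log_density_tendsto:
  assumes Q: "\<And>n. 1 \<le> n \<Longrightarrow> pvec n (Q n)" and f: "continuous_on UNIV f" "torus_periodic f"
    and f01: "\<And>\<theta>. 0 \<le> f \<theta> \<and> f \<theta> \<le> 1"
    and lln: "\<And>G. continuous_on UNIV G \<Longrightarrow> torus_periodic G \<Longrightarrow>
       (\<lambda>n. mean_dev n (Q n) G (torus_integral (\<lambda>\<theta>. G \<theta> * f \<theta>))) \<longlonglongrightarrow> 0"
    and \<epsilon>: "0 < \<epsilon>" "\<epsilon> < 1" and \<alpha>: "0 < \<alpha>" "\<alpha> < 1"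
  shows "(\<lambda>n. (1 / real n) * (ent n (Q n) (bern n (\<lambda>_. \<alpha>)) - ent n (Q n) (bern n (\<lambda>i. mix \<epsilon> (f (real i / real n))))))
    \<longlonglongrightarrow> torus_integral (\<lambda>\<theta>. cross_entropy \<epsilon> (f \<theta>)) -
      (torus_integral f * ln \<alpha> + (1 - torus_integral f) * ln (1 - \<alpha>))"
proof -
  define K where "K \<theta> = ln ((1 - mix \<epsilon> (f \<theta>)) / (1 - \<alpha>))" for \<theta>
  define G where "G \<theta> = ln (mix \<epsilon> (f \<theta>) / \<alpha>) - K \<theta>" for \<theta>
  have cf: "continuous_on A f" for A using continuous_on_subset[OF f(1)] by auto
  have mix01: "0 < mix \<epsilon> (f \<theta>)" "mix \<epsilon> (f \<theta>) < 1" for \<theta>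
    using mix_bounds[OF \<epsilon>, of "f \<theta>"] f01[of \<theta>] \<epsilon> by auto
  have cmix: "continuous_on A (\<lambda>\<theta>. mix \<epsilon> (f \<theta>))" for A
    unfolding mix_def by (intro continuous_intros cf)
  have cK: "continuous_on A K" for A
    unfolding K_def[abs_def] using mix01 \<alpha> by (intro continuous_intros cmix) (auto simp: less_imp_neq[symmetric])
  have cG: "continuous_on A G" for A
    unfolding G_def[abs_def] using mix01 \<alpha> by (intro continuous_intros cmix cK) (auto simp: less_imp_neq[symmetric])
  have per: "torus_periodic G"
    using f(2) by (simp add: torus_periodic_def G_def K_def)
  have "(\<lambda>n. (\<Sum>\<eta>\<in>configs n. Q n \<eta> * empirical_mean n \<eta> G) + 1 / real n * (\<Sum>i<n. K (real i / real n)))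
      \<longlonglongrightarrow> torus_integral (\<lambda>\<theta>. G \<theta> * f \<theta>) + torus_integral K"
    by (intro tendsto_add expectation_tendsto[OF Q lln] riemann_sum_tendsto cG cK per)
  moreover have "torus_integral (\<lambda>\<theta>. G \<theta> * f \<theta>) + torus_integral K = torus_integral (\<lambda>\<theta>. cross_entropy \<epsilon> (f \<theta>)) -
      (torus_integral f * ln \<alpha> + (1 - torus_integral f) * ln (1 - \<alpha>))"
  proof -
    let ?d = "ln \<alpha> - ln (1 - \<alpha>)"
    have cc: "continuous_on A (\<lambda>\<theta>. cross_entropy \<epsilon> (f \<theta>))" for A
      unfolding cross_entropy_def using mix01 by (intro continuous_intros cmix cf) (auto simp: less_imp_neq[symmetric])
    have eq: "G \<theta> * f \<theta> + K \<theta> = cross_entropy \<epsilon> (f \<theta>) - (?d * f \<theta> + ln (1 - \<alpha>))" for \<theta>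
      using mix01[of \<theta>] \<alpha> by (simp add: G_def K_def cross_entropy_def ln_div algebra_simps)
    have "torus_integral (\<lambda>\<theta>. G \<theta> * f \<theta>) + torus_integral K = torus_integral (\<lambda>\<theta>. G \<theta> * f \<theta> + K \<theta>)"
      by (intro torus_integral_add[symmetric] torus_integrable_continuous continuous_intros cG cK cf)
    also have "\<dots> = torus_integral (\<lambda>\<theta>. cross_entropy \<epsilon> (f \<theta>)) - torus_integral (\<lambda>\<theta>. ?d * f \<theta> + ln (1 - \<alpha>))"
      unfolding eq by (intro torus_integral_diff torus_integrable_continuous continuous_intros cc cf)
    also have "torus_integral (\<lambda>\<theta>. ?d * f \<theta> + ln (1 - \<alpha>)) = torus_integral (\<lambda>\<theta>. ?d * f \<theta>) + torus_integral (\<lambda>_. ln (1 - \<alpha>))"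
      by (intro torus_integral_add torus_integrable_continuous continuous_intros cf)
    finally show ?thesis
      by (simp only: torus_integral_cmult torus_integral_const) (simp add: algebra_simps)
  qed
  ultimately have lim: "(\<lambda>n. (\<Sum>\<eta>\<in>configs n. Q n \<eta> * empirical_mean n \<eta> G) + 1 / real n * (\<Sum>i<n. K (real i / real n)))
      \<longlonglongrightarrow> torus_integral (\<lambda>\<theta>. cross_entropy \<epsilon> (f \<theta>)) -
      (torus_integral f * ln \<alpha> + (1 - torus_integral f) * ln (1 - \<alpha>))" by simp
  show ?thesis
  proof (rule Lim_transform_eventually[OF lim])
    show "\<forall>\<^sub>F n in sequentially. (\<Sum>\<eta>\<in>configs n. Q n \<eta> * empirical_mean n \<eta> G) + 1 / real n * (\<Sum>i<n. K (real i / real n)) =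
       (1 / real n) * (ent n (Q n) (bern n (\<lambda>_. \<alpha>)) - ent n (Q n) (bern n (\<lambda>i. mix \<epsilon> (f (real i / real n)))))"
      using eventually_ge_at_top[of 1]
    proof eventually_elim
      case (elim n)
      have "ent n (Q n) (bern n (\<lambda>_. \<alpha>)) = ent n (Q n) (bern n (\<lambda>i. mix \<epsilon> (f (real i / real n)))) +
        ((\<Sum>\<eta>\<in>configs n. Q n \<eta> * (\<Sum>i<n. G (real i / real n) * real (\<eta> i))) + (\<Sum>i<n. K (real i / real n)))"
        unfolding G_def K_def by (rule ent_change_reference[OF Q[OF elim]]) (use mix01 \<alpha> in auto)
      then show ?case
        by (simp add: empirical_mean_def sum_divide_distrib[symmetric] add_divide_distrib)
    qed
  qed
qed

text \<open>The wave of frequency 0 and phase 0 is the constant 1 and does not decay.\<close>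

lemma heat_mass_conservation:
  assumes "heat_solution m0 m" "density_profile m0" "0 < t"
  shows "torus_integral (m t) = torus_integral m0"
  using heat_wave_evolution[OF assms, of 0 0] by (simp add: wave_def)

text \<open>At time 0 the solution converges in \<open>L\<^sup>1\<close>, which
  \<open>h_modulus\<close> converts into convergence of the entropies.\<close>

lemma heat_entropy_tendsto_initial:
  assumes heat: "heat_solution m0 m" and m0: "density_profile m0"
    and m01: "\<And>u \<theta>. 0 < u \<Longrightarrow> 0 \<le> m u \<theta> \<and> m u \<theta> \<le> 1"
  shows "((\<lambda>t. torus_integral (\<lambda>\<theta>. h (m t \<theta>))) \<longlongrightarrow> torus_integral (\<lambda>\<theta>. h (m0 \<theta>))) (at_right 0)"
proof (rule tendstoI)
  fix e :: real assume e: "0 < e"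
  obtain C where C0: "0 \<le> C"
    and C: "\<And>x y. 0 \<le> x \<Longrightarrow> x \<le> 1 \<Longrightarrow> 0 \<le> y \<Longrightarrow> y \<le> 1 \<Longrightarrow> \<bar>h x - h y\<bar> \<le> e / 2 + C * \<bar>x - y\<bar>"
    using h_modulus[of "e / 2"] e by (metis half_gt_zero)
  have m0': "m0 \<in> borel_measurable borel" "\<And>\<theta>. 0 \<le> m0 \<theta> \<and> m0 \<theta> \<le> 1"
    using m0 by (auto simp: density_profile_def)
  have "((\<lambda>t. torus_integral (\<lambda>\<theta>. \<bar>m t \<theta> - m0 \<theta>\<bar>)) \<longlongrightarrow> 0) (at_right 0)"
    using heat by (simp add: heat_solution_def)
  then have "((\<lambda>t. C * torus_integral (\<lambda>\<theta>. \<bar>m t \<theta> - m0 \<theta>\<bar>)) \<longlongrightarrow> C * 0) (at_right 0)"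
    by (rule tendsto_mult_left)
  then have "\<forall>\<^sub>F t in at_right 0. C * torus_integral (\<lambda>\<theta>. \<bar>m t \<theta> - m0 \<theta>\<bar>) < e / 2"
    by (rule order_tendstoD) (use e in simp)
  moreover have "\<forall>\<^sub>F t::real in at_right 0. 0 < t"
    by (simp add: eventually_at_right_less)
  ultimately show "\<forall>\<^sub>F t in at_right 0. dist (torus_integral (\<lambda>\<theta>. h (m t \<theta>))) (torus_integral (\<lambda>\<theta>. h (m0 \<theta>))) < e"
  proof eventually_elim
    case (elim t)
    have mt: "m t \<in> borel_measurable borel"
      by (intro borel_measurable_continuous_onI heat_solution_continuous[OF heat elim(2)])
    have i1: "set_integrable lborel {0..<1} (\<lambda>\<theta>. h (m t \<theta>))"
      by (rule h_integrable[OF mt m01[OF elim(2)]])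
    have i2: "set_integrable lborel {0..<1} (\<lambda>\<theta>. h (m0 \<theta>))"
      by (rule h_integrable[OF m0'])
    have i3: "set_integrable lborel {0..<1} (\<lambda>\<theta>. \<bar>m t \<theta> - m0 \<theta>\<bar>)"
    proof (rule torus_integrable[where B = 1])
      show "\<bar>\<bar>m t \<theta> - m0 \<theta>\<bar>\<bar> \<le> 1" for \<theta>
        using m01[OF elim(2), of \<theta>] m0'(2)[of \<theta>] by (auto simp: abs_le_iff)
    qed (use mt m0' in simp)
    have "\<bar>torus_integral (\<lambda>\<theta>. h (m t \<theta>) - h (m0 \<theta>))\<bar> \<le> torus_integral (\<lambda>\<theta>. e / 2 + C * \<bar>m t \<theta> - m0 \<theta>\<bar>)"
      using C m01[OF elim(2)] m0'(2)
      by (intro torus_integral_abs_le set_integral_diff(1)[OF i1 i2] set_integral_add(1) set_integrable_mult_right i3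
            torus_integrable_continuous continuous_intros) auto
    also have "\<dots> = torus_integral (\<lambda>_. e / 2) + torus_integral (\<lambda>\<theta>. C * \<bar>m t \<theta> - m0 \<theta>\<bar>)"
      by (intro torus_integral_add set_integrable_mult_right i3 torus_integrable_continuous continuous_intros)
    finally show ?case
      using elim(1) by (simp add: torus_integral_diff[OF i1 i2] torus_integral_cmult dist_real_def)
  qed
qed

lemma torus_cross_entropy_bound:
  assumes f: "continuous_on UNIV f" and f01: "\<And>\<theta>. 0 \<le> f \<theta> \<and> f \<theta> \<le> 1" and \<epsilon>: "0 < \<epsilon>" "\<epsilon> < 1"
  shows "\<bar>torus_integral (\<lambda>\<theta>. cross_entropy \<epsilon> (f \<theta>)) - torus_integral (\<lambda>\<theta>. h (f \<theta>))\<bar> \<le> - 2 * ln (1 - \<epsilon>)"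
proof -
  have cf: "continuous_on A f" for A using continuous_on_subset[OF f] by auto
  have mix01: "0 < mix \<epsilon> (f \<theta>)" "mix \<epsilon> (f \<theta>) < 1" for \<theta>
    using mix_bounds[OF \<epsilon>, of "f \<theta>"] f01[of \<theta>] \<epsilon> by auto
  have i1: "set_integrable lborel {0..<1} (\<lambda>\<theta>. cross_entropy \<epsilon> (f \<theta>))"
    unfolding cross_entropy_def mix_def
    using mix01 by (intro torus_integrable_continuous continuous_intros cf) (auto simp: mix_def less_imp_neq[symmetric])
  have i2: "set_integrable lborel {0..<1} (\<lambda>\<theta>. h (f \<theta>))"
    by (rule h_integrable[OF borel_measurable_continuous_onI[OF f] f01])
  have "\<bar>torus_integral (\<lambda>\<theta>. cross_entropy \<epsilon> (f \<theta>) - h (f \<theta>))\<bar> \<le> torus_integral (\<lambda>_. - 2 * ln (1 - \<epsilon>))"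
    using f01 by (intro torus_integral_abs_le set_integral_diff(1)[OF i1 i2] cross_entropy_bound \<epsilon>
        torus_integrable_continuous continuous_intros) auto
  then show ?thesis by (simp add: torus_integral_diff[OF i1 i2])
qed

text \<open>The terms depending on \<alpha> are the same number \<open>l\<close> at the times
  \<open>s\<close> and \<open>t\<close>, because the mass is conserved, and cancel in the upper
  bound. In the lower bound \<open>l\<close> stays and is at most \<open>h mb\<close> by Gibbs'
  inequality.\<close>

lemma entropy_convergence:
  assumes \<alpha>: "0 < \<alpha>" "\<alpha> < 1" and m0: "density_profile m0" and heat: "heat_solution m0 m"
    and Q: "\<And>n. 1 \<le> n \<Longrightarrow> pvec n (Q n)"
    and m01: "\<And>u \<theta>. 0 < u \<Longrightarrow> 0 \<le> m u \<theta> \<and> m u \<theta> \<le> 1"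
    and lln: "\<And>u G. 0 < u \<Longrightarrow> continuous_on UNIV G \<Longrightarrow> torus_periodic G \<Longrightarrow>
       (\<lambda>n. mean_dev n (law n (Q n) u) G (torus_integral (\<lambda>\<theta>. G \<theta> * m u \<theta>))) \<longlonglongrightarrow> 0"
    and init: "(\<lambda>n. (1 / real n) * ent n (Q n) (bern n (\<lambda>_. \<alpha>))) \<longlonglongrightarrow>
       torus_integral (\<lambda>\<theta>. h (m0 \<theta>)) - h (torus_integral m0)"
    and t: "0 < t"
  shows "(\<lambda>n. (1 / real n) * ent n (law n (Q n) t) (bern n (\<lambda>_. \<alpha>))) \<longlonglongrightarrow>
     torus_integral (\<lambda>\<theta>. h (m t \<theta>)) - h (torus_integral (m t))"
proof (rule tendstoI)
  fix e :: real assume e: "0 < e"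
  define H where "H u = torus_integral (\<lambda>\<theta>. h (m u \<theta>))" for u
  define mb where "mb = torus_integral m0"
  define l where "l = mb * ln \<alpha> + (1 - mb) * ln (1 - \<alpha>)"
  have mb01: "0 \<le> mb" "mb \<le> 1"
  proof -
    have i: "set_integrable lborel {0..<1} m0"
      using density_profile_integrable[OF m0, of "\<lambda>_. 1" 1] by simp
    have ic: "set_integrable lborel {0..<1} (\<lambda>_::real. c)" for c :: real
      by (intro torus_integrable_continuous continuous_intros)
    show "0 \<le> mb" "mb \<le> 1"
      using torus_integral_mono[OF ic i, of 0] torus_integral_mono[OF i ic, of 1] m0
      by (auto simp: mb_def density_profile_def)
  qed
  have gibbs: "l \<le> h mb"
    unfolding l_def by (rule gibbs_bernoulli[OF \<alpha> mb01])
  have mass: "torus_integral (m u) = mb" if "0 < u" for u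
    unfolding mb_def by (rule heat_mass_conservation[OF heat m0 that])
  \<comment> \<open>Solves \<open>- 2 * ln (1 - \<epsilon>) = e / 16\<close>, the error in
    \<open>torus_cross_entropy_bound\<close>.\<close>
  define \<epsilon> where "\<epsilon> = 1 - exp (- (e / 32))"
  have \<epsilon>: "0 < \<epsilon>" "\<epsilon> < 1" "- 2 * ln (1 - \<epsilon>) = e / 16" using e by (auto simp: \<epsilon>_def)
  have "\<forall>\<^sub>F s in at_right 0. dist (H s) (torus_integral (\<lambda>\<theta>. h (m0 \<theta>))) < e / 8"
    unfolding H_def using heat_entropy_tendsto_initial[OF heat m0 m01] e by (intro tendstoD) auto
  moreover have "\<forall>\<^sub>F s in at_right 0. s \<in> {0<..<t}"
    using eventually_at_right_real[OF t] .
  ultimately have "\<forall>\<^sub>F s in at_right 0. dist (H s) (torus_integral (\<lambda>\<theta>. h (m0 \<theta>))) < e / 8 \<and> s \<in> {0<..<t}"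
    by eventually_elim simp
  then obtain s where s: "0 < s" "s < t" and Hs: "\<bar>H s - torus_integral (\<lambda>\<theta>. h (m0 \<theta>))\<bar> < e / 8"
    using eventually_happens'[OF trivial_limit_at_right_real] by (force simp: dist_real_def)
  define L where "L n u = (1 / real n) * ent n (law n (Q n) u) (bern n (\<lambda>_. \<alpha>))" for n u
  define R where "R n u = (1 / real n) * ent n (law n (Q n) u) (bern n (\<lambda>i. mix \<epsilon> (m u (real i / real n))))" for n u
  define X where "X u = torus_integral (\<lambda>\<theta>. cross_entropy \<epsilon> (m u \<theta>))" for u
  have X: "\<bar>X u - H u\<bar> \<le> e / 16" if "0 < u" for u
    unfolding X_def H_def \<epsilon>(3)[symmetric]
    by (rule torus_cross_entropy_bound[OF heat_solution_continuous(2)[OF heat that] m01[OF that] \<epsilon>(1,2)])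
  have "(\<lambda>n. L n u - R n u) \<longlonglongrightarrow> X u - l" if "0 < u" for u
  proof -
    have "(\<lambda>n. (1 / real n) * (ent n (law n (Q n) u) (bern n (\<lambda>_. \<alpha>)) -
        ent n (law n (Q n) u) (bern n (\<lambda>i. mix \<epsilon> (m u (real i / real n)))))) \<longlonglongrightarrow>
        torus_integral (\<lambda>\<theta>. cross_entropy \<epsilon> (m u \<theta>)) -
      (torus_integral (m u) * ln \<alpha> + (1 - torus_integral (m u)) * ln (1 - \<alpha>))"
      using that heat_solution_continuous[OF heat that]
      by (intro log_density_tendsto pvec_law Q m01 lln \<epsilon> \<alpha>) auto
    then show ?thesis by (simp add: L_def R_def X_def l_def mass[OF that] right_diff_distrib)
  qed
  then have J: "\<forall>\<^sub>F n in sequentially. \<bar>(L n u - R n u) - (X u - l)\<bar> < e / 8" if "0 < u" for u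
    using that e unfolding dist_real_def[symmetric] by (intro tendstoD) auto
  have "\<forall>\<^sub>F n in sequentially. \<bar>(1 / real n) * ent n (Q n) (bern n (\<lambda>_. \<alpha>)) - (torus_integral (\<lambda>\<theta>. h (m0 \<theta>)) - h mb)\<bar> < e / 8"
    unfolding mb_def dist_real_def[symmetric] using e by (intro tendstoD init) auto
  moreover have "\<forall>\<^sub>F n in sequentially. R n t \<le> R n s + e / 8"
    unfolding R_def using s e by (intro ent_heat_growth[OF heat Q m01 _ _ \<epsilon>(1,2)]) auto
  ultimately show "\<forall>\<^sub>F n in sequentially. dist ((1 / real n) * ent n (law n (Q n) t) (bern n (\<lambda>_. \<alpha>)))
     (torus_integral (\<lambda>\<theta>. h (m t \<theta>)) - h (torus_integral (m t))) < e"
    using J[OF t] J[OF s(1)] eventually_ge_at_top[of 2]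
  proof eventually_elim
    case (elim n)
    have q: "pvec n (Q n)" "pvec n (law n (Q n) t)" using elim(5) t by (auto intro!: pvec_law Q)
    have mono: "L n s \<le> (1 / real n) * ent n (Q n) (bern n (\<lambda>_. \<alpha>))"
      unfolding L_def using s by (intro mult_left_mono ent_law_antimono elim(5) q \<alpha>) auto
    have "0 \<le> ent n (law n (Q n) t) (bern n (\<lambda>i. mix \<epsilon> (m t (real i / real n))))"
    proof (rule ent_nonneg)
      show "0 < bern n (\<lambda>i. mix \<epsilon> (m t (real i / real n))) \<eta>" for \<eta>
      proof (rule bern_pos)
        fix i
        show "0 < mix \<epsilon> (m t (real i / real n)) \<and> mix \<epsilon> (m t (real i / real n)) < 1"
          using mix_bounds[OF \<epsilon>(1,2), of "m t (real i / real n)"] m01[OF t, of "real i / real n"] \<epsilon> by auto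
      qed
    qed (use q in \<open>auto simp: pvec_def sum_bern\<close>)
    then have "0 \<le> R n t" by (simp add: R_def)
    \<comment> \<open>From above, \<open>L n t\<close> is compared in turn with
      \<open>R n t\<close>, \<open>R n s\<close>, \<open>L n s\<close> and the initial entropy: four
      errors \<open>e / 8\<close>, a fifth from \<open>Hs\<close> and two of \<open>e / 16\<close>,
      in all \<open>3 * e / 4\<close>. From below, \<open>0 \<le> R n t\<close> and
      \<open>l \<le> h mb\<close>.\<close>
    then have "\<bar>L n t - (H t - h mb)\<bar> < e"
      using elim(1-4) mono Hs X[OF t] X[OF s(1)] gibbs e by linarith
    then show ?case by (simp add: L_def H_def mass[OF t] dist_real_def)
  qed
qed

theorem theorem4p2:
  fixes \<alpha> :: real
    and m0 :: "real \<Rightarrow> real"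
    and m :: "real \<Rightarrow> real \<Rightarrow> real"
    and \<mu> :: "nat \<Rightarrow> config measure"
    and M :: "nat \<Rightarrow> 'w measure"
    and X :: "nat \<Rightarrow> real \<Rightarrow> 'w \<Rightarrow> config"
  assumes alpha: "0 < \<alpha>" "\<alpha> < 1"
    and profile: "density_profile m0"
    and initial_prob: "\<And>n. n \<ge> 1 \<Longrightarrow> prob_space (\<mu> n)"
    and initial_sets: "\<And>n. n \<ge> 1 \<Longrightarrow> sets (\<mu> n) = Pow (configs n)"
    and initial_profile:
      "\<And>\<delta> G. \<delta> > 0 \<Longrightarrow> torus_smooth G \<Longrightarrow>
         limsup (\<lambda>n. ereal (measure (\<mu> n)
           {\<eta> \<in> configs n. \<bar>empirical_mean n \<eta> G - torus_integral (\<lambda>\<theta>. G \<theta> * m0 \<theta>)\<bar> > \<delta>})) = 0"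
    and initial_entropy:
      "(\<lambda>n. (1 / real n) * relative_entropy (configs n) (bernoulli_product n \<alpha>) (\<mu> n))
         \<longlonglongrightarrow> torus_integral (\<lambda>\<theta>. h (m0 \<theta>)) - h (torus_integral m0)"
    and process: "\<And>n. n \<ge> 1 \<Longrightarrow> markov_process (configs n) (ssep_generator n) (\<mu> n) (M n) (X n)"
    and heat: "heat_solution m0 m"
  shows "\<forall>t>0.
    (\<forall>G \<delta>. torus_smooth G \<longrightarrow> \<delta> > 0 \<longrightarrow>
       (\<lambda>n. measure (M n) {\<omega> \<in> space (M n).
          \<bar>empirical_mean n (X n t \<omega>) G - torus_integral (\<lambda>\<theta>. G \<theta> * m t \<theta>)\<bar> > \<delta>})
         \<longlonglongrightarrow> 0) \<and>
    (\<lambda>n. (1 / real n) * relative_entropy (configs n) (bernoulli_product n \<alpha>)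
         (distr (M n) (count_space (configs n)) (X n t)))
      \<longlonglongrightarrow> torus_integral (\<lambda>\<theta>. h (m t \<theta>)) - h (torus_integral (m t))"
proof -
  define Q where "Q n = (\<lambda>\<eta>. measure (\<mu> n) {\<eta>})" for n
  have Q: "pvec n (Q n)" if n: "1 \<le> n" for n
  proof -
    interpret prob_space "\<mu> n" by (rule initial_prob[OF n])
    have "space (\<mu> n) = configs n"
      using sets_eq_imp_space_eq[of "\<mu> n" "count_space (configs n)"] initial_sets[OF n] by simp
    then have "(\<Sum>\<eta>\<in>configs n. Q n \<eta>) = 1"
      using finite_measure_eq_sum_singleton[of "configs n"] prob_space initial_sets[OF n] by (simp add: Q_def)
    then show ?thesis by (simp add: pvec_def Q_def)
  qed
  have tail0: "measure (\<mu> n) {\<eta> \<in> configs n. \<bar>empirical_mean n \<eta> G - b\<bar> > \<delta>} = tail_prob n (Q n) G b \<delta>"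
    if n: "1 \<le> n" for n G b \<delta>
  proof -
    interpret prob_space "\<mu> n" by (rule initial_prob[OF n])
    show ?thesis
      unfolding tail_prob_def Q_def using initial_sets[OF n] by (intro finite_measure_eq_sum_singleton) auto
  qed
  have init: "(\<lambda>n. tail_prob n (Q n) G (torus_integral (\<lambda>\<theta>. G \<theta> * m0 \<theta>)) \<delta>) \<longlonglongrightarrow> 0"
    if G: "torus_smooth G" and \<delta>: "0 < \<delta>" for G \<delta>
  proof -
    let ?p = "\<lambda>n. measure (\<mu> n) {\<eta> \<in> configs n. \<bar>empirical_mean n \<eta> G - torus_integral (\<lambda>\<theta>. G \<theta> * m0 \<theta>)\<bar> > \<delta>}"
    \<comment> \<open>The hypothesis speaks of the upper limit; probabilities are nonnegative, so
      the sequence itself converges.\<close>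
    have "?p \<longlonglongrightarrow> 0"
    proof (rule limsup_le_liminf_real)
      show "limsup (\<lambda>n. ereal (?p n)) \<le> ereal 0" using initial_profile[OF \<delta> G] by simp
      show "ereal 0 \<le> liminf (\<lambda>n. ereal (?p n))" by (rule Liminf_bounded) simp
    qed
    then show ?thesis
      by (rule Lim_transform_eventually) (auto intro!: eventually_mono[OF eventually_ge_at_top[of 1]] tail0)
  qed
  have lln: "(\<lambda>n. mean_dev n (law n (Q n) u) G (torus_integral (\<lambda>\<theta>. G \<theta> * m u \<theta>))) \<longlonglongrightarrow> 0"
    if "0 < u" "continuous_on UNIV G" "torus_periodic G" for u G
    by (rule heat_lln[OF profile heat Q init that])
  \<comment> \<open>Not part of \<open>heat_solution\<close>: the bounds are inherited from the
    particle system through the law of large numbers.\<close>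
  have m01: "0 \<le> m u \<theta> \<and> m u \<theta> \<le> 1" if u: "0 < u" for u \<theta>
    using lln_density_bounds[OF _ heat_solution_continuous(2,1)[OF heat u] lln[OF u]]
      pvec_law[OF Q less_imp_le[OF u]] by simp
  have init_ent: "(\<lambda>n. (1 / real n) * ent n (Q n) (bern n (\<lambda>_. \<alpha>))) \<longlonglongrightarrow>
       torus_integral (\<lambda>\<theta>. h (m0 \<theta>)) - h (torus_integral m0)"
    using initial_entropy unfolding relative_entropy_eq_ent[OF alpha] Q_def .
  show ?thesis
  proof (intro allI impI conjI)
    fix t :: real and G :: "real \<Rightarrow> real" and \<delta> :: real
    assume t: "0 < t" and G: "torus_smooth G" and \<delta>: "0 < \<delta>"
    let ?b = "torus_integral (\<lambda>\<theta>. G \<theta> * m t \<theta>)"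
    have "\<forall>\<theta>. ((deriv ^^ 0) G) differentiable (at \<theta>)"
      using G unfolding torus_smooth_def by blast
    then have "continuous_on UNIV G"
      by (auto intro!: differentiable_imp_continuous_on simp: differentiable_on_def)
    then have "(\<lambda>n. mean_dev n (law n (Q n) t) G ?b) \<longlonglongrightarrow> 0"
      using lln t G by (simp add: torus_smooth_def)
    from tendsto_divide[OF this tendsto_const[of \<delta>]] have "(\<lambda>n. mean_dev n (law n (Q n) t) G ?b / \<delta>) \<longlonglongrightarrow> 0"
      using \<delta> by simp
    then show "(\<lambda>n. measure (M n) {\<omega> \<in> space (M n). \<bar>empirical_mean n (X n t \<omega>) G - ?b\<bar> > \<delta>}) \<longlonglongrightarrow> 0"
    proof (rule Lim_null_comparison[rotated])
      show "\<forall>\<^sub>F n in sequentially. norm (measure (M n) {\<omega> \<in> space (M n). \<bar>empirical_mean n (X n t \<omega>) G - ?b\<bar> > \<delta>}) \<le>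
          mean_dev n (law n (Q n) t) G ?b / \<delta>"
        using eventually_ge_at_top[of 1]
      proof eventually_elim
        case (elim n)
        then show ?case
          using tail_prob_le_mean_dev[OF pvec_law[OF Q[OF elim] less_imp_le[OF t]] \<delta>, where G = G and b = ?b]
            markov_process_tail[OF process[OF elim] less_imp_le[OF t], where G = G and b = ?b and \<delta> = \<delta>]
            tail_prob_nonneg[OF pvec_law[OF Q[OF elim] less_imp_le[OF t]], of G ?b \<delta>]
          by (simp add: Q_def)
      qed
    qed
  next
    fix t :: real assume t: "0 < t"
    show "(\<lambda>n. (1 / real n) * relative_entropy (configs n) (bernoulli_product n \<alpha>)
         (distr (M n) (count_space (configs n)) (X n t)))
      \<longlonglongrightarrow> torus_integral (\<lambda>\<theta>. h (m t \<theta>)) - h (torus_integral (m t))"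
    proof (rule Lim_transform_eventually[OF entropy_convergence[OF alpha profile heat Q m01 lln init_ent t]])
      show "\<forall>\<^sub>F n in sequentially. (1 / real n) * ent n (law n (Q n) t) (bern n (\<lambda>_. \<alpha>)) =
         (1 / real n) * relative_entropy (configs n) (bernoulli_product n \<alpha>) (distr (M n) (count_space (configs n)) (X n t))"
        using eventually_ge_at_top[of 1]
      proof eventually_elim
        case (elim n)
        have X: "X n t \<in> M n \<rightarrow>\<^sub>M count_space (configs n)"
          using process[OF elim] t by (auto simp: markov_process_def)
        have "law n (Q n) t \<eta> = measure (distr (M n) (count_space (configs n)) (X n t)) {\<eta>}" if "\<eta> \<in> configs n" for \<eta>
          using markov_process_law[OF process[OF elim] less_imp_le[OF t] that] that
          by (simp add: measure_distr[OF X] Q_def)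
        then show ?case
          by (simp add: relative_entropy_eq_ent[OF alpha] ent_def)
      qed
    qed auto
  qed
qed

end
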